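(* Let $G$ be a finite group, $p$ a prime, and $P$ a normal $p$-subgroup of $G$. Suppose that $P$ has a subgroup $D$ such that $1\leq |D|<|P|$ and every proper subgroup $H$ of $P$ with $|H|=p^n|D|$ ($n=0,1$) either is $\Pi$-supplemented in $G$ or has a $p$-supersoluble supplement in $G$. If $P$ is not quaternion-free and $|D|=1$, suppose further that every cyclic subgroup of $P$ of order $4$ either is $\Pi$-supplemented in $G$ or has a $2$-supersoluble supplement in $G$. Then $P\leq Z_{\mathcal{U}}(G)$.
   Context: All groups are finite. $\pi(G)$ is the set of prime divisors of $|G|$; an integer is a $\pi$-number if all its prime divisors lie in the set of primes $\pi$ (so an $\emptyset$-number is $1$). A subgroup $H$ of $G$ satisfies the $\Pi$-property in $G$ if for every chief factor $L/K$ of $G$, the index $|G/K:N_{G/K}(HK/K\cap L/K)|$ is a $\pi(HK/K\cap L/K)$-number. A subgroup $H$ of $G$ is $\Pi$-supplemented in $G$ if there is a subgroup $T$ of $G$ with $G=HT$ and $H\cap T\leq I\leq H$ for some subgroup $I$ that satisfies the $\Pi$-property in $G$. A supplement of $H$ in $G$ is a subgroup $T\leq G$ with $G=HT$. A group is $p$-supersoluble if each of its chief factors is either a $p'$-group or of order $p$. A $2$-group is quaternion-free if it has no section isomorphic to the quaternion group of order $8$; $p$-groups with $p$ odd are quaternion-free. $\mathcal{U}$ is the class of finite supersoluble groups. A chief factor $L/K$ of $G$ is $\mathcal{U}$-central in $G$ if $(L/K)\rtimes(G/C_G(L/K))\in\mathcal{U}$. A normal subgroup $N$ of $G$ is $\mathcal{U}$-hypercentral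 in $G$ if every chief factor of $G$ below $N$ is $\mathcal{U}$-central in $G$. $Z_{\mathcal{U}}(G)$ is the product of all $\mathcal{U}$-hypercentral normal subgroups of $G$. *)

theory Defs
  imports "HOL-Algebra.Algebra"
begin

text \<open>
  Subgroups of a group \<open>G\<close> are represented by their carrier sets.  For \<open>K\<close> normal in \<open>G\<close> and
  \<open>K \<subseteq> L\<close>, the factor \<open>L/K\<close> is the group \<open>G\<lparr>carrier := L\<rparr> Mod K\<close>, whose carrier (the cosets of
  \<open>K\<close> contained in \<open>L\<close>) is a subgroup of \<open>G Mod K\<close>.
\<close>

abbreviation factor_group ::
  "('a, 'b) monoid_scheme \<Rightarrow> 'a set \<Rightarrow> 'a set \<Rightarrow> 'a set monoid"
  where "factor_group G L K \<equiv> (G\<lparr>carrier := L\<rparr>) Mod K"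

definition chief_factor :: "('a, 'b) monoid_scheme \<Rightarrow> 'a set \<Rightarrow> 'a set \<Rightarrow> bool"
  where "chief_factor G L K \<longleftrightarrow>
    L \<lhd> G \<and> K \<lhd> G \<and> K \<subset> L \<and>
    (\<forall>M. M \<lhd> G \<and> K \<subseteq> M \<and> M \<subseteq> L \<longrightarrow> M = K \<or> M = L)"

definition pi_number :: "nat set \<Rightarrow> nat \<Rightarrow> bool"
  where "pi_number \<pi> n \<longleftrightarrow> prime_factors n \<subseteq> \<pi>"

definition Pi_property :: "('a, 'b) monoid_scheme \<Rightarrow> 'a set \<Rightarrow> bool"
  where "Pi_property G H \<longleftrightarrow>
    (\<forall>L K. chief_factor G L K \<longrightarrow>
      (let A = carrier (factor_group G (H <#>\<^bsub>G\<^esub> K) K) \<inter> carrier (factor_group G L K)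
       in pi_number (prime_factors (card A))
            (card (rcosets\<^bsub>G Mod K\<^esub> (normalizer (G Mod K) A)))))"

definition Pi_supplemented :: "('a, 'b) monoid_scheme \<Rightarrow> 'a set \<Rightarrow> bool"
  where "Pi_supplemented G H \<longleftrightarrow>
    (\<exists>T. subgroup T G \<and> H <#>\<^bsub>G\<^esub> T = carrier G \<and>
      (\<exists>I. subgroup I G \<and> H \<inter> T \<subseteq> I \<and> I \<subseteq> H \<and> Pi_property G I))"

definition p_supersoluble :: "nat \<Rightarrow> ('a, 'b) monoid_scheme \<Rightarrow> bool"
  where "p_supersoluble p G \<longleftrightarrow>
    (\<forall>L K. chief_factor G L K \<longrightarrow>
      \<not> p dvd order (factor_group G L K) \<or> order (factor_group G L K) = p)"

definition has_p_supersoluble_supplement ::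
  "nat \<Rightarrow> ('a, 'b) monoid_scheme \<Rightarrow> 'a set \<Rightarrow> bool"
  where "has_p_supersoluble_supplement p G H \<longleftrightarrow>
    (\<exists>T. subgroup T G \<and> H <#>\<^bsub>G\<^esub> T = carrier G \<and> p_supersoluble p (G\<lparr>carrier := T\<rparr>))"

text \<open>
  The quaternion group of order 8 consists of the units \<open>\<plusminus>1, \<plusminus>i, \<plusminus>j, \<plusminus>k\<close> under Hamilton's
  multiplication; the quadruple \<open>(a, b, c, d)\<close> stands for \<open>a + bi + cj + dk\<close>.
\<close>

definition quaternion_group :: "(int \<times> int \<times> int \<times> int) monoid"
  where "quaternion_group =
    \<lparr>carrier = {(1, 0, 0, 0), (-1, 0, 0, 0), (0, 1, 0, 0), (0, -1, 0, 0),
                (0, 0, 1, 0), (0, 0, -1, 0), (0, 0, 0, 1), (0, 0, 0, -1)},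
     monoid.mult = (\<lambda>(a, b, c, d) (a', b', c', d').
       (a * a' - b * b' - c * c' - d * d',
        a * b' + b * a' + c * d' - d * c',
        a * c' - b * d' + c * a' + d * b',
        a * d' + b * c' - c * b' + d * a')),
     one = (1, 0, 0, 0)\<rparr>"

text \<open>For a \<open>p\<close>-group \<open>P\<close>; by convention the condition is void when \<open>p\<close> is odd.\<close>

definition quaternion_free :: "nat \<Rightarrow> ('a, 'b) monoid_scheme \<Rightarrow> bool"
  where "quaternion_free p P \<longleftrightarrow>
    (p = 2 \<longrightarrow>
      \<not> (\<exists>A B. subgroup A P \<and> B \<lhd> (P\<lparr>carrier := A\<rparr>) \<and>
            factor_group P A B \<cong> quaternion_group))"

text \<open>The class of finite supersoluble groups: there is a finite series of normal subgroups of the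
  whole group, from \<open>1\<close> to the group, with cyclic factors.\<close>

definition supersoluble :: "('a, 'b) monoid_scheme \<Rightarrow> bool"
  where "supersoluble G \<longleftrightarrow> group G \<and> finite (carrier G) \<and>
    (\<exists>(N :: nat \<Rightarrow> 'a set) n. N 0 = {\<one>\<^bsub>G\<^esub>} \<and> N n = carrier G \<and>
      (\<forall>i\<le>n. N i \<lhd> G) \<and>
      (\<forall>i<n. N i \<subseteq> N (Suc i) \<and> cyclic_group (factor_group G (N (Suc i)) (N i))))"

text \<open>External semidirect product of \<open>N\<close> by \<open>Q\<close>, where \<open>\<phi> q\<close> is the automorphism of \<open>N\<close> induced by \<open>q\<close>.\<close>

definition semidirect_product ::
  "('n, 'x) monoid_scheme \<Rightarrow> ('q, 'y) monoid_scheme \<Rightarrow> ('q \<Rightarrow> 'n \<Rightarrow> 'n) \<Rightarrow> ('n \<times> 'q) monoid"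
  where "semidirect_product N Q \<phi> =
    \<lparr>carrier = carrier N \<times> carrier Q,
     monoid.mult = (\<lambda>(x, q) (y, r). (x \<otimes>\<^bsub>N\<^esub> \<phi> q y, q \<otimes>\<^bsub>Q\<^esub> r)),
     one = (\<one>\<^bsub>N\<^esub>, \<one>\<^bsub>Q\<^esub>)\<rparr>"

text \<open>\<open>C\<^sub>G(L/K)\<close>: the elements of \<open>G\<close> fixing every coset \<open>Kx\<close> in \<open>L/K\<close> under conjugation.\<close>

definition factor_centralizer :: "('a, 'b) monoid_scheme \<Rightarrow> 'a set \<Rightarrow> 'a set \<Rightarrow> 'a set"
  where "factor_centralizer G L K =
    {g \<in> carrier G. \<forall>x\<in>L. K #>\<^bsub>G\<^esub> (g \<otimes>\<^bsub>G\<^esub> x \<otimes>\<^bsub>G\<^esub> inv\<^bsub>G\<^esub> g) = K #>\<^bsub>G\<^esub> x}"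

text \<open>
  The conjugation action of \<open>G/C\<^sub>G(L/K)\<close> on \<open>L/K\<close>, written without choosing representatives: if
  \<open>A\<close> is the coset of \<open>g\<close> modulo \<open>C\<^sub>G(L/K)\<close> and \<open>Y = Kx\<close> with \<open>x \<in> L\<close>, then all elements
  \<open>a y a\<^sup>-\<^sup>1\<close> with \<open>a \<in> A\<close> and \<open>y \<in> Y\<close> lie in the coset of \<open>g x g\<^sup>-\<^sup>1\<close> modulo \<open>K\<close>, and they fill it.
\<close>

definition conj_action :: "('a, 'b) monoid_scheme \<Rightarrow> 'a set \<Rightarrow> 'a set \<Rightarrow> 'a set"
  where "conj_action G A Y = {a \<otimes>\<^bsub>G\<^esub> y \<otimes>\<^bsub>G\<^esub> inv\<^bsub>G\<^esub> a | a y. a \<in> A \<and> y \<in> Y}"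

definition U_central :: "('a, 'b) monoid_scheme \<Rightarrow> 'a set \<Rightarrow> 'a set \<Rightarrow> bool"
  where "U_central G L K \<longleftrightarrow>
    supersoluble
      (semidirect_product (factor_group G L K) (G Mod factor_centralizer G L K) (conj_action G))"

definition U_hypercentral :: "('a, 'b) monoid_scheme \<Rightarrow> 'a set \<Rightarrow> bool"
  where "U_hypercentral G N \<longleftrightarrow> N \<lhd> G \<and>
    (\<forall>L K. chief_factor G L K \<and> L \<subseteq> N \<longrightarrow> U_central G L K)"

text \<open>The product of a family of normal subgroups of a finite group is the subgroup generated by
  their union.\<close>

definition Z_U :: "('a, 'b) monoid_scheme \<Rightarrow> 'a set"
  where "Z_U G = generate G (\<Union>{N. U_hypercentral G N})"

end

theory Submission
  imports Defs "HOL-Number_Theory.Residue_Primitive_Roots"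
begin

text \<open>It suffices to find a \<open>G\<close>-invariant series of \<open>P\<close> with factors of order \<open>p\<close>, since a chief factor
  of order \<open>p\<close> is \<open>\<U>\<close>-central, its automorphism group being cyclic.  Each of the two
  hypotheses on \<open>H\<close> yields a supplement \<open>T\<close> such that a chief factor \<open>L/K\<close> below \<open>P\<close>, covered
  by \<open>T\<close> and with \<open>H \<inter> L \<subseteq> (H \<inter> T)K\<close>, either has order \<open>p\<close> or the normalizer of
  \<open>(H \<inter> L)K\<close> has \<open>p\<close>-power index.  If, in the second case, \<open>H\<close> is chosen invariant under a Sylow
  \<open>p\<close>-subgroup of \<open>G\<close>, then \<open>(H \<inter> L)K\<close> is normal in \<open>G\<close>.

  Suppose \<open>|D| = 1\<close> and take a counterexample \<open>P\<close> of least order.  There is a largest proper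
  \<open>G\<close>-invariant subgroup \<open>M\<close> of \<open>P\<close>; it has the required series, and \<open>P/M\<close> is not of order \<open>p\<close>.
  If every \<open>p'\<close>-element acting trivially on the factors of that series acted trivially on \<open>P/M\<close>, then \<open>G\<close> would
  act on \<open>P/M\<close> as an abelian group of exponent dividing \<open>p - 1\<close>, and a common eigenvector would give
  \<open>|P/M| = p\<close>.  So some \<open>p'\<close>-elements centralize \<open>M\<close> but not \<open>P/M\<close>; this forces \<open>M \<le> Z(P)\<close> and
  \<open>P\<close> to have exponent \<open>p\<close>, or \<open>4\<close> if \<open>P\<close> is not quaternion-free.  Now an element \<open>x\<close> of
  \<open>P\<close> outside \<open>M\<close> whose coset is fixed by a Sylow \<open>p\<close>-subgroup gives the normal subgroup \<open>\<langle>x\<rangle>M\<close>, a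
  contradiction.

  Suppose \<open>|D| > 1\<close> and let \<open>N\<close> be a minimal normal subgroup of \<open>G\<close> in \<open>P\<close>.  Then \<open>|N| \<le> |D|\<close>,
  and \<open>P/N\<close> has the required series, by induction in \<open>G/N\<close> if \<open>|N| < |D|\<close> and by a direct
  argument if \<open>|N| = |D|\<close>.  If \<open>|N| \<noteq> p\<close>, then \<open>N\<close> is the
  only minimal normal subgroup and \<open>P\<close> is elementary abelian; a subgroup \<open>H\<close> of order \<open>|D|\<close> such that
  \<open>H \<inter> N\<close> has index \<open>p\<close> in \<open>N\<close> and is invariant under a Sylow \<open>p\<close>-subgroup contradicts the
  minimality of \<open>N\<close>.\<close>

section \<open>Conjugation and products of subgroups\<close>

text \<open>Each hypothesis on \<open>H\<close> only yields a factor of order \<open>p\<close> or a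
  normalizer of \<open>p\<close>-power index, and such a normalizer is known to be \<open>G\<close>
  only once it contains a Sylow \<open>p\<close>-subgroup. So what is tested must be
  Sylow-invariant, and this comes from counting fixed points of \<open>p\<close>-groups. For
  \<open>|D| = 1\<close> only cyclic subgroups of order \<open>p\<close> or 4 may be tested, and the
  count does not control the order of the element it finds; hence the exponent of \<open>P\<close>
  is bounded first. Here quaternion groups enter: in class 2,
  \<open>(xy)\<^sup>n = x\<^sup>n y\<^sup>n [y,x]\<^sup>c\<close> with \<open>c = n(n-1)/2\<close>.
  For \<open>n = p\<close> odd the commutator factor vanishes; for \<open>n = 2\<close> it is
  \<open>[y,x]\<close> itself, which in the situation reached can be nontrivial only if the
  quaternion group is a section.

  The order \<open>p|D|\<close> supplies the subgroups of order \<open>p\<close> if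
  \<open>|D| = 1\<close>, the subgroups just above \<open>N\<close> if \<open>|N| = |D|\<close>, and
  the cyclic subgroups of order 4 if \<open>|D| = 2\<close>; the last is why order 4 is mentioned
  separately for \<open>|D| = 1\<close> only.\<close>

definition conjugate :: "('a, 'b) monoid_scheme \<Rightarrow> 'a \<Rightarrow> 'a \<Rightarrow> 'a"
  where "conjugate G g x = g \<otimes>\<^bsub>G\<^esub> x \<otimes>\<^bsub>G\<^esub> inv\<^bsub>G\<^esub> g"

context group
begin

abbreviation cj :: "'a \<Rightarrow> 'a \<Rightarrow> 'a" where "cj \<equiv> conjugate G"

lemma cj_closed [simp]: "g \<in> carrier G \<Longrightarrow> x \<in> carrier G \<Longrightarrow> cj g x \<in> carrier G"
  by (simp add: conjugate_def)

lemma cj_mult: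
  assumes "g \<in> carrier G" "x \<in> carrier G" "y \<in> carrier G"
  shows "cj g (x \<otimes> y) = cj g x \<otimes> cj g y"
proof -
  have "inv g \<otimes> (g \<otimes> (y \<otimes> inv g)) = y \<otimes> inv g"
    using assms by (simp add: m_assoc[symmetric])
  then show ?thesis using assms by (simp add: conjugate_def m_assoc)
qed

lemma cj_one [simp]: "g \<in> carrier G \<Longrightarrow> cj g \<one> = \<one>"
  by (simp add: conjugate_def)

lemma cj_inv: "g \<in> carrier G \<Longrightarrow> x \<in> carrier G \<Longrightarrow> cj g (inv x) = inv (cj g x)"
  by (simp add: conjugate_def inv_mult_group m_assoc)

lemma cj_pow: "g \<in> carrier G \<Longrightarrow> x \<in> carrier G \<Longrightarrow> cj g (x [^] (n::nat)) = cj g x [^] n"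
  by (induction n) (simp_all add: cj_mult)

lemma cj_cj: "g \<in> carrier G \<Longrightarrow> h \<in> carrier G \<Longrightarrow> x \<in> carrier G \<Longrightarrow> cj g (cj h x) = cj (g \<otimes> h) x"
  by (simp add: conjugate_def inv_mult_group m_assoc)

lemma cj_one_left [simp]: "x \<in> carrier G \<Longrightarrow> cj \<one> x = x"
  by (simp add: conjugate_def)

lemma cj_inv_cancel [simp]:
  assumes "g \<in> carrier G" "x \<in> carrier G"
  shows "cj g (cj (inv g) x) = x" "cj (inv g) (cj g x) = x"
  using assms by (simp_all add: cj_cj)

lemma cj_mult_left: "g \<in> carrier G \<Longrightarrow> x \<in> carrier G \<Longrightarrow> cj g x \<otimes> g = g \<otimes> x"
  by (simp add: conjugate_def m_assoc)

lemma inj_on_cj: "g \<in> carrier G \<Longrightarrow> inj_on (cj g) (carrier G)"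
  by (rule inj_onI) (metis cj_inv_cancel(2))

lemma normal_iff_cj: "N \<lhd> G \<longleftrightarrow> subgroup N G \<and> (\<forall>g\<in>carrier G. \<forall>x\<in>N. cj g x \<in> N)"
  unfolding normal_inv_iff conjugate_def by blast

lemma normalD_subgroup: "N \<lhd> G \<Longrightarrow> subgroup N G"
  by (rule normal_imp_subgroup)

lemma normalD_cj: "N \<lhd> G \<Longrightarrow> g \<in> carrier G \<Longrightarrow> x \<in> N \<Longrightarrow> cj g x \<in> N"
  by (simp add: normal_iff_cj)

lemma normal_carrierD: "N \<lhd> G \<Longrightarrow> x \<in> N \<Longrightarrow> x \<in> carrier G"
  using normalD_subgroup subgroup.mem_carrier by fastforce

lemma subgroup_cj: "subgroup H G \<Longrightarrow> g \<in> H \<Longrightarrow> x \<in> H \<Longrightarrow> cj g x \<in> H"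
  by (simp add: conjugate_def subgroup.m_closed subgroup.m_inv_closed)

lemma subgroupI':
  assumes "H \<subseteq> carrier G" "\<one> \<in> H" "\<And>x y. x \<in> H \<Longrightarrow> y \<in> H \<Longrightarrow> x \<otimes> y \<in> H"
    "\<And>x. x \<in> H \<Longrightarrow> inv x \<in> H"
  shows "subgroup H G"
  using assms by (intro subgroupI) auto

lemma mem_set_mult: "x \<in> A <#> B \<longleftrightarrow> (\<exists>a\<in>A. \<exists>b\<in>B. x = a \<otimes> b)"
  by (auto simp: set_mult_def)

lemma set_multI: "a \<in> A \<Longrightarrow> b \<in> B \<Longrightarrow> a \<otimes> b \<in> A <#> B"
  by (auto simp: set_mult_def)

lemma set_mult_subset_left: "subgroup B G \<Longrightarrow> A \<subseteq> carrier G \<Longrightarrow> A \<subseteq> A <#> B"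
proof
  fix x assume "subgroup B G" "A \<subseteq> carrier G" "x \<in> A"
  then have "x = x \<otimes> \<one>" "\<one> \<in> B" by (auto simp: subgroup.one_closed)
  then show "x \<in> A <#> B" using \<open>x \<in> A\<close> mem_set_mult by blast
qed

lemma set_mult_subset_right: "subgroup A G \<Longrightarrow> B \<subseteq> carrier G \<Longrightarrow> B \<subseteq> A <#> B"
proof
  fix x assume "subgroup A G" "B \<subseteq> carrier G" "x \<in> B"
  then have "x = \<one> \<otimes> x" "\<one> \<in> A" by (auto simp: subgroup.one_closed)
  then show "x \<in> A <#> B" using \<open>x \<in> B\<close> mem_set_mult by blast
qed

lemma set_mult_subset: "subgroup L G \<Longrightarrow> A \<subseteq> L \<Longrightarrow> B \<subseteq> L \<Longrightarrow> A <#> B \<subseteq> L"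
  by (auto simp: mem_set_mult intro!: subgroup.m_closed)

lemma subgroup_set_mult:
  assumes "subgroup H G" "subgroup K G" "\<And>h k. h \<in> H \<Longrightarrow> k \<in> K \<Longrightarrow> cj h k \<in> K"
  shows "subgroup (H <#> K) G"
proof (rule subgroupI')
  note sub = subgroup.mem_carrier[OF assms(1)] subgroup.mem_carrier[OF assms(2)]
  show "H <#> K \<subseteq> carrier G" by (auto simp: mem_set_mult sub)
  show "\<one> \<in> H <#> K"
    using set_multI[OF subgroup.one_closed[OF assms(1)] subgroup.one_closed[OF assms(2)]] by simp
  have comm: "k \<otimes> h = h \<otimes> cj (inv h) k" if "h \<in> H" "k \<in> K" for h k
    using that by (simp add: conjugate_def sub m_assoc[symmetric])
  have key: "k \<otimes> h \<in> H <#> K" if "h \<in> H" "k \<in> K" for h k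
    using comm[OF that] assms(3)[OF subgroup.m_inv_closed[OF assms(1)]] that
    by (auto simp: mem_set_mult)
  show "x \<otimes> y \<in> H <#> K" if xy: "x \<in> H <#> K" "y \<in> H <#> K" for x y
  proof -
    obtain h k h' k' where *: "h \<in> H" "k \<in> K" "h' \<in> H" "k' \<in> K" "x = h \<otimes> k" "y = h' \<otimes> k'"
      using xy by (auto simp: mem_set_mult)
    obtain h2 k2 where 2: "h2 \<in> H" "k2 \<in> K" "k \<otimes> h' = h2 \<otimes> k2"
      using key[OF *(3,2)] by (auto simp: mem_set_mult)
    have "x \<otimes> y = h \<otimes> (k \<otimes> h') \<otimes> k'" using * by (simp add: sub m_assoc)
    also have "\<dots> = (h \<otimes> h2) \<otimes> (k2 \<otimes> k')" using * 2 by (simp add: sub m_assoc)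
    finally show ?thesis
      using * 2 subgroup.m_closed[OF assms(1)] subgroup.m_closed[OF assms(2)] by (metis set_multI)
  qed
  show "inv x \<in> H <#> K" if "x \<in> H <#> K" for x
  proof -
    obtain h k where *: "h \<in> H" "k \<in> K" "x = h \<otimes> k" using \<open>x \<in> _\<close> by (auto simp: mem_set_mult)
    then have "inv x = inv k \<otimes> inv h" by (simp add: sub inv_mult_group)
    then show ?thesis using key * subgroup.m_inv_closed[OF assms(1)] subgroup.m_inv_closed[OF assms(2)]
      by simp
  qed
qed

lemma subgroup_set_mult_normal: "subgroup H G \<Longrightarrow> N \<lhd> G \<Longrightarrow> subgroup (H <#> N) G"
  by (rule subgroup_set_mult) (auto simp: normalD_subgroup normalD_cj subgroup.mem_carrier)

lemma normal_set_mult: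
  assumes "M \<lhd> G" "N \<lhd> G"
  shows "M <#> N \<lhd> G"
  unfolding normal_iff_cj
proof (intro conjI ballI)
  show "subgroup (M <#> N) G"
    using assms subgroup_set_mult_normal normalD_subgroup by blast
  fix g x assume g: "g \<in> carrier G" and "x \<in> M <#> N"
  then obtain a b where ab: "a \<in> M" "b \<in> N" "x = a \<otimes> b" by (auto simp: mem_set_mult)
  then have "cj g x = cj g a \<otimes> cj g b" using g assms by (simp add: cj_mult normal_carrierD)
  then show "cj g x \<in> M <#> N" using ab g assms normalD_cj by (simp add: set_multI)
qed

lemma normal_Int: "M \<lhd> G \<Longrightarrow> N \<lhd> G \<Longrightarrow> M \<inter> N \<lhd> G"
  by (rule normal_subgroup_intersect)

text \<open>Dedekind's modular law, the means of cutting a factorization \<open>H <#> T\<close> down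
  to a normal subgroup. Its mirror image is stated separately because the factors need not
  commute.\<close>

lemma set_mult_Int_eq:
  assumes "subgroup T G" "subgroup L G" "H \<subseteq> L"
  shows "(H <#> T) \<inter> L = H <#> (T \<inter> L)"
proof (intro equalityI subsetI)
  note sub = subgroup.mem_carrier[OF assms(1)] subgroup.mem_carrier[OF assms(2)]
  fix x assume "x \<in> (H <#> T) \<inter> L"
  then obtain h t where ht: "h \<in> H" "t \<in> T" "x = h \<otimes> t" "x \<in> L" by (auto simp: mem_set_mult)
  then have "t = inv h \<otimes> x" using assms(3) sub by (metis inv_solve_left subsetD)
  moreover have "inv h \<in> L" using ht assms subgroup.m_inv_closed[OF assms(2)] by blast
  ultimately have "t \<in> L" using ht subgroup.m_closed[OF assms(2)] by metis
  then show "x \<in> H <#> (T \<inter> L)" using ht by (auto simp: mem_set_mult)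
next
  fix x assume "x \<in> H <#> (T \<inter> L)"
  then obtain h t where "h \<in> H" "t \<in> T" "t \<in> L" "x = h \<otimes> t" by (auto simp: mem_set_mult)
  then show "x \<in> (H <#> T) \<inter> L"
    using assms subgroup.m_closed[OF assms(2)] set_multI[of h H t T] by auto
qed

lemma set_mult_Int_eq':
  assumes "subgroup T G" "subgroup L G" "K \<subseteq> L"
  shows "(T <#> K) \<inter> L = (T \<inter> L) <#> K"
proof (intro equalityI subsetI)
  note sub = subgroup.mem_carrier[OF assms(1)] subgroup.mem_carrier[OF assms(2)]
  fix x assume "x \<in> (T <#> K) \<inter> L"
  then obtain t k where tk: "t \<in> T" "k \<in> K" "x = t \<otimes> k" "x \<in> L" by (auto simp: mem_set_mult)
  then have "t = x \<otimes> inv k" using assms(3) sub by (metis inv_solve_right subsetD)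
  moreover have "inv k \<in> L" using tk assms subgroup.m_inv_closed[OF assms(2)] by blast
  ultimately have "t \<in> L" using tk subgroup.m_closed[OF assms(2)] by metis
  then show "x \<in> (T \<inter> L) <#> K" using tk by (auto simp: mem_set_mult)
next
  fix x assume "x \<in> (T \<inter> L) <#> K"
  then obtain t k where "k \<in> K" "t \<in> T" "t \<in> L" "x = t \<otimes> k" by (auto simp: mem_set_mult)
  then show "x \<in> (T <#> K) \<inter> L"
    using assms subgroup.m_closed[OF assms(2)] set_multI[of t T k K] by auto
qed

section \<open>Orders of subgroups and of their products\<close>

lemma card_subgroup_dvd:
  assumes "subgroup H G" "subgroup L G" "H \<subseteq> L"
  shows "card H dvd card L"
proof -
  have "subgroup H (G\<lparr>carrier := L\<rparr>)" using assms by (simp add: subgroup_incl)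
  then have "card (rcosets\<^bsub>G\<lparr>carrier := L\<rparr>\<^esub> H) * card H = order (G\<lparr>carrier := L\<rparr>)"
    using group.lagrange[OF subgroup_imp_group[OF assms(2)]] by blast
  then have "card (rcosets\<^bsub>G\<lparr>carrier := L\<rparr>\<^esub> H) * card H = card L" by (simp add: order_def)
  then show ?thesis by (metis dvd_triv_right)
qed

lemma card_set_mult:
  assumes "subgroup H G" "subgroup K G" "finite H" "finite K"
  shows "card (H <#> K) * card (H \<inter> K) = card H * card K"
proof -
  note sub = subgroup.mem_carrier[OF assms(1)] subgroup.mem_carrier[OF assms(2)]
  note cl = subgroup.m_closed[OF assms(1)] subgroup.m_closed[OF assms(2)]
    subgroup.m_inv_closed[OF assms(1)] subgroup.m_inv_closed[OF assms(2)]
  define f where "f = (\<lambda>(h, k). h \<otimes> k)"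
  have img: "f ` (H \<times> K) = H <#> K" by (force simp: f_def mem_set_mult)
  have fib: "card {z \<in> H \<times> K. f z = y} = card (H \<inter> K)" if y: "y \<in> H <#> K" for y
  proof -
    obtain h k where hk: "h \<in> H" "k \<in> K" "y = h \<otimes> k" using y by (auto simp: mem_set_mult)
    \<comment> \<open>The fibre over \<open>h \<otimes> k\<close> is a copy of
      \<open>H \<inter> K\<close>: its members arise by shifting \<open>x\<close> from the right
      factor to the left.\<close>
    have "bij_betw (\<lambda>x. (h \<otimes> x, inv x \<otimes> k)) (H \<inter> K) {z \<in> H \<times> K. f z = y}"
    proof (rule bij_betwI')
      show "(h \<otimes> x, inv x \<otimes> k) = (h \<otimes> x', inv x' \<otimes> k) \<longleftrightarrow> x = x'"
        if "x \<in> H \<inter> K" "x' \<in> H \<inter> K" for x x'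
        using that hk sub by auto
      show "(h \<otimes> x, inv x \<otimes> k) \<in> {z \<in> H \<times> K. f z = y}" if "x \<in> H \<inter> K" for x
      proof -
        have c: "h \<in> carrier G" "x \<in> carrier G" "k \<in> carrier G" using that hk sub by auto
        have "x \<otimes> (inv x \<otimes> k) = k" using c by (simp add: m_assoc[symmetric])
        then have "(h \<otimes> x) \<otimes> (inv x \<otimes> k) = y" using c hk(3) by (simp add: m_assoc)
        then show ?thesis using that hk cl by (auto simp: f_def)
      qed
      show "\<exists>x\<in>H \<inter> K. z = (h \<otimes> x, inv x \<otimes> k)" if z: "z \<in> {z \<in> H \<times> K. f z = y}" for z
      proof -
        obtain a b where ab: "z = (a, b)" "a \<in> H" "b \<in> K" "a \<otimes> b = h \<otimes> k"
          using z hk by (auto simp: f_def)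
        have c: "h \<in> carrier G" "a \<in> carrier G" "b \<in> carrier G" "k \<in> carrier G" using ab hk sub by auto
        define x where "x = inv h \<otimes> a"
        have xc: "x \<in> carrier G" using c by (simp add: x_def)
        have a: "a = h \<otimes> x" using c by (simp add: x_def m_assoc[symmetric])
        then have "h \<otimes> (x \<otimes> b) = h \<otimes> k" using ab(4) c xc by (simp add: m_assoc)
        then have k: "x \<otimes> b = k" using c xc by simp
        have x2: "x = k \<otimes> inv b" using c xc k by (metis inv_solve_right)
        have "b = inv x \<otimes> k" using c xc k by (metis inv_solve_left)
        moreover have "x \<in> H" "x \<in> K" using cl ab hk by (simp add: x_def, simp add: x2)
        moreover note a
        ultimately show ?thesis using ab by blast
      qed
    qed
    then show ?thesis by (simp add: bij_betw_same_card)
  qed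
  have "card (H \<times> K) = (\<Sum>y\<in>f ` (H \<times> K). card {z \<in> H \<times> K. f z = y})"
    using sum.image_gen[of "H \<times> K" "\<lambda>_. 1::nat" f] assms by simp
  then show ?thesis using fib img by (simp add: card_cartesian_product)
qed

end

locale fin_group = group +
  assumes fin [simp]: "finite (carrier G)"
begin

lemma finite_subgroup: "subgroup H G \<Longrightarrow> finite H"
  using finite_subset subgroup.subset fin by blast

lemma card_subgroup_pos: "subgroup H G \<Longrightarrow> 0 < card H"
  using finite_subgroup subgroup.one_closed card_gt_0_iff by blast

lemma subgroup_eqI: "subgroup H G \<Longrightarrow> subgroup L G \<Longrightarrow> H \<subseteq> L \<Longrightarrow> card L \<le> card H \<Longrightarrow> H = L"
  using card_seteq finite_subgroup by blast

lemma card_one_subgroup: "subgroup H G \<Longrightarrow> card H = 1 \<Longrightarrow> H = {\<one>}"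
  using card_1_singletonE subgroup.one_closed by (metis singletonD)

lemma card_psubset_subgroup: "subgroup L G \<Longrightarrow> H \<subset> L \<Longrightarrow> card H < card L"
  by (simp add: finite_subgroup psubset_card_mono)

lemma card_normalizing_mult:
  assumes "subgroup H G" "subgroup K G"
  shows "card (H <#> K) * card (H \<inter> K) = card H * card K"
  using assms card_set_mult finite_subgroup by blast

lemma between_prime_index:
  assumes "Factorial_Ring.prime p" "subgroup K G" "subgroup Y G" "subgroup L G"
    "K \<subseteq> Y" "Y \<subseteq> L" "card L = p * card K"
  shows "Y = K \<or> Y = L"
proof -
  obtain a where a: "card Y = card K * a" using card_subgroup_dvd assms by (meson dvdE)
  obtain b where b: "card L = card Y * b" using card_subgroup_dvd assms by (meson dvdE)
  have "p * card K = card K * (a * b)" using a b assms(7) by simp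
  then have "p = a * b" using card_subgroup_pos[OF assms(2)] by simp
  then have "a = 1 \<or> b = 1" using assms(1) by (metis prime_product)
  then show ?thesis
  proof
    assume "a = 1"
    then have "card Y \<le> card K" using a by simp
    then show ?thesis using subgroup_eqI[OF assms(2,3,5)] by blast
  next
    assume "b = 1"
    then have "card L \<le> card Y" using b by simp
    then show ?thesis using subgroup_eqI[OF assms(3,4,6)] by blast
  qed
qed

end

section \<open>Finite \<open>p\<close>-groups\<close>

lemma prime_power_dvd_iff:
  fixes p :: nat
  assumes "Factorial_Ring.prime p"
  shows "p ^ a dvd p ^ b \<longleftrightarrow> a \<le> b"
  using assms dvd_power_iff_le prime_ge_2_nat by blast

lemma prime_power_le_iff:
  fixes p :: nat
  assumes "Factorial_Ring.prime p"
  shows "p ^ a \<le> p ^ b \<longleftrightarrow> a \<le> b"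
  using assms power_increasing_iff prime_gt_1_nat by blast

lemma prime_power_less_iff:
  fixes p :: nat
  assumes "Factorial_Ring.prime p"
  shows "p ^ a < p ^ b \<longleftrightarrow> a < b"
  using assms power_strict_increasing_iff prime_gt_1_nat by blast

text \<open>An action in the sense of \<open>group_action\<close> is a homomorphism into
  \<open>BijGroup\<close>, whose elements are extensional functions; hence the condition
  \<open>ext\<close>. Bijectivity follows from the action of the inverse.\<close>

lemma group_actionI:
  assumes G: "group G"
    and ext: "\<And>g. g \<in> carrier G \<Longrightarrow> \<phi> g \<in> extensional E"
    and cl: "\<And>g x. g \<in> carrier G \<Longrightarrow> x \<in> E \<Longrightarrow> \<phi> g x \<in> E"
    and one: "\<And>x. x \<in> E \<Longrightarrow> \<phi> \<one>\<^bsub>G\<^esub> x = x"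
    and mult: "\<And>g h x. g \<in> carrier G \<Longrightarrow> h \<in> carrier G \<Longrightarrow> x \<in> E \<Longrightarrow> \<phi> (g \<otimes>\<^bsub>G\<^esub> h) x = \<phi> g (\<phi> h x)"
  shows "group_action G E \<phi>"
proof -
  interpret group G by fact
  have inv: "\<phi> g (\<phi> (inv\<^bsub>G\<^esub> g) x) = x" "\<phi> (inv\<^bsub>G\<^esub> g) (\<phi> g x) = x" if "g \<in> carrier G" "x \<in> E" for g x
    using that mult[of g "inv\<^bsub>G\<^esub> g" x] mult[of "inv\<^bsub>G\<^esub> g" g x] one by simp_all
  have Bij: "\<phi> g \<in> Bij E" if "g \<in> carrier G" for g
    unfolding Bij_def
  proof
    show "\<phi> g \<in> extensional E" by (rule ext[OF that])
    have "bij_betw (\<phi> g) E E"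
      by (rule bij_betw_byWitness[where f' = "\<phi> (inv\<^bsub>G\<^esub> g)"]) (use that inv cl in auto)
    then show "\<phi> g \<in> {f. bij_betw f E E}" by simp
  qed
  have "\<phi> (g \<otimes>\<^bsub>G\<^esub> h) = compose E (\<phi> g) (\<phi> h)" if "g \<in> carrier G" "h \<in> carrier G" for g h
    by (rule extensionalityI[where A = E]) (use that ext mult in \<open>auto simp: compose_def\<close>)
  then have "\<phi> \<in> hom G (BijGroup E)"
    by (auto simp: hom_def BijGroup_def Bij)
  then show ?thesis
    by (intro group_action.intro group_hom.intro group_hom_axioms.intro G group_BijGroup)
qed

text \<open>Orbit lengths divide \<open>p ^ a\<close>, so an orbit either is a fixed point or has
  length divisible by \<open>p\<close>.\<close>

lemma (in group_action) card_fixed_points_cong: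
  fixes p :: nat
  assumes p: "Factorial_Ring.prime p" and ord: "order G = p ^ a" and E: "finite E"
  shows "[card E = card {x \<in> E. \<forall>g\<in>carrier G. \<phi> g x = x}] (mod p)"
proof -
  interpret group_hom G "BijGroup E" \<phi> by (rule group_hom)
  define Fx where "Fx = {x \<in> E. \<forall>g\<in>carrier G. \<phi> g x = x}"
  define Os where "Os = orbits G E \<phi>"
  have fin: "finite Os"
    using E orbits_coverture unfolding Os_def by (metis finite_UnionD)
  have finO: "finite Q" if "Q \<in> Os" for Q
    using that E orbits_coverture unfolding Os_def by (metis Sup_upper finite_subset)
  have dv: "p dvd card Q" if Q: "Q \<in> Os" "card Q \<noteq> 1" for Q
  proof -
    obtain x where x: "x \<in> E" "Q = orbit G \<phi> x" using Q(1) by (auto simp: Os_def orbits_def)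
    have "card Q * card (stabilizer G \<phi> x) = p ^ a"
      using orbit_stabilizer_theorem[OF x(1)] x ord by simp
    then have "card Q dvd p ^ a" by (metis dvd_triv_left)
    then obtain k where k: "card Q = p ^ k" using divides_primepow_nat[OF p] by blast
    then have "k \<noteq> 0" using Q(2) by auto
    then show ?thesis using k by simp
  qed
  have bij: "bij_betw (\<lambda>x. {x}) Fx {Q \<in> Os. card Q = 1}"
  proof (rule bij_betwI')
    fix x assume x: "x \<in> Fx"
    then have "orbit G \<phi> x \<subseteq> {x}" by (auto simp: orbit_def Fx_def)
    moreover have "x \<in> orbit G \<phi> x" using x orbit_refl by (simp add: Fx_def)
    ultimately have "orbit G \<phi> x = {x}" by blast
    then show "{x} \<in> {Q \<in> Os. card Q = 1}" using x by (force simp: Os_def orbits_def Fx_def)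
  next
    fix Q assume "Q \<in> {Q \<in> Os. card Q = 1}"
    then obtain x y where x: "x \<in> E" "Q = orbit G \<phi> x" "Q = {y}"
      by (auto simp: Os_def orbits_def card_1_singleton_iff)
    then have "x = y" using orbit_refl by blast
    then have "\<phi> g x = x" if "g \<in> carrier G" for g using that x by (auto simp: orbit_def)
    then show "\<exists>x\<in>Fx. Q = {x}" using x \<open>x = y\<close> by (auto simp: Fx_def)
  qed auto
  have "card E = (\<Sum>Q\<in>Os. card Q)"
    using disjoint_sum[OF E, of "\<lambda>_. 1::nat"] by (simp add: Os_def)
  also have "\<dots> = (\<Sum>Q\<in>{Q \<in> Os. card Q = 1}. card Q) + (\<Sum>Q\<in>{Q \<in> Os. card Q \<noteq> 1}. card Q)"
    using fin by (subst sum.union_disjoint[symmetric]) (auto intro: sum.cong)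
  also have "(\<Sum>Q\<in>{Q \<in> Os. card Q = 1}. card Q) = card Fx"
    using bij_betw_same_card[OF bij] by simp
  finally have "card E = card Fx + (\<Sum>Q\<in>{Q \<in> Os. card Q \<noteq> 1}. card Q)" .
  moreover have "p dvd (\<Sum>Q\<in>{Q \<in> Os. card Q \<noteq> 1}. card Q)"
    using dv by (intro dvd_sum) auto
  ultimately show ?thesis unfolding Fx_def[symmetric] by (metis cong_add_lcancel_0_nat cong_0_iff)
qed

section \<open>Commutators and cosets modulo a normal subgroup\<close>

context group
begin

text \<open>Since \<open>cj g x = cmt g x \<otimes> x\<close>, membership of \<open>cmt g x\<close>
  in a subgroup \<open>K\<close> says exactly that \<open>x\<close> and its conjugate have the same
  right coset. Most statements about trivial action on a factor take this form.\<close>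

abbreviation cmt :: "'a \<Rightarrow> 'a \<Rightarrow> 'a" where "cmt g x \<equiv> cj g x \<otimes> inv x"

abbreviation normalizes :: "'a set \<Rightarrow> 'a set \<Rightarrow> bool"
  where "normalizes S H \<equiv> \<forall>s\<in>S. \<forall>x\<in>H. cj s x \<in> H"

lemma cmt_closed: "g \<in> carrier G \<Longrightarrow> x \<in> carrier G \<Longrightarrow> cmt g x \<in> carrier G"
  by simp

lemma cj_eq_cmt: "g \<in> carrier G \<Longrightarrow> x \<in> carrier G \<Longrightarrow> cj g x = cmt g x \<otimes> x"
  by (simp add: m_assoc)

lemma cj_rcoset:
  assumes "subgroup H G" "s \<in> carrier G" "x \<in> carrier G" "\<And>h. h \<in> H \<Longrightarrow> cj s h \<in> H"
    "\<And>h. h \<in> H \<Longrightarrow> cj (inv s) h \<in> H"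
  shows "cj s ` (H #> x) = H #> cj s x"
proof (intro equalityI subsetI)
  note sub = subgroup.mem_carrier[OF assms(1)]
  fix y assume "y \<in> cj s ` (H #> x)"
  then obtain h where h: "h \<in> H" "y = cj s (h \<otimes> x)" by (auto simp: r_coset_def)
  then have "y = cj s h \<otimes> cj s x" using assms sub by (simp add: cj_mult)
  then show "y \<in> H #> cj s x" using h assms(4) by (auto simp: r_coset_def)
next
  note sub = subgroup.mem_carrier[OF assms(1)]
  fix y assume "y \<in> H #> cj s x"
  then obtain h where h: "h \<in> H" "y = h \<otimes> cj s x" by (auto simp: r_coset_def)
  then have "y = cj s (cj (inv s) h \<otimes> x)" using assms sub by (simp add: cj_mult)
  moreover have "cj (inv s) h \<otimes> x \<in> H #> x" using h assms(5) by (auto simp: r_coset_def)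
  ultimately show "y \<in> cj s ` (H #> x)" by blast
qed

lemma generate_singleton_finite:
  assumes "finite (carrier G)" "x \<in> carrier G"
  shows "generate G {x} = range (\<lambda>n::nat. x [^] n)"
proof -
  have "ord x \<noteq> 0" using assms ord_ge_1 by fastforce
  then show ?thesis using generate_pow_nat assms by auto
qed

lemma nat_pow_mem: "subgroup H G \<Longrightarrow> x \<in> H \<Longrightarrow> x [^] (n::nat) \<in> H"
  by (induction n) (auto simp: subgroup.one_closed subgroup.m_closed)

text \<open>If \<open>n\<close> were prime to \<open>p\<close>, then with \<open>n * m\<close>
  congruent to 1 modulo \<open>p\<close> the element \<open>x\<close> itself would be a product of
  elements of \<open>H\<close>.\<close>

lemma pow_mem_iff_dvd:
  fixes p n :: nat
  assumes "Factorial_Ring.prime p" "subgroup H G" "x \<in> carrier G" "x \<notin> H" "x [^] p \<in> H"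
  shows "x [^] n \<in> H \<longleftrightarrow> p dvd n"
proof
  assume n: "x [^] n \<in> H"
  show "p dvd n"
  proof (rule ccontr)
    assume "\<not> p dvd n"
    then have "coprime n p" using assms(1) by (metis coprime_commute prime_imp_coprime)
    then obtain m where m: "[n * m = 1] (mod p)" using cong_solve_coprime_nat by auto
    have "p > 1" using assms(1) prime_gt_1_nat by blast
    then have "(n * m) mod p = 1" using m by (simp add: cong_def)
    then have "n * m = p * (n * m div p) + 1" by (metis mult_div_mod_eq)
    then have "x [^] (n * m) = x [^] (p * (n * m div p)) \<otimes> x"
      using assms(3) by (metis nat_pow_Suc Suc_eq_plus1)
    then have e: "(x [^] n) [^] m = (x [^] p) [^] (n * m div p) \<otimes> x"
      using assms(3) by (simp add: nat_pow_pow)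
    define a where "a = (x [^] p) [^] (n * m div p)"
    have a: "a \<in> H" "a \<in> carrier G" using assms nat_pow_mem subgroup.mem_carrier unfolding a_def by fastforce+
    have "x = inv a \<otimes> (x [^] n) [^] m" using e a assms(3) by (simp add: a_def[symmetric] m_assoc[symmetric])
    then have "x \<in> H" using a n assms(2) by (metis nat_pow_mem subgroup.m_closed subgroup.m_inv_closed)
    then show False using assms by simp
  qed
next
  assume "p dvd n"
  then obtain m where "n = p * m" by blast
  then have "x [^] n = (x [^] p) [^] m" using assms(3) by (simp add: nat_pow_pow)
  then show "x [^] n \<in> H" using assms nat_pow_mem by simp
qed

text \<open>The condition on \<open>cj g x\<close> at \<open>s\<close> is the conjugate of the
  condition on \<open>x\<close> at \<open>cj (inv g) s\<close>. So it is enough that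
  \<open>S\<close> is closed under conjugation, and \<open>S\<close> may be a mere set, such as the
  \<open>p'\<close>-elements of a normal subgroup.\<close>

lemma normal_fixed_mod:
  assumes K: "K \<lhd> G" and L: "L \<lhd> G" and "K \<subseteq> L" and S: "S \<subseteq> carrier G" "normalizes (carrier G) S"
  shows "{x \<in> L. \<forall>s\<in>S. cmt s x \<in> K} \<lhd> G" "K \<subseteq> {x \<in> L. \<forall>s\<in>S. cmt s x \<in> K}"
proof -
  define F where "F = {x \<in> L. \<forall>s\<in>S. cmt s x \<in> K}"
  note Ks = normalD_subgroup[OF K] and Ls = normalD_subgroup[OF L]
  note Kc = normal_carrierD[OF K] and Lc = normal_carrierD[OF L]
  have Sc: "s \<in> carrier G" if "s \<in> S" for s using that S by blast
  have "F \<lhd> G"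
    unfolding normal_iff_cj
  proof (intro conjI ballI)
    show "subgroup F G"
    proof (rule subgroupI')
      show "F \<subseteq> carrier G" using Lc by (auto simp: F_def)
      show "\<one> \<in> F" using Ks Ls Sc by (auto simp: F_def subgroup.one_closed)
      show "x \<otimes> y \<in> F" if "x \<in> F" "y \<in> F" for x y
      proof -
        have "cmt s (x \<otimes> y) \<in> K" if s: "s \<in> S" for s
        proof -
          have c: "x \<in> carrier G" "y \<in> carrier G" "s \<in> carrier G" using \<open>x \<in> F\<close> \<open>y \<in> F\<close> Lc Sc s by (auto simp: F_def)
          have "cmt s (x \<otimes> y) = cmt s x \<otimes> cj x (cmt s y)"
            using c by (simp add: cj_mult inv_mult_group conjugate_def[of G x] m_assoc)
               (simp add: m_assoc[symmetric])
          moreover have "cmt s x \<in> K" "cj x (cmt s y) \<in> K"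
            using \<open>x \<in> F\<close> \<open>y \<in> F\<close> s c normalD_cj[OF K] by (auto simp: F_def)
          ultimately show ?thesis using subgroup.m_closed[OF Ks] by metis
        qed
        then show ?thesis using that subgroup.m_closed[OF Ls] by (auto simp: F_def)
      qed
      show "inv x \<in> F" if "x \<in> F" for x
      proof -
        have "cmt s (inv x) \<in> K" if s: "s \<in> S" for s
        proof -
          have c: "x \<in> carrier G" "s \<in> carrier G" using \<open>x \<in> F\<close> Lc Sc s by (auto simp: F_def)
          have "cmt s (inv x) = cj (inv x) (inv (cmt s x))"
            using c by (simp add: cj_inv inv_mult_group conjugate_def[of G "inv x"] m_assoc[symmetric])
          moreover have "inv (cmt s x) \<in> K" using \<open>x \<in> F\<close> s by (auto simp: F_def subgroup.m_inv_closed[OF Ks])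
          ultimately show ?thesis using normalD_cj[OF K] c by (metis inv_closed)
        qed
        then show ?thesis using that subgroup.m_inv_closed[OF Ls] by (auto simp: F_def)
      qed
    qed
    fix g x assume g: "g \<in> carrier G" and x: "x \<in> F"
    have "cmt s (cj g x) \<in> K" if s: "s \<in> S" for s
    proof -
      have c: "x \<in> carrier G" "s \<in> carrier G" using x Lc Sc s by (auto simp: F_def)
      have "cj (inv g) s \<in> S" using S(2) g s by simp
      then have "cmt (cj (inv g) s) x \<in> K" using x by (auto simp: F_def)
      then have "cj g (cmt (cj (inv g) s) x) \<in> K" using normalD_cj[OF K g] by blast
      moreover have "cj g (cj (cj (inv g) s) x) = cj s (cj g x)"
      proof -
        have "g \<otimes> cj (inv g) s = s \<otimes> g" using g c by (simp add: conjugate_def m_assoc[symmetric])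
        then show ?thesis using g c by (simp add: cj_cj)
      qed
      ultimately show ?thesis using g c by (simp add: cj_mult cj_inv)
    qed
    then show "cj g x \<in> F" using x normalD_cj[OF L g] by (auto simp: F_def)
  qed
  then show "{x \<in> L. \<forall>s\<in>S. cmt s x \<in> K} \<lhd> G" by (simp add: F_def)
  show "K \<subseteq> {x \<in> L. \<forall>s\<in>S. cmt s x \<in> K}"
    using assms(3) normalD_cj[OF K] Sc Ks by (auto simp: subgroup.m_closed subgroup.m_inv_closed)
qed

lemma rcoset_hom: "K \<lhd> G \<Longrightarrow> (\<lambda>a. K #> a) \<in> hom G (G Mod K)"
  by (rule normal.r_coset_hom_Mod)

lemma rcoset_eq_iff:
  assumes "subgroup K G" "x \<in> carrier G" "y \<in> carrier G"
  shows "K #> x = K #> y \<longleftrightarrow> x \<otimes> inv y \<in> K"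
proof -
  have "x \<otimes> inv y \<in> K \<longleftrightarrow> x \<in> K #> y" using assms subgroup.rcos_module is_group by metis
  then show ?thesis using assms repr_independence rcos_self by metis
qed

lemma rcoset_eq_self_iff:
  assumes "subgroup K G" "x \<in> carrier G"
  shows "K #> x = K \<longleftrightarrow> x \<in> K"
  using assms by (metis coset_join1 coset_join2 subgroup.subset rcos_self)

lemma cmt_mem_iff:
  assumes K: "K \<lhd> G" and c: "g \<in> carrier G" "x \<in> carrier G"
  shows "cmt g x \<in> K \<longleftrightarrow> (K #> g) <#> (K #> x) = (K #> x) <#> (K #> g)"
proof -
  have "(K #> g) <#> (K #> x) = K #> (g \<otimes> x)" "(K #> x) <#> (K #> g) = K #> (x \<otimes> g)"
    using normal.rcos_sum[OF K] c by auto
  moreover have "(g \<otimes> x) \<otimes> inv (x \<otimes> g) = cmt g x"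
    using c by (simp add: conjugate_def inv_mult_group m_assoc)
  ultimately show ?thesis using rcoset_eq_iff[OF normalD_subgroup[OF K]] c by simp
qed

lemma rcoset_pow:
  assumes K: "K \<lhd> G" and "x \<in> carrier G"
  shows "(K #> x) [^]\<^bsub>G Mod K\<^esub> (n::nat) = K #> (x [^] n)"
  using assms normal.FactGroup_pow by metis

lemma pow_mult_mod:
  assumes K: "K \<lhd> G" and c: "x \<in> carrier G" "y \<in> carrier G" and "cmt x y \<in> K"
  shows "K #> ((x \<otimes> y) [^] (n::nat)) = K #> (x [^] n \<otimes> y [^] n)"
proof -
  interpret Q: group "G Mod K" by (rule normal.factorgroup_is_group[OF K])
  have m: "K #> x \<in> carrier (G Mod K)" "K #> y \<in> carrier (G Mod K)"
    using c by (auto simp: carrier_FactGroup)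
  have "(K #> x) \<otimes>\<^bsub>G Mod K\<^esub> (K #> y) = (K #> y) \<otimes>\<^bsub>G Mod K\<^esub> (K #> x)"
    using assms cmt_mem_iff by simp
  from Q.pow_mult_distrib[OF this m, of n] show ?thesis
    using c by (simp add: normal.rcos_sum[OF K] rcoset_pow[OF K])
qed

end

section \<open>Fixed points of \<open>p\<close>-groups and chains of invariant subgroups\<close>

context fin_group
begin

lemma Mod_fin_group: "K \<lhd> G \<Longrightarrow> fin_group (G Mod K)"
  by (intro fin_group.intro fin_group_axioms.intro normal.factorgroup_is_group)
    (auto simp: carrier_FactGroup)

lemma subgroup_fin_group: "subgroup H G \<Longrightarrow> fin_group (G\<lparr>carrier := H\<rparr>)"
  by (intro fin_group.intro fin_group_axioms.intro subgroup_imp_group) (auto simp: finite_subgroup)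

text \<open>\<open>S\<close> permutes the cosets of \<open>H\<close> in \<open>L\<close>, and their
  number is divisible by \<open>p\<close>. So is the number of fixed cosets, which is not 0 because
  \<open>H\<close> itself is one.\<close>

lemma fixed_coset:
  fixes p :: nat
  assumes p: "Factorial_Ring.prime p" and S: "subgroup S G" "card S = p ^ a"
    and H: "subgroup H G" and L: "subgroup L G" "H \<subseteq> L"
    and nH: "normalizes S H" and nL: "normalizes S L" and dv: "p * card H dvd card L"
  shows "\<exists>x\<in>L. x \<notin> H \<and> (\<forall>s\<in>S. cmt s x \<in> H)"
proof -
  note Sc = subgroup.mem_carrier[OF S(1)] and Hc = subgroup.mem_carrier[OF H] and Lc = subgroup.mem_carrier[OF L(1)]
  define E where "E = (\<lambda>x. H #> x) ` L"
  define \<phi> where "\<phi> s = (\<lambda>C\<in>E. cj s ` C)" for s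
  have im: "cj s ` (H #> x) = H #> cj s x" if "s \<in> S" "x \<in> L" for s x
    using that by (intro cj_rcoset) (auto simp: Sc Lc H nH subgroup.m_inv_closed[OF S(1)])
  have \<phi>: "\<phi> s (H #> x) = H #> cj s x" if "s \<in> S" "x \<in> L" for s x
    using that im by (auto simp: \<phi>_def E_def)
  interpret A: group_action "G\<lparr>carrier := S\<rparr>" E \<phi>
  proof (rule group_actionI)
    show "group (G\<lparr>carrier := S\<rparr>)" using S(1) by (rule subgroup_imp_group)
    show "\<phi> g \<in> extensional E" for g by (simp add: \<phi>_def)
    show "\<phi> g x \<in> E" if "g \<in> carrier (G\<lparr>carrier := S\<rparr>)" "x \<in> E" for g x
      using that nL by (auto simp: E_def \<phi>)
    show "\<phi> \<one>\<^bsub>G\<lparr>carrier := S\<rparr>\<^esub> x = x" if "x \<in> E" for x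
      using that subgroup.one_closed[OF S(1)] Lc by (auto simp: E_def \<phi>)
    show "\<phi> (g \<otimes>\<^bsub>G\<lparr>carrier := S\<rparr>\<^esub> h) x = \<phi> g (\<phi> h x)"
      if "g \<in> carrier (G\<lparr>carrier := S\<rparr>)" "h \<in> carrier (G\<lparr>carrier := S\<rparr>)" "x \<in> E" for g h x
      using that nL Sc Lc subgroup.m_closed[OF S(1)] by (auto simp: E_def \<phi> cj_cj)
  qed
  have finE: "finite E" using finite_subgroup[OF L(1)] by (simp add: E_def)
  define Fx where "Fx = {C \<in> E. \<forall>g\<in>S. \<phi> g C = C}"
  have cong: "[card E = card Fx] (mod p)"
    using A.card_fixed_points_cong[OF p _ finE] S(2) by (simp add: Fx_def order_def)
  have "rcosets\<^bsub>G\<lparr>carrier := L\<rparr>\<^esub> H = E" by (auto simp: RCOSETS_def E_def)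
  moreover have "subgroup H (G\<lparr>carrier := L\<rparr>)" using H L by (simp add: subgroup_incl)
  ultimately have "card E * card H = order (G\<lparr>carrier := L\<rparr>)"
    using group.lagrange[OF subgroup_imp_group[OF L(1)]] by metis
  then have "card E * card H = card L" by (simp add: order_def)
  then have "p dvd card E" using dv card_subgroup_pos[OF H] by (metis mult.commute nat_mult_dvd_cancel1 neq0_conv)
  then have pF: "p dvd card Fx" using cong cong_dvd_iff by blast
  have "H = H #> \<one>" using subgroup.subset[OF H] by simp
  then have "H \<in> Fx" using \<phi>[of _ \<one>] Sc by (auto simp: Fx_def E_def subgroup.one_closed[OF L(1)])
  moreover have "finite Fx" using finE by (simp add: Fx_def)
  ultimately have "card Fx \<noteq> 0" by auto
  then have "card Fx \<ge> p" using pF by (simp add: dvd_imp_le)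
  then have "card Fx > 1" using prime_gt_1_nat[OF p] by linarith
  then have "\<not> Fx \<subseteq> {H}" using card_mono[of "{H}" Fx] by auto
  then obtain C where C: "C \<in> Fx" "C \<noteq> H" by blast
  then obtain x where x: "x \<in> L" "C = H #> x" by (auto simp: Fx_def E_def)
  have "x \<notin> H" using C x rcoset_eq_self_iff[OF H] Lc by blast
  moreover have "cmt s x \<in> H" if "s \<in> S" for s
  proof -
    have "H #> cj s x = H #> x" using C that x \<phi> by (auto simp: Fx_def)
    then show ?thesis using rcoset_eq_iff[OF H] Sc Lc x that by auto
  qed
  ultimately show ?thesis using x by blast
qed

text \<open>In the sequence \<open>x\<close>, \<open>x [^] p\<close>, \<open>x [^] (p ^ 2)\<close>,
  ..., which ends in 1, take the last member outside \<open>H\<close>.\<close>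

lemma exists_prime_root:
  fixes p :: nat
  assumes p: "Factorial_Ring.prime p" and F: "subgroup F G" "card F = p ^ m" and H: "subgroup H G"
    and x: "x \<in> F" "x \<notin> H"
  shows "\<exists>n. x [^] (p ^ n) \<notin> H \<and> (x [^] (p ^ n)) [^] p \<in> H"
proof -
  have xc: "x \<in> carrier G" using x F subgroup.mem_carrier by fastforce
  interpret F: group "G\<lparr>carrier := F\<rparr>" using F(1) by (rule subgroup_imp_group)
  have "x [^]\<^bsub>G\<lparr>carrier := F\<rparr>\<^esub> order (G\<lparr>carrier := F\<rparr>) = \<one>"
    using F.pow_order_eq_1 x by simp
  then have ex: "x [^] (p ^ m) \<in> H" using F(2) H by (simp add: order_def nat_pow_consistent[symmetric] subgroup.one_closed)
  define n where "n = (LEAST n. x [^] (p ^ n) \<in> H)"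
  have n: "x [^] (p ^ n) \<in> H" unfolding n_def by (rule LeastI[of "\<lambda>n. x [^] (p ^ n) \<in> H", OF ex])
  have "n \<noteq> 0" using n x xc by (metis power_0 nat_pow_eone)
  then obtain k where k: "n = Suc k" using not0_implies_Suc by blast
  have "x [^] (p ^ k) \<notin> H" using not_less_Least[of k "\<lambda>n. x [^] (p ^ n) \<in> H"] k n_def by simp
  moreover have "(x [^] (p ^ k)) [^] p = x [^] (p ^ n)" using xc k by (simp add: nat_pow_pow mult.commute)
  ultimately show ?thesis using n by auto
qed

text \<open>Every element has a unique form \<open>x [^] i \<otimes> h\<close> with
  \<open>i < p\<close>: uniqueness because no smaller positive power of \<open>x\<close> is in
  \<open>H\<close>, existence because \<open>x [^] p\<close> is.\<close>

lemma prime_extension: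
  fixes p :: nat
  assumes p: "Factorial_Ring.prime p" and H: "subgroup H G" and x: "x \<in> carrier G" "x \<notin> H" "x [^] p \<in> H"
    and n: "\<And>h. h \<in> H \<Longrightarrow> cj x h \<in> H"
  shows "subgroup (generate G {x} <#> H) G" "card (generate G {x} <#> H) = p * card H"
proof -
  note Hc = subgroup.mem_carrier[OF H]
  have gen: "generate G {x} = range (\<lambda>n::nat. x [^] n)" using generate_singleton_finite x by simp
  have pw: "cj (x [^] (k::nat)) h \<in> H" if "h \<in> H" for k h
    using that
  proof (induction k arbitrary: h)
    case (Suc k)
    have "cj (x [^] Suc k) h = cj (x [^] k) (cj x h)" using x Suc.prems Hc by (simp add: cj_cj)
    then show ?case using Suc n by simp
  qed (simp add: Hc)
  show sub: "subgroup (generate G {x} <#> H) G"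
  proof (rule subgroup_set_mult)
    show "subgroup (generate G {x}) G" using x by (simp add: generate_is_subgroup)
    show "cj h k \<in> H" if "h \<in> generate G {x}" "k \<in> H" for h k using that pw gen by auto
  qed (rule H)
  have "bij_betw (\<lambda>(i, h). x [^] i \<otimes> h) ({..<p} \<times> H) (generate G {x} <#> H)"
  proof (rule bij_betw_imageI)
    have *: "i = j \<and> h = h'" if "i \<le> j" "x [^] i \<otimes> h = x [^] j \<otimes> h'" "h \<in> H" "h' \<in> H" "j < p" for i j :: nat and h h'
    proof -
      have "x [^] i \<otimes> h = x [^] i \<otimes> (x [^] (j - i) \<otimes> h')"
        using that x Hc by (simp add: m_assoc[symmetric] nat_pow_mult)
      then have e: "h = x [^] (j - i) \<otimes> h'" using that x Hc by simp
      then have "x [^] (j - i) = h \<otimes> inv h'" using that x Hc by (metis inv_solve_right nat_pow_closed)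
      then have "x [^] (j - i) \<in> H" using that by (simp add: subgroup.m_closed[OF H] subgroup.m_inv_closed[OF H])
      then have "p dvd j - i" using pow_mem_iff_dvd[OF p H x] by blast
      then have "i = j" using that by (metis diff_is_0_eq dvd_imp_le le_antisym less_imp_diff_less not_le zero_less_diff le_neq_implies_less)
      then show ?thesis using e that Hc by simp
    qed
    show "inj_on (\<lambda>(i, h). x [^] i \<otimes> h) ({..<p} \<times> H)"
    proof (rule inj_onI)
      fix z z' assume z: "z \<in> {..<p} \<times> H" "z' \<in> {..<p} \<times> H"
        and eq: "(\<lambda>(i, h). x [^] i \<otimes> h) z = (\<lambda>(i, h). x [^] i \<otimes> h) z'"
      obtain i h j h' where "z = (i, h)" "z' = (j, h')" by (metis surj_pair)
      then show "z = z'" using z eq *[of i j h h'] *[of j i h' h] by (cases "i \<le> j") auto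
    qed
    show "(\<lambda>(i, h). x [^] i \<otimes> h) ` ({..<p} \<times> H) = generate G {x} <#> H"
    proof (intro equalityI subsetI)
      fix y assume "y \<in> generate G {x} <#> H"
      then obtain n :: nat and h where y: "h \<in> H" "y = x [^] n \<otimes> h" by (auto simp: mem_set_mult gen)
      have "x [^] n = x [^] (n mod p + p * (n div p))" by simp
      also have "\<dots> = x [^] (n mod p) \<otimes> (x [^] p) [^] (n div p)"
        using x by (simp only: nat_pow_mult[symmetric] nat_pow_pow)
      finally have "y = x [^] (n mod p) \<otimes> ((x [^] p) [^] (n div p) \<otimes> h)"
        using y x Hc by (simp add: m_assoc)
      moreover have "(x [^] p) [^] (n div p) \<otimes> h \<in> H"
        using y x by (simp add: subgroup.m_closed[OF H] nat_pow_mem[OF H])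
      moreover have "n mod p < p" using p prime_gt_0_nat by simp
      ultimately show "y \<in> (\<lambda>(i, h). x [^] i \<otimes> h) ` ({..<p} \<times> H)" by force
    qed (auto simp: mem_set_mult gen)
  qed
  then show "card (generate G {x} <#> H) = p * card H"
    by (simp add: bij_betw_same_card[symmetric] card_cartesian_product)
qed

text \<open>Take a coset fixed by \<open>S\<close>. Modulo \<open>H\<close> its representative
  \<open>x\<close> is centralized by \<open>S\<close>, and so is each power of it; one of these
  powers, \<open>y\<close>, has its \<open>p\<close>-th power in \<open>H\<close>, and
  \<open>S\<close> then preserves \<open>generate G {y} <#> H\<close>. The inclusion
  \<open>L \<subseteq> S\<close> makes \<open>y\<close> normalize \<open>H\<close>.\<close>

lemma prime_step:
  fixes p :: nat
  assumes p: "Factorial_Ring.prime p" and S: "subgroup S G" "card S = p ^ a"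
    and H: "subgroup H G" and L: "subgroup L G" "H \<subseteq> L" "L \<subseteq> S"
    and nH: "normalizes S H" and nL: "normalizes S L" and less: "card H < card L"
  shows "\<exists>H'. subgroup H' G \<and> H \<subseteq> H' \<and> H' \<subseteq> L \<and> card H' = p * card H \<and> normalizes S H'"
proof -
  note Sc = subgroup.mem_carrier[OF S(1)] and Hc = subgroup.mem_carrier[OF H] and Lc = subgroup.mem_carrier[OF L(1)]
  have "card L dvd p ^ a" using card_subgroup_dvd[OF L(1) S(1) L(3)] S by simp
  then obtain l where l: "card L = p ^ l" using divides_primepow_nat[OF p] by blast
  have "card H dvd p ^ l" using card_subgroup_dvd[OF H L(1,2)] l by simp
  then obtain h where h: "card H = p ^ h" using divides_primepow_nat[OF p] by blast
  have "h < l" using less l h prime_power_less_iff[OF p] by simp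
  then have "p ^ Suc h dvd p ^ l" using prime_power_dvd_iff[OF p, of "Suc h" l] by simp
  then have "p * card H dvd card L" using h l by simp
  from fixed_coset[OF p S H L(1,2) nH nL this]
  obtain x where x: "x \<in> L" "x \<notin> H" "\<And>s. s \<in> S \<Longrightarrow> cmt s x \<in> H" by blast
  have pw: "cmt s (x [^] (n::nat)) \<in> H" if s: "s \<in> S" for s n
  proof (induction n)
    case (Suc n)
    have c: "s \<in> carrier G" "x \<in> carrier G" using s x Sc Lc by auto
    have "cmt s (x [^] Suc n) = cmt s (x [^] n) \<otimes> cj (x [^] n) (cmt s x)"
      using c by (simp add: cj_mult inv_mult_group conjugate_def[of G "x [^] n"] m_assoc)
        (simp add: m_assoc[symmetric])
    moreover have "x [^] n \<in> S" using x L nat_pow_mem[OF S(1)] by blast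
    ultimately show ?case using Suc x(3)[OF s] nH subgroup.m_closed[OF H] by simp
  qed (use s Sc in \<open>simp add: subgroup.one_closed[OF H]\<close>)
  obtain n where n: "x [^] (p ^ n) \<notin> H" "(x [^] (p ^ n)) [^] p \<in> H"
    using exists_prime_root[OF p L(1) l H x(1,2)] by blast
  define y where "y = x [^] (p ^ n)"
  have y: "y \<in> L" "y \<notin> H" "y [^] p \<in> H" "y \<in> carrier G" "y \<in> S"
    using n x Lc L nat_pow_mem[OF L(1)] by (auto simp: y_def)
  let ?H = "generate G {y} <#> H"
  have gen: "generate G {y} = range (\<lambda>n::nat. y [^] n)" using generate_singleton_finite y by simp
  have ext: "subgroup ?H G" "card ?H = p * card H"
    using prime_extension[OF p H y(4,2,3)] nH y(5) by auto
  have "H \<subseteq> ?H" using set_mult_subset_right[of "generate G {y}" H] Hc y by (auto simp: generate_is_subgroup)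
  moreover have "generate G {y} \<subseteq> L" using gen nat_pow_mem[OF L(1) y(1)] by auto
  then have "?H \<subseteq> L" using set_mult_subset[OF L(1) _ L(2)] by blast
  moreover have "cj s z \<in> ?H" if s: "s \<in> S" "z \<in> ?H" for s z
  proof -
    obtain k :: nat and h where z: "h \<in> H" "z = y [^] k \<otimes> h" using s(2) by (auto simp: mem_set_mult gen)
    have c: "s \<in> carrier G" "y [^] k \<in> carrier G" using s Sc y by auto
    have "y [^] k = x [^] (p ^ n * k)" using x Lc by (simp add: y_def nat_pow_pow)
    then have "cmt s (y [^] k) \<in> H" using pw[OF s(1)] by simp
    moreover have "cj s z = cmt s (y [^] k) \<otimes> (y [^] k \<otimes> cj s h)"
      using z c Hc by (simp add: cj_mult m_assoc) (simp add: m_assoc[symmetric])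
    moreover have "y [^] k \<otimes> cj s h \<in> ?H" using z s nH gen by (auto intro: set_multI)
    ultimately show ?thesis using \<open>H \<subseteq> ?H\<close> subgroup.m_closed[OF ext(1)] by auto
  qed
  ultimately show ?thesis using ext by blast
qed

lemma prime_chain:
  fixes p :: nat
  assumes p: "Factorial_Ring.prime p" and S: "subgroup S G" "card S = p ^ a"
    and H: "subgroup H G" "card H = p ^ i" and L: "subgroup L G" "H \<subseteq> L" "L \<subseteq> S"
    and nH: "normalizes S H" and nL: "normalizes S L" and j: "i \<le> j" "p ^ j \<le> card L"
  shows "\<exists>H'. subgroup H' G \<and> H \<subseteq> H' \<and> H' \<subseteq> L \<and> card H' = p ^ j \<and> normalizes S H'"
  using j
proof (induction j rule: dec_induct)
  case base
  then show ?case using H L nH by blast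
next
  case (step n)
  have lt: "p ^ n < p ^ Suc n" using prime_power_less_iff[OF p] by blast
  then have nL': "p ^ n < card L" using step.prems by linarith
  then obtain H' where H': "subgroup H' G" "H \<subseteq> H'" "H' \<subseteq> L" "card H' = p ^ n" "normalizes S H'"
    using step by (meson less_imp_le_nat)
  have "card H' < card L" using H' nL' by simp
  from prime_step[OF p S H'(1) L(1) H'(3) L(3) H'(5) nL this] show ?case
    using H' by (metis order_trans power_Suc)
qed

section \<open>Sylow subgroups\<close>

lemma sylow_exists:
  fixes p :: nat
  assumes "Factorial_Ring.prime p"
  shows "\<exists>S. subgroup S G \<and> card S = p ^ multiplicity p (card (carrier G))"
proof -
  obtain m where "order G = p ^ multiplicity p (order G) * m" using multiplicity_dvd by (metis dvdE)
  then show ?thesis using sylow_thm[OF assms group_axioms _ fin] by (metis order_def)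
qed

lemma subgroup_eq_carrierI:
  assumes Y: "subgroup Y G"
    and syl: "\<And>q. Factorial_Ring.prime q \<Longrightarrow> \<exists>S. subgroup S G \<and> S \<subseteq> Y \<and> card S = q ^ multiplicity q (card (carrier G))"
  shows "Y = carrier G"
proof -
  have "card (carrier G) dvd card Y"
  proof (rule multiplicity_le_imp_dvd)
    show "card (carrier G) \<noteq> 0" using fin by auto
    fix q :: nat assume q: "Factorial_Ring.prime q"
    obtain S where S: "subgroup S G" "S \<subseteq> Y" "card S = q ^ multiplicity q (card (carrier G))" using syl[OF q] by blast
    then have "q ^ multiplicity q (card (carrier G)) dvd card Y" using card_subgroup_dvd[OF S(1) Y S(2)] by simp
    then show "multiplicity q (card (carrier G)) \<le> multiplicity q (card Y)"
      using q card_subgroup_pos[OF Y] by (intro multiplicity_geI) (auto simp: prime_gt_0_nat not_prime_unit)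
  qed
  then have "card (carrier G) \<le> card Y" using card_subgroup_pos[OF Y] by (simp add: dvd_imp_le)
  then show ?thesis using subgroup_eqI[OF Y subgroup_self] subgroup.subset[OF Y] by blast
qed

text \<open>Turns an index that is a power of \<open>p\<close> into normality: a normalizer
  containing a Sylow \<open>p\<close>-subgroup has index prime to \<open>p\<close>.\<close>

lemma sylow_prime_power_index:
  fixes p :: nat
  assumes p: "Factorial_Ring.prime p" and S: "subgroup S G" "card S = p ^ multiplicity p (card (carrier G))"
    and Y: "subgroup Y G" "S \<subseteq> Y" "card (carrier G) = p ^ m * card Y"
  shows "Y = carrier G"
proof -
  define e where "e = multiplicity p (card (carrier G))"
  have "p ^ e dvd card Y" using card_subgroup_dvd[OF S(1) Y(1,2)] S by (simp add: e_def)
  then have "p ^ (m + e) dvd card (carrier G)" using Y(3) by (simp add: power_add mult_dvd_mono)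
  then have "m + e \<le> e" unfolding e_def
    using p fin by (intro multiplicity_geI) (auto simp: not_prime_unit)
  then have "m = 0" by simp
  then show ?thesis using subgroup_eqI[OF Y(1) subgroup_self] subgroup.subset[OF Y(1)] Y(3) by simp
qed

text \<open>\<open>S <#> P\<close> has \<open>p\<close>-power order, and no such subgroup is larger
  than \<open>S\<close>.\<close>

lemma normal_subset_sylow:
  fixes p :: nat
  assumes p: "Factorial_Ring.prime p" and S: "subgroup S G" "card S = p ^ multiplicity p (card (carrier G))"
    and P: "P \<lhd> G" "card P = p ^ m"
  shows "P \<subseteq> S"
proof -
  note Ps = normalD_subgroup[OF P(1)]
  let ?e = "multiplicity p (card (carrier G))"
  have sub: "subgroup (S <#> P) G" by (rule subgroup_set_mult_normal[OF S(1) P(1)])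
  have "card (S <#> P) dvd card S * card P" using card_normalizing_mult[OF S(1) Ps] by (metis dvd_triv_left)
  then have "card (S <#> P) dvd p ^ (?e + m)" using S P by (simp add: power_add)
  then obtain k where k: "card (S <#> P) = p ^ k" using divides_primepow_nat[OF p] by blast
  then have "p ^ k dvd card (carrier G)" using card_subgroup_dvd[OF sub subgroup_self] subgroup.subset[OF sub] by simp
  then have "k \<le> ?e" using p fin by (intro multiplicity_geI) (auto simp: not_prime_unit)
  then have "card (S <#> P) \<le> card S" using k S prime_power_le_iff[OF p] by simp
  moreover have "S \<subseteq> S <#> P" using set_mult_subset_left[OF Ps subgroup.subset[OF S(1)]] .
  ultimately have "S = S <#> P" using subgroup_eqI[OF S(1) sub] by blast
  then show ?thesis using set_mult_subset_right[OF S(1) subgroup.subset[OF Ps]] by simp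
qed

end

section \<open>Eigenvectors of operators of order dividing \<open>p - 1\<close>\<close>

text \<open>Replacing \<open>c\<close> by \<open>g * c\<close> for a primitive root \<open>g\<close>
  permutes the nonzero residues and multiplies the sum by \<open>g ^ j\<close>, which is not 1
  modulo \<open>p\<close>.\<close>

lemma sum_powers_cong_0:
  fixes p j :: nat
  assumes p: "Factorial_Ring.prime p" and j: "0 < j" "j < p - 1"
  shows "[(\<Sum>c = 1..p - 1. c ^ j) = 0] (mod p)"
proof -
  obtain g where g: "residue_primroot p g" using prime_primitive_root_exists[OF prime_gt_1_nat[OF p] p] by blast
  then have cop: "coprime p g" and ordg: "Pocklington.ord p g = p - 1"
    using p by (auto simp: residue_primroot_def totient_prime)
  have ndvd: "\<not> p dvd g" using cop p by (metis coprime_absorb_left not_prime_unit)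
  have "\<not> [g ^ j = 1] (mod p)" using j ordg ord_divides[of g j p] by (auto dest: dvd_imp_le)
  define S where "S = (\<Sum>c = 1..p - 1. c ^ j)"
  let ?f = "\<lambda>c. (g * c) mod p"
  have inj: "inj_on ?f {1..p - 1}"
  proof (rule inj_onI)
    fix a b assume ab: "a \<in> {1..p - 1}" "b \<in> {1..p - 1}" "(g * a) mod p = (g * b) mod p"
    then have "[a = b] (mod p)" using cop by (metis cong_def cong_mult_lcancel_nat coprime_commute)
    then show "a = b" using ab(1,2) by (auto simp: cong_def)
  qed
  have "?f ` {1..p - 1} \<subseteq> {1..p - 1}"
  proof
    fix y assume "y \<in> ?f ` {1..p - 1}"
    then obtain c where c: "c \<in> {1..p - 1}" "y = (g * c) mod p" by blast
    have "\<not> p dvd c" using c(1) by (auto dest: dvd_imp_le)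
    then have "\<not> p dvd g * c" using ndvd p by (simp add: prime_dvd_mult_iff)
    then have "y \<noteq> 0" using c(2) by (auto simp: dvd_eq_mod_eq_0)
    moreover have "y < p" using c(2) prime_gt_0_nat[OF p] by simp
    ultimately show "y \<in> {1..p - 1}" by auto
  qed
  then have img: "?f ` {1..p - 1} = {1..p - 1}" using inj by (simp add: endo_inj_surj)
  have "S = (\<Sum>c = 1..p - 1. ?f c ^ j)"
    unfolding S_def by (subst img[symmetric], subst sum.reindex[OF inj]) (simp add: o_def)
  also have "[\<dots> = (\<Sum>c = 1..p - 1. (g * c) ^ j)] (mod p)"
    by (rule cong_sum) (simp add: cong_def power_mod)
  also have "(\<Sum>c = 1..p - 1. (g * c) ^ j) = g ^ j * S"
    by (simp add: S_def power_mult_distrib sum_distrib_left)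
  finally have "[int S = int (g ^ j) * int S] (mod int p)" by (metis cong_int_iff of_nat_mult)
  then have "int p dvd (int (g ^ j) - 1) * int S"
    by (simp add: cong_iff_dvd_diff algebra_simps dvd_diff_commute)
  moreover have "\<not> int p dvd int (g ^ j) - 1"
    using \<open>\<not> [g ^ j = 1] (mod p)\<close> by (metis cong_iff_dvd_diff cong_int_iff of_nat_1)
  ultimately have "int p dvd int S" using p by (metis prime_dvd_mult_iff prime_nat_int_transfer)
  then have "[S = 0] (mod p)" by (simp add: cong_0_iff)
  then show ?thesis by (simp only: S_def)
qed

context comm_group
begin

lemma hom_finprod:
  assumes "\<tau> \<in> hom G G" "finite A" "f \<in> A \<rightarrow> carrier G"
  shows "\<tau> (finprod G f A) = finprod G (\<lambda>x. \<tau> (f x)) A"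
  using assms(2,3)
proof (induction A rule: finite_induct)
  case empty
  show ?case using assms(1) hom_one[OF assms(1) is_group is_group] by simp
next
  case (insert x F)
  have "(\<lambda>x. \<tau> (f x)) \<in> F \<rightarrow> carrier G" "\<tau> (f x) \<in> carrier G" using insert assms(1) by (auto simp: hom_def)
  then show ?case using insert assms(1) by (auto simp: hom_mult Pi_iff)
qed

lemma pow_hom: "(\<lambda>x. x [^] (n::nat)) \<in> hom G G"
  by (auto simp: hom_def nat_pow_distrib)

lemma finprod_swap:
  assumes "finite A" "finite B" "\<And>i j. i \<in> A \<Longrightarrow> j \<in> B \<Longrightarrow> f i j \<in> carrier G"
  shows "finprod G (\<lambda>i. finprod G (f i) B) A = finprod G (\<lambda>j. finprod G (\<lambda>i. f i j) A) B"
  using assms(1,3)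
proof (induction A rule: finite_induct)
  case empty
  show ?case by simp
next
  case (insert x F)
  have cl: "(\<lambda>i. finprod G (f i) B) \<in> F \<rightarrow> carrier G" "finprod G (f x) B \<in> carrier G"
    "f x \<in> B \<rightarrow> carrier G" "(\<lambda>j. finprod G (\<lambda>i. f i j) F) \<in> B \<rightarrow> carrier G"
    using insert by (auto intro!: finprod_closed)
  have "finprod G (\<lambda>i. finprod G (f i) B) (insert x F) = finprod G (f x) B \<otimes> finprod G (\<lambda>j. finprod G (\<lambda>i. f i j) F) B"
    using insert cl by simp
  also have "\<dots> = finprod G (\<lambda>j. f x j \<otimes> finprod G (\<lambda>i. f i j) F) B"
    using cl by (simp add: finprod_multf)
  also have "\<dots> = finprod G (\<lambda>j. finprod G (\<lambda>i. f i j) (insert x F)) B"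
    using insert cl by (intro finprod_cong') (auto simp: Pi_iff)
  finally show ?case .
qed

lemma finprod_pow_sum:
  assumes "finite A" "v \<in> carrier G"
  shows "finprod G (\<lambda>i. v [^] (c i :: nat)) A = v [^] (\<Sum>i\<in>A. c i)"
  using assms(1)
proof (induction A rule: finite_induct)
  case (insert x F)
  then show ?case using assms(2) by (simp add: nat_pow_mult)
qed simp

lemma pow_cong:
  fixes a b p :: nat
  assumes "v \<in> carrier G" "v [^] p = \<one>" "[a = b] (mod p)"
  shows "v [^] a = v [^] b"
proof -
  have *: "v [^] n = v [^] (n mod p)" for n
  proof -
    have "v [^] n = v [^] (p * (n div p) + n mod p)" by simp
    also have "\<dots> = (v [^] p) [^] (n div p) \<otimes> v [^] (n mod p)"
      using assms(1) by (simp only: nat_pow_mult[symmetric] nat_pow_pow)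
    finally show ?thesis using assms by simp
  qed
  show ?thesis using *[of a] *[of b] assms(3) by (simp add: cong_def)
qed

text \<open>For \<open>c = 1, \<dots>, p - 1\<close> put \<open>e\<^sub>c = \<Prod>\<^sub>j (\<tau>\<^sup>j v)\<close> raised to \<open>c\<^sup>j\<close>.  Then \<open>\<tau>\<close> acts on
  \<open>e\<^sub>c\<close> as the power \<open>c\<^sup>-\<^sup>1\<close>, and the product of all \<open>e\<^sub>c\<close> is the inverse of \<open>v\<close>.\<close>

lemma exists_eigenvector:
  fixes p :: nat
  assumes p: "Factorial_Ring.prime p" and exp: "\<And>x. x \<in> carrier G \<Longrightarrow> x [^] p = \<one>"
    and \<tau>: "\<tau> \<in> hom G G" and v: "v \<in> carrier G" "v \<noteq> \<one>" and per: "(\<tau> ^^ (p - 1)) v = v"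
  shows "\<exists>e\<in>carrier G. e \<noteq> \<one> \<and> (\<exists>i::nat. \<tau> e = e [^] i)"
proof -
  define w where "w j = (\<tau> ^^ j) v" for j
  have w: "w j \<in> carrier G" for j
    by (induction j) (use v \<tau> in \<open>auto simp: w_def hom_def\<close>)
  define e where "e c = finprod G (\<lambda>j. w j [^] (c ^ j)) {..<p - 1}" for c :: nat
  have e: "e c \<in> carrier G" for c unfolding e_def using w by (intro finprod_closed) auto
  have p1: "p - 1 > 0" using prime_gt_1_nat[OF p] by simp
  \<comment> \<open>The eigenvalue equation with \<open>c\<close> moved to the left. Applying
    \<open>\<tau>\<close> and raising to the power \<open>c\<close> shifts \<open>j\<close> to
    \<open>j + 1\<close>, and the last term becomes the first because \<open>w (p - 1) = w 0\<close>
    and \<open>c ^ (p - 1)\<close> is 1 modulo \<open>p\<close>.\<close>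
  have \<tau>e: "(\<tau> (e c)) [^] c = e c" if c: "c \<in> {1..p - 1}" for c
  proof -
    have "\<not> p dvd c" using c by (auto dest: dvd_imp_le)
    then have fl: "[c ^ (p - 1) = 1] (mod p)" by (rule fermat_theorem[OF p])
    have pw: "\<tau> (x [^] (n::nat)) = \<tau> x [^] n" if "x \<in> carrier G" for x n
      using that hom_nat_pow[OF \<tau> _ is_group is_group] group_hom.hom_nat_pow[OF group_hom.intro[OF is_group is_group group_hom_axioms.intro[OF \<tau>]]] by blast
    have "\<tau> (e c) [^] c = finprod G (\<lambda>j. \<tau> (w j [^] (c ^ j))) {..<p - 1} [^] c"
      unfolding e_def by (subst hom_finprod[OF \<tau>]) (auto simp: w)
    also have "\<dots> = finprod G (\<lambda>j. (\<tau> (w j [^] (c ^ j))) [^] c) {..<p - 1}"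
      by (rule hom_finprod[OF pow_hom]) (use w \<tau> in \<open>auto simp: hom_def\<close>)
    also have "\<dots> = finprod G (\<lambda>j. w (Suc j) [^] (c ^ Suc j)) {..<p - 1}"
    proof (rule finprod_cong')
      fix j assume "j \<in> {..<p - 1}"
      have "\<tau> (w j [^] (c ^ j)) [^] c = (\<tau> (w j)) [^] (c ^ j * c)"
        using pw[OF w] w[of "Suc j"] by (simp add: nat_pow_pow w_def)
      then show "\<tau> (w j [^] (c ^ j)) [^] c = w (Suc j) [^] (c ^ Suc j)" by (simp add: w_def mult.commute)
    qed (use w in auto)
    also have "\<dots> = finprod G (\<lambda>j. w j [^] (c ^ j)) (Suc ` {..<p - 1})"
      by (subst finprod_reindex) (auto simp: w)
    also have "Suc ` {..<p - 1} = insert (p - 1) {1..<p - 1}"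
      using p1 by (auto simp: image_Suc_lessThan)
    also have "finprod G (\<lambda>j. w j [^] (c ^ j)) (insert (p - 1) {1..<p - 1})
        = w (p - 1) [^] (c ^ (p - 1)) \<otimes> finprod G (\<lambda>j. w j [^] (c ^ j)) {1..<p - 1}"
      by (subst finprod_insert) (auto simp: w)
    also have "w (p - 1) [^] (c ^ (p - 1)) = w 0 [^] (c ^ 0)"
      using per pow_cong[OF v(1) exp[OF v(1)] fl] v by (simp add: w_def)
    also have "w 0 [^] (c ^ 0) \<otimes> finprod G (\<lambda>j. w j [^] (c ^ j)) {1..<p - 1}
        = finprod G (\<lambda>j. w j [^] (c ^ j)) (insert 0 {1..<p - 1})"
      by (subst finprod_insert) (auto simp: w)
    also have "insert 0 {1..<p - 1} = {..<p - 1}" using p1 by auto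
    finally show ?thesis by (simp add: e_def)
  qed
  have "finprod G e {1..p - 1} = finprod G (\<lambda>j. finprod G (\<lambda>c. w j [^] (c ^ j)) {1..p - 1}) {..<p - 1}"
    unfolding e_def by (rule finprod_swap) (auto simp: w)
  \<comment> \<open>By the vanishing of power sums only \<open>j = 0\<close> survives, with exponent
    \<open>p - 1\<close>. As \<open>v\<close> has order \<open>p\<close>, the product is not 1, so
    some \<open>e c\<close> is not 1 either.\<close>
  also have "\<dots> = finprod G (\<lambda>j. if j = 0 then v [^] (p - 1) else \<one>) {..<p - 1}"
  proof (rule finprod_cong')
    fix j assume j: "j \<in> {..<p - 1}"
    have *: "finprod G (\<lambda>c. w j [^] (c ^ j)) {1..p - 1} = w j [^] (\<Sum>c = 1..p - 1. c ^ j)"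
      by (rule finprod_pow_sum) (auto simp: w)
    show "finprod G (\<lambda>c. w j [^] (c ^ j)) {1..p - 1} = (if j = 0 then v [^] (p - 1) else \<one>)"
    proof (cases "j = 0")
      case False
      then have "w j [^] (\<Sum>c = 1..p - 1. c ^ j) = w j [^] (0::nat)"
        using j by (intro pow_cong[OF w exp[OF w]] sum_powers_cong_0 p) auto
      then show ?thesis using * False by simp
    qed (use * in \<open>simp add: w_def\<close>)
  qed (use v in auto)
  also have "\<dots> = v [^] (p - 1)"
    using p1 v by (simp add: finprod_singleton_swap)
  finally have prod: "finprod G e {1..p - 1} = v [^] (p - 1)" .
  have "v [^] (p - 1) \<noteq> \<one>"
  proof
    assume "v [^] (p - 1) = \<one>"
    moreover have "v [^] p = v [^] (p - 1) \<otimes> v" using p1 by (metis Suc_diff_1 nat_pow_Suc prime_gt_0_nat[OF p])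
    ultimately show False using exp[OF v(1)] v by simp
  qed
  then obtain c where c: "c \<in> {1..p - 1}" "e c \<noteq> \<one>"
    using prod finprod_one_eqI[of "{1..p - 1}" e] by metis
  have "\<not> p dvd c" using c(1) by (auto dest: dvd_imp_le)
  then have "coprime c p" using prime_imp_coprime[OF p] by (simp add: coprime_commute)
  \<comment> \<open>\<open>d\<close> inverts \<open>c\<close> modulo \<open>p\<close>, which moves
    the exponent to the other side.\<close>
  then obtain d where d: "[c * d = 1] (mod p)" using cong_solve_coprime_nat by auto
  have \<tau>c: "\<tau> (e c) \<in> carrier G" using e \<tau> by (auto simp: hom_def)
  have "\<tau> (e c) [^] (c * d) = \<tau> (e c) [^] (1::nat)" by (rule pow_cong[OF \<tau>c exp[OF \<tau>c] d])
  then have "\<tau> (e c) = (\<tau> (e c) [^] c) [^] d" using \<tau>c by (simp add: nat_pow_pow)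
  then have "\<tau> (e c) = e c [^] d" using \<tau>e[OF c(1)] by simp
  then show ?thesis using e c by blast
qed

end

section \<open>Chief factors and series with factors of order \<open>p\<close>\<close>

text \<open>The lower end \<open>N\<close> is a parameter, so that a series of a quotient
  \<open>P/N\<close> can be expressed by subgroups of \<open>G\<close> and glued to a series of
  \<open>N\<close>.\<close>

inductive p_series :: "('a, 'b) monoid_scheme \<Rightarrow> nat \<Rightarrow> 'a set \<Rightarrow> 'a set \<Rightarrow> bool"
  for G :: "('a, 'b) monoid_scheme" and p :: nat and N :: "'a set" where
  refl: "N \<lhd> G \<Longrightarrow> p_series G p N N"
| step: "p_series G p N K \<Longrightarrow> L \<lhd> G \<Longrightarrow> K \<subseteq> L \<Longrightarrow> card L = p * card K \<Longrightarrow> p_series G p N L"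

lemma p_series_normal:
  "p_series G p N M \<Longrightarrow> N \<lhd> G" "p_series G p N M \<Longrightarrow> M \<lhd> G" "p_series G p N M \<Longrightarrow> N \<subseteq> M"
  by (induction rule: p_series.induct) auto

lemma p_series_trans: "p_series G p K M \<Longrightarrow> p_series G p N K \<Longrightarrow> p_series G p N M"
  by (induction rule: p_series.induct) (auto intro: p_series.step)

context fin_group
begin

text \<open>A Jordan-Hoelder argument for a single chief factor. At the first member
  \<open>Z\<close> of the series with \<open>Z \<inter> L\<close> not in \<open>K\<close>, preceded
  by \<open>Y\<close>, both \<open>L/K\<close> and \<open>Z/Y\<close> are isomorphic to
  \<open>(Z \<inter> L)/(Y \<inter> L)\<close>; only the orders are compared.\<close>

lemma p_series_chief_card:
  assumes p: "Factorial_Ring.prime p" and LK: "chief_factor G L K"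
    and M: "p_series G p N M" and NL: "N \<inter> L \<subseteq> K"
  shows "M \<inter> L \<subseteq> K \<or> card L = p * card K"
  using M
proof (induction rule: p_series.induct)
  case refl
  then show ?case using NL by blast
next
  case (step Y Z)
  have L: "L \<lhd> G" "K \<lhd> G" "K \<subset> L" and max: "\<And>M. M \<lhd> G \<Longrightarrow> K \<subseteq> M \<Longrightarrow> M \<subseteq> L \<Longrightarrow> M = K \<or> M = L"
    using LK by (auto simp: chief_factor_def)
  have Y: "Y \<lhd> G" using step p_series_normal by blast
  note Z = \<open>Z \<lhd> G\<close>
  note Ls = normalD_subgroup[OF L(1)] and Ks = normalD_subgroup[OF L(2)]
    and Ys = normalD_subgroup[OF Y] and Zs = normalD_subgroup[OF Z]
  show ?case
  proof (cases "Z \<inter> L \<subseteq> K \<or> card L = p * card K")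
    case False
    then have YL: "Y \<inter> L \<subseteq> K" using step.IH by blast
    let ?W = "Z \<inter> L"
    have W: "?W \<lhd> G" using normal_Int Z L by blast
    note Ws = normalD_subgroup[OF W]
    have "?W <#> K \<lhd> G" using normal_set_mult W L by blast
    moreover have "K \<subseteq> ?W <#> K" "?W \<subseteq> ?W <#> K" "?W <#> K \<subseteq> L"
      using set_mult_subset_right[OF Ws subgroup.subset[OF Ks]] set_mult_subset_left[OF Ks subgroup.subset[OF Ws]]
        set_mult_subset[OF Ls, of ?W K] L by auto
    ultimately have WK: "?W <#> K = L" using max[of "?W <#> K"] False by blast
    have "?W <#> Y \<lhd> G" using normal_set_mult W Y by blast
    then have WYs: "subgroup (?W <#> Y) G" by (rule normalD_subgroup)
    have sub: "Y \<subseteq> ?W <#> Y" "?W \<subseteq> ?W <#> Y" "?W <#> Y \<subseteq> Z"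
      using set_mult_subset_right[OF Ws subgroup.subset[OF Ys]] set_mult_subset_left[OF Ys subgroup.subset[OF Ws]]
        set_mult_subset[OF Zs, of ?W Y] step.hyps by auto
    then have "?W <#> Y = Y \<or> ?W <#> Y = Z"
      using between_prime_index[OF p Ys WYs Zs] step.hyps by blast
    moreover have "?W <#> Y \<noteq> Y" using sub False YL by blast
    ultimately have WY: "?W <#> Y = Z" by blast
    have i: "?W \<inter> Y = Y \<inter> L" using step.hyps by blast
    have "card Z * card (Y \<inter> L) = card ?W * card Y" using card_normalizing_mult[OF Ws Ys] WY i by simp
    then have cW: "card ?W = p * card (Y \<inter> L)"
      using step.hyps card_subgroup_pos[OF Ys] by simp
    have "?W \<inter> K = Y \<inter> L \<or> ?W \<inter> K = ?W"
      using cW YL step.hyps normal_Int[OF Y L(1)] normal_Int[OF W L(2)]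
      by (intro between_prime_index[OF p _ _ Ws]) (auto dest: normalD_subgroup)
    then have "?W \<inter> K = Y \<inter> L" using False by blast
    then have eq: "card L * card (Y \<inter> L) = card ?W * card K" using card_normalizing_mult[OF Ws Ks] WK by simp
    have "card (Y \<inter> L) > 0" using normalD_subgroup[OF normal_Int[OF Y L(1)]] by (rule card_subgroup_pos)
    then show ?thesis using eq cW by auto
  qed auto
qed

text \<open>\<open>Z \<inter> (Y <#> A)\<close> lies between \<open>Y\<close> and \<open>Z\<close>,
  hence is one of them: after multiplication by \<open>A\<close> the factor \<open>Z/Y\<close>
  either collapses or keeps its order.\<close>

lemma p_series_mult:
  assumes p: "Factorial_Ring.prime p" and M: "p_series G p N M" and A: "A \<lhd> G" "N \<subseteq> A"
  shows "p_series G p A (M <#> A)"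
  using M
proof (induction rule: p_series.induct)
  case refl
  have "N <#> A = A"
    using set_mult_subset[OF normalD_subgroup[OF A(1)] A(2)] set_mult_subset_right[OF normalD_subgroup[OF refl] subgroup.subset[OF normalD_subgroup[OF A(1)]]]
    by blast
  then show ?case using A by (simp add: p_series.refl)
next
  case (step Y Z)
  have Y: "Y \<lhd> G" using step p_series_normal by blast
  note Z = \<open>Z \<lhd> G\<close>
  have n: "Y <#> A \<lhd> G" "Z <#> A \<lhd> G" using Y Z A normal_set_mult by auto
  note s = normalD_subgroup[OF Y] normalD_subgroup[OF Z] normalD_subgroup[OF A(1)] normalD_subgroup[OF n(1)] normalD_subgroup[OF n(2)]
  note sc = s[THEN subgroup.subset]
  have Y1: "Y \<subseteq> Y <#> A" "A \<subseteq> Y <#> A" "Z \<subseteq> Z <#> A" "A \<subseteq> Z <#> A"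
    by (rule set_mult_subset_left[OF s(3) sc(1)] set_mult_subset_right[OF s(1) sc(3)]
        set_mult_subset_left[OF s(3) sc(2)] set_mult_subset_right[OF s(2) sc(3)])+
  have YZ: "Y <#> A \<subseteq> Z <#> A" using mono_set_mult[OF step.hyps(3), of A A] by simp
  let ?I = "Z \<inter> (Y <#> A)"
  have I: "subgroup ?I G" using normal_Int[OF Z n(1)] by (rule normalD_subgroup)
  have "?I = Y \<or> ?I = Z"
    using between_prime_index[OF p s(1) I s(2)] Y1 step.hyps by auto
  then show ?case
  proof
    assume e: "?I = Z"
    then have "Z <#> A \<subseteq> Y <#> A" using set_mult_subset[OF s(4), of Z A] Y1 by blast
    then have "Z <#> A = Y <#> A" using YZ by blast
    then show ?thesis using step.IH by simp
  next
    assume e: "?I = Y"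
    have "Z <#> (Y <#> A) = Z <#> A"
    proof
      show "Z <#> (Y <#> A) \<subseteq> Z <#> A" using set_mult_subset[OF s(5), of Z "Y <#> A"] Y1 YZ by blast
      show "Z <#> A \<subseteq> Z <#> (Y <#> A)" using mono_set_mult[of Z Z A "Y <#> A"] Y1 by blast
    qed
    then have "card (Z <#> A) * card Y = card Z * card (Y <#> A)"
      using card_normalizing_mult[OF s(2) s(4)] e by simp
    then have "card (Z <#> A) = p * card (Y <#> A)"
      using step.hyps card_subgroup_pos[OF s(1)] by simp
    then show ?thesis using step.IH n YZ p_series.step by blast
  qed
qed

section \<open>Chief factors below a normal \<open>p\<close>-subgroup\<close>

lemma exists_chief_factor_above:
  assumes "K \<lhd> G" "L \<lhd> G" "K \<subset> L"
  shows "\<exists>M. chief_factor G M K \<and> M \<subseteq> L"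
proof -
  let ?P = "\<lambda>M. M \<lhd> G \<and> K \<subset> M \<and> M \<subseteq> L"
  have "?P L" using assms by blast
  from ex_has_least_nat[of ?P, OF this, of card]
  obtain M where M: "?P M \<and> (\<forall>N. ?P N \<longrightarrow> card M \<le> card N)" ..
  then have P: "?P M" and min: "\<forall>N. ?P N \<longrightarrow> card M \<le> card N" by blast+
  have "chief_factor G M K"
    unfolding chief_factor_def
  proof (intro conjI allI impI)
    fix N assume N: "N \<lhd> G \<and> K \<subseteq> N \<and> N \<subseteq> M"
    show "N = K \<or> N = M"
    proof (cases "N = K")
      case False
      then have "card M \<le> card N" using N P min by (metis psubsetI order_trans)
      then show ?thesis using subgroup_eqI[of N M] N P normalD_subgroup by blast
    qed simp
  qed (use P assms in auto)
  then show ?thesis using P by blast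
qed

lemma prime_index_chief:
  assumes p: "Factorial_Ring.prime p" and "K \<lhd> G" "L \<lhd> G" "K \<subseteq> L" "card L = p * card K"
  shows "chief_factor G L K"
  unfolding chief_factor_def
proof (intro conjI allI impI)
  have "card K \<noteq> card L" using assms card_subgroup_pos[OF normalD_subgroup[OF assms(2)]] prime_gt_1_nat[OF p] by auto
  then show "K \<subset> L" using assms by blast
  fix M assume "M \<lhd> G \<and> K \<subseteq> M \<and> M \<subseteq> L"
  then show "M = K \<or> M = L" using between_prime_index[OF p] assms normalD_subgroup by metis
qed (use assms in auto)

text \<open>Irreducibility: the fixed cosets make up a normal subgroup between \<open>K\<close> and
  \<open>L\<close>, so one of them outside \<open>K\<close> forces trivial action.\<close>

lemma chief_fixed:
  assumes "chief_factor G L K" "S \<subseteq> carrier G" "normalizes (carrier G) S"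
    and "x \<in> L" "x \<notin> K" "\<And>s. s \<in> S \<Longrightarrow> cmt s x \<in> K"
  shows "y \<in> L \<Longrightarrow> s \<in> S \<Longrightarrow> cmt s y \<in> K"
proof -
  have L: "L \<lhd> G" "K \<lhd> G" "K \<subseteq> L" using assms(1) by (auto simp: chief_factor_def)
  have "{x \<in> L. \<forall>s\<in>S. cmt s x \<in> K} = K \<or> {x \<in> L. \<forall>s\<in>S. cmt s x \<in> K} = L"
    using normal_fixed_mod[OF L(2,1,3) assms(2,3)] assms(1) unfolding chief_factor_def by blast
  then show "y \<in> L \<Longrightarrow> s \<in> S \<Longrightarrow> cmt s y \<in> K" using assms(4-6) by blast
qed

text \<open>A \<open>p\<close>-group fixes some nontrivial coset of the \<open>p\<close>-group
  \<open>L/K\<close>, and then all of them. So \<open>L/K\<close> is central in \<open>P/K\<close>;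
  with \<open>P = L\<close> this also says that \<open>L/K\<close> is abelian.\<close>

lemma chief_commutator:
  fixes p :: nat
  assumes p: "Factorial_Ring.prime p" and P: "P \<lhd> G" "card P = p ^ m" and LK: "chief_factor G L K" "L \<subseteq> P"
    and x: "x \<in> L" and y: "y \<in> P"
  shows "cmt y x \<in> K"
proof -
  have L: "L \<lhd> G" "K \<lhd> G" "K \<subset> L" using LK(1) by (auto simp: chief_factor_def)
  note s = normalD_subgroup[OF L(1)] normalD_subgroup[OF L(2)] normalD_subgroup[OF P(1)]
  have "card L dvd p ^ m" using card_subgroup_dvd[OF s(1,3) LK(2)] P by simp
  then obtain l where l: "card L = p ^ l" using divides_primepow_nat[OF p] by blast
  have "card K dvd p ^ l" using card_subgroup_dvd[OF s(2,1)] L l by auto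
  then obtain k where k: "card K = p ^ k" using divides_primepow_nat[OF p] by blast
  have "card K < card L" using card_psubset_subgroup[OF s(1)] L by blast
  then have "Suc k \<le> l" using k l prime_power_less_iff[OF p] by simp
  then have "p * card K dvd card L" using k l prime_power_dvd_iff[OF p, of "Suc k" l] by simp
  moreover have "normalizes P K" "normalizes P L" using L P normalD_cj normal_carrierD by blast+
  ultimately obtain z where z: "z \<in> L" "z \<notin> K" "\<forall>s\<in>P. cmt s z \<in> K"
    using fixed_coset[OF p s(3) P(2) s(2,1)] L by blast
  show ?thesis
    by (rule chief_fixed[OF LK(1), of P z]) (use z x y P normalD_cj subgroup.subset[OF s(3)] in auto)
qed

text \<open>In the abelian group \<open>L/K\<close> the elements of order dividing \<open>p\<close>
  form a \<open>G\<close>-invariant subgroup, which is not trivial.\<close>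

lemma chief_power:
  fixes p :: nat
  assumes p: "Factorial_Ring.prime p" and P: "P \<lhd> G" "card P = p ^ m" and LK: "chief_factor G L K" "L \<subseteq> P"
    and x: "x \<in> L"
  shows "x [^] p \<in> K"
proof -
  have L: "L \<lhd> G" "K \<lhd> G" "K \<subset> L" using LK(1) by (auto simp: chief_factor_def)
  note s = normalD_subgroup[OF L(1)] normalD_subgroup[OF L(2)] normalD_subgroup[OF P(1)]
  note Lc = normal_carrierD[OF L(1)] and Kc = normal_carrierD[OF L(2)]
  have "card L dvd p ^ m" using card_subgroup_dvd[OF s(1,3) LK(2)] P by simp
  then obtain l where l: "card L = p ^ l" using divides_primepow_nat[OF p] by blast
  define F where "F = {x \<in> L. x [^] p \<in> K}"
  have "F \<lhd> G" unfolding normal_iff_cj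
  proof (intro conjI ballI)
    show "subgroup F G"
    proof (rule subgroupI')
      show "F \<subseteq> carrier G" using Lc by (auto simp: F_def)
      show "\<one> \<in> F" using s by (auto simp: F_def subgroup.one_closed)
      show "a \<otimes> b \<in> F" if ab: "a \<in> F" "b \<in> F" for a b
      proof -
        have c: "a \<in> L" "b \<in> L" "a [^] p \<in> K" "b [^] p \<in> K" using ab by (auto simp: F_def)
        then have "cmt a b \<in> K" using chief_commutator[OF p P LK] LK(2) by blast
        then have "K #> ((a \<otimes> b) [^] p) = K #> (a [^] p \<otimes> b [^] p)" using pow_mult_mod[OF L(2)] c Lc by blast
        also have "\<dots> = K" using c s(2) by (metis rcoset_eq_self_iff subgroup.m_closed subgroup.mem_carrier)
        finally have "(a \<otimes> b) [^] p \<in> K" using c Lc rcoset_eq_self_iff[OF s(2)] by simp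
        then show ?thesis using c subgroup.m_closed[OF s(1)] by (simp add: F_def)
      qed
      show "inv a \<in> F" if "a \<in> F" for a
        using that Lc subgroup.m_inv_closed[OF s(1)] subgroup.m_inv_closed[OF s(2)] by (auto simp: F_def nat_pow_inv)
    qed
    show "cj g a \<in> F" if "g \<in> carrier G" "a \<in> F" for g a
      using that L Lc normalD_cj by (auto simp: F_def cj_pow[symmetric])
  qed
  moreover have "K \<subseteq> F" using L nat_pow_mem[OF s(2)] by (auto simp: F_def)
  moreover have "F \<subseteq> L" by (auto simp: F_def)
  ultimately have "F = K \<or> F = L" using LK(1) unfolding chief_factor_def by blast
  moreover have "F \<noteq> K"
  proof -
    obtain z where z: "z \<in> L" "z \<notin> K" using L by blast
    obtain n where "z [^] (p ^ n) \<notin> K" "(z [^] (p ^ n)) [^] p \<in> K" using exists_prime_root[OF p s(1) l s(2) z] by blast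
    then show ?thesis using nat_pow_mem[OF s(1) z(1)] by (auto simp: F_def)
  qed
  ultimately show ?thesis using x by (auto simp: F_def)
qed

end

section \<open>The action of \<open>G\<close> on factors of order \<open>p\<close>\<close>

context fin_group
begin

lemma rcoset_cong_cj:
  assumes K: "K \<lhd> G" and c: "g \<in> carrier G" "x \<in> carrier G" "y \<in> carrier G" and "K #> x = K #> y"
  shows "K #> cj g x = K #> cj g y"
proof -
  note Ks = normalD_subgroup[OF K]
  have "x \<otimes> inv y \<in> K" using assms rcoset_eq_iff[OF Ks] by blast
  then have "cj g (x \<otimes> inv y) \<in> K" using normalD_cj[OF K] c by blast
  then show ?thesis using c rcoset_eq_iff[OF Ks] by (simp add: cj_mult cj_inv)
qed

lemma rcoset_cong_mult:
  assumes K: "K \<lhd> G" and c: "x \<in> carrier G" "y \<in> carrier G" "x' \<in> carrier G" "y' \<in> carrier G"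
    and "K #> x = K #> x'" "K #> y = K #> y'"
  shows "K #> (x \<otimes> y) = K #> (x' \<otimes> y')"
  using assms normal.rcos_sum[OF K] by metis

lemma rcoset_cong_pow:
  assumes K: "K \<lhd> G" and c: "x \<in> carrier G" "y \<in> carrier G" and "K #> x = K #> y"
  shows "K #> (x [^] (n::nat)) = K #> (y [^] n)"
  using assms rcoset_pow[OF K] by metis

lemma cmt_mem_iff_rcoset:
  assumes "K \<lhd> G" "g \<in> carrier G" "x \<in> carrier G"
  shows "cmt g x \<in> K \<longleftrightarrow> K #> cj g x = K #> x"
  using assms rcoset_eq_iff[OF normalD_subgroup[OF assms(1)]] by simp

lemma fixer_subgroup:
  assumes K: "K \<lhd> G" and x: "x \<in> carrier G" and B: "subgroup B G"
  shows "subgroup {g \<in> B. cmt g x \<in> K} G"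
proof (rule subgroupI')
  note Bc = subgroup.mem_carrier[OF B] and iff = cmt_mem_iff_rcoset[OF K _ x]
  show "{g \<in> B. cmt g x \<in> K} \<subseteq> carrier G" using Bc by blast
  show "\<one> \<in> {g \<in> B. cmt g x \<in> K}"
    using x B normalD_subgroup[OF K] by (simp add: subgroup.one_closed)
  fix g assume "g \<in> {g \<in> B. cmt g x \<in> K}"
  then have g: "g \<in> B" "g \<in> carrier G" "K #> cj g x = K #> x" using iff Bc by auto
  have "K #> cj (inv g) (cj g x) = K #> cj (inv g) x"
    by (rule rcoset_cong_cj[OF K]) (use g x in auto)
  then have "K #> cj (inv g) x = K #> x" using g x by simp
  then show "inv g \<in> {g \<in> B. cmt g x \<in> K}"
    using g B iff[of "inv g"] by (simp add: subgroup.m_inv_closed)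
  fix h assume "h \<in> {g \<in> B. cmt g x \<in> K}"
  then have h: "h \<in> B" "h \<in> carrier G" "K #> cj h x = K #> x" using iff Bc by auto
  have "K #> cj g (cj h x) = K #> cj g x"
    by (rule rcoset_cong_cj[OF K]) (use g h x in auto)
  then have "K #> cj (g \<otimes> h) x = K #> x" using g h x by (simp add: cj_cj)
  then show "g \<otimes> h \<in> {g \<in> B. cmt g x \<in> K}"
    using g h B iff[of "g \<otimes> h"] by (simp add: subgroup.m_closed)
qed

text \<open>The relation \<open>cmt g x \<in> K\<close> is symmetric in \<open>g\<close> and
  \<open>x\<close>, so the centralizer is also the set of elements of \<open>G\<close> fixed modulo
  \<open>K\<close> by \<open>L\<close>, and \<open>normal_fixed_mod\<close> applies.\<close>

lemma centralizer_normal: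
  assumes K: "K \<lhd> G" and L: "L \<lhd> G"
  shows "{g \<in> carrier G. \<forall>x\<in>L. cmt g x \<in> K} \<lhd> G"
proof -
  have "cmt x g \<in> K \<longleftrightarrow> cmt g x \<in> K" if "g \<in> carrier G" "x \<in> L" for g x
    using that normal_carrierD[OF L] by (metis cmt_mem_iff[OF K])
  then have "{g \<in> carrier G. \<forall>x\<in>L. cmt g x \<in> K} = {g \<in> carrier G. \<forall>x\<in>L. cmt x g \<in> K}" by blast
  moreover have "{g \<in> carrier G. \<forall>x\<in>L. cmt x g \<in> K} \<lhd> G"
    by (rule normal_fixed_mod[OF K normal_self])
      (use K L normal_carrierD normalD_cj in auto)
  ultimately show ?thesis by simp
qed

text \<open>\<open>L/K\<close> is generated by one coset, so \<open>g\<close> raises all of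
  \<open>L/K\<close> to a common power. Power maps commute, and by Fermat's theorem their
  \<open>(p - 1)\<close>-st iterates are trivial.\<close>

lemma power_action:
  fixes p :: nat
  assumes p: "Factorial_Ring.prime p" and Ln: "L \<lhd> G" "card L = p ^ l"
    and LK: "chief_factor G L K" and card: "card L = p * card K"
  shows "g \<in> carrier G \<Longrightarrow> \<exists>a::nat. \<forall>x\<in>L. K #> cj g x = K #> x [^] a"
    and "g \<in> carrier G \<Longrightarrow> h \<in> carrier G \<Longrightarrow> x \<in> L \<Longrightarrow> cmt (cmt g h) x \<in> K"
    and "g \<in> carrier G \<Longrightarrow> x \<in> L \<Longrightarrow> cmt (g [^] (p - 1)) x \<in> K"
proof -
  have L: "L \<lhd> G" "K \<lhd> G" "K \<subset> L" using LK by (auto simp: chief_factor_def)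
  note Ls = normalD_subgroup[OF L(1)] and Ks = normalD_subgroup[OF L(2)]
  note Lc = normal_carrierD[OF L(1)] and Kc = normal_carrierD[OF L(2)]
  obtain z where z: "z \<in> L" "z \<notin> K" using L by blast
  have zc: "z \<in> carrier G" using z Lc by blast
  have zp: "z [^] p \<in> K" by (rule chief_power[OF p Ln LK order_refl z(1)])
  have gen: "generate G {z} = range (\<lambda>n::nat. z [^] n)" using generate_singleton_finite zc by simp
  have e: "subgroup (generate G {z} <#> K) G" "card (generate G {z} <#> K) = p * card K"
    using prime_extension[OF p Ks zc z(2) zp] normalD_cj[OF L(2) zc] by auto
  have "generate G {z} \<subseteq> L" using gen nat_pow_mem[OF Ls z(1)] by auto
  then have "generate G {z} <#> K \<subseteq> L" using set_mult_subset[OF Ls] L by blast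
  then have eq: "generate G {z} <#> K = L" using subgroup_eqI[OF e(1) Ls] e card by simp
  have zn: "\<exists>i::nat. K #> x = K #> z [^] i" if "x \<in> L" for x
  proof -
    obtain i :: nat and k where ik: "k \<in> K" "x = z [^] i \<otimes> k" using \<open>x \<in> L\<close> unfolding eq[symmetric] gen mem_set_mult by auto
    have "x \<otimes> inv (z [^] i) = cj (z [^] i) k" using ik zc by (simp add: conjugate_def)
    then have "x \<otimes> inv (z [^] i) \<in> K" using normalD_cj[OF L(2)] ik zc by simp
    then show ?thesis using rcoset_eq_iff[OF Ks] Lc that zc by blast
  qed
  have act: "\<exists>a::nat. \<forall>x\<in>L. K #> cj g x = K #> x [^] a" if g: "g \<in> carrier G" for g
  proof -
    obtain a :: nat where a: "K #> cj g z = K #> z [^] a" using zn normalD_cj[OF L(1) g z(1)] by blast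
    have "K #> cj g x = K #> x [^] a" if x: "x \<in> L" for x
    proof -
      obtain i :: nat where i: "K #> x = K #> z [^] i" using zn x by blast
      have "K #> cj g x = K #> cj g (z [^] i)"
        by (rule rcoset_cong_cj[OF L(2) g]) (use x Lc zc i in auto)
      also have "\<dots> = K #> (cj g z) [^] i" using g zc by (simp add: cj_pow)
      also have "\<dots> = K #> (z [^] a) [^] i"
        by (rule rcoset_cong_pow[OF L(2)]) (use g zc a in auto)
      also have "\<dots> = K #> (z [^] i) [^] a" using zc by (simp add: nat_pow_pow mult.commute)
      also have "\<dots> = K #> x [^] a"
        by (rule rcoset_cong_pow[OF L(2)]) (use x Lc zc i in auto)
      finally show ?thesis .
    qed
    then show ?thesis by blast
  qed
  show "g \<in> carrier G \<Longrightarrow> \<exists>a::nat. \<forall>x\<in>L. K #> cj g x = K #> x [^] a" by (rule act)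
  have act2: "K #> cj g (cj h x) = K #> x [^] (a * b)"
    if "g \<in> carrier G" "h \<in> carrier G" "x \<in> L" "\<forall>x\<in>L. K #> cj g x = K #> x [^] (a::nat)"
      "\<forall>x\<in>L. K #> cj h x = K #> x [^] (b::nat)" for g h x a b
  proof -
    have "K #> cj g (cj h x) = K #> cj g (x [^] b)"
      by (rule rcoset_cong_cj[OF L(2)]) (use that Lc in auto)
    also have "\<dots> = K #> (x [^] b) [^] a" using that(4) nat_pow_mem[OF Ls that(3)] by blast
    finally show ?thesis using that Lc by (simp add: nat_pow_pow mult.commute)
  qed
  show "cmt (cmt g h) x \<in> K" if gh: "g \<in> carrier G" "h \<in> carrier G" and x: "x \<in> L"
  proof -
    obtain a b :: nat where ab: "\<forall>x\<in>L. K #> cj g x = K #> x [^] a" "\<forall>x\<in>L. K #> cj h x = K #> x [^] b"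
      using act gh by metis
    \<comment> \<open>With \<open>x = cj (h \<otimes> g) x'\<close> the action of
      \<open>cmt g h\<close> on \<open>x\<close> becomes that of \<open>g \<otimes> h\<close> on
      \<open>x'\<close>, to be compared with that of \<open>h \<otimes> g\<close>.\<close>
    define x' where "x' = cj (inv (h \<otimes> g)) x"
    have x': "x' \<in> L" "x' \<in> carrier G" "x \<in> carrier G" using gh x normalD_cj[OF L(1)] Lc by (auto simp: x'_def)
    have xe: "x = cj (h \<otimes> g) x'" using gh x' by (simp add: x'_def)
    have "cmt g h \<otimes> (h \<otimes> g) = g \<otimes> h"
      using gh by (simp add: conjugate_def m_assoc) (simp add: m_assoc[symmetric])
    then have "cj (cmt g h) x = cj g (cj h x')" using gh x' by (simp add: xe cj_cj)
    then have "K #> cj (cmt g h) x = K #> x' [^] (a * b)" using act2[OF gh x'(1) ab] by simp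
    also have "\<dots> = K #> cj h (cj g x')" using act2[OF gh(2,1) x'(1) ab(2,1)] by (simp add: mult.commute)
    also have "cj h (cj g x') = x" using xe gh x' by (simp add: cj_cj)
    finally show ?thesis using cmt_mem_iff_rcoset[OF L(2)] gh x' by simp
  qed
  show "cmt (g [^] (p - 1)) x \<in> K" if g: "g \<in> carrier G" and x: "x \<in> L"
  proof -
    obtain a :: nat where a: "\<forall>x\<in>L. K #> cj g x = K #> x [^] a" using act g by blast
    have pw: "K #> cj (g [^] (n::nat)) y = K #> y [^] (a ^ n)" if "y \<in> L" for n y
      using that
    proof (induction n arbitrary: y)
      case (Suc n)
      have c: "y \<in> carrier G" using Suc Lc by blast
      have "K #> cj (g [^] Suc n) y = K #> cj (g [^] n) (cj g y)" using g c by (simp add: cj_cj)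
      also have "\<dots> = K #> (cj g y) [^] (a ^ n)" using Suc normalD_cj[OF L(1) g] by blast
      also have "\<dots> = K #> (y [^] a) [^] (a ^ n)"
        by (rule rcoset_cong_pow[OF L(2)]) (use g c a Suc in auto)
      finally show ?case using c by (simp add: nat_pow_pow)
    qed (use Lc in auto)
    have "\<not> p dvd a"
    proof
      assume "p dvd a"
      then have "z [^] a \<in> K" using pow_mem_iff_dvd[OF p Ks zc z(2) zp] by blast
      then have "K #> cj g z = K" using a z rcoset_eq_self_iff[OF Ks] zc by simp
      then have "cj g z \<in> K" using rcoset_eq_self_iff[OF Ks] g zc by simp
      then have "cj (inv g) (cj g z) \<in> K" using normalD_cj[OF L(2)] g by blast
      then show False using g zc z by simp
    qed
    then have fl: "[a ^ (p - 1) = 1] (mod p)" by (rule fermat_theorem[OF p])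
    have xc: "x \<in> carrier G" using x Lc by blast
    interpret Q: group "G Mod K" by (rule normal.factorgroup_is_group[OF L(2)])
    have xK: "K #> x \<in> carrier (G Mod K)" using xc by (auto simp: carrier_FactGroup)
    have "x [^] p \<in> K" by (rule chief_power[OF p Ln LK order_refl x])
    then have "(K #> x) [^]\<^bsub>G Mod K\<^esub> p = \<one>\<^bsub>G Mod K\<^esub>"
      using rcoset_pow[OF L(2) xc] rcoset_eq_self_iff[OF Ks] xc by simp
    moreover have "(K #> x) [^]\<^bsub>G Mod K\<^esub> n = (K #> x) [^]\<^bsub>G Mod K\<^esub> (n mod p)" if "(K #> x) [^]\<^bsub>G Mod K\<^esub> p = \<one>\<^bsub>G Mod K\<^esub>" for n
    proof -
      have "(K #> x) [^]\<^bsub>G Mod K\<^esub> n = (K #> x) [^]\<^bsub>G Mod K\<^esub> (p * (n div p) + n mod p)" by simp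
      also have "\<dots> = ((K #> x) [^]\<^bsub>G Mod K\<^esub> p) [^]\<^bsub>G Mod K\<^esub> (n div p) \<otimes>\<^bsub>G Mod K\<^esub> (K #> x) [^]\<^bsub>G Mod K\<^esub> (n mod p)"
        using xK by (simp only: Q.nat_pow_mult[symmetric] Q.nat_pow_pow)
      finally show ?thesis using that xK by (simp del: mult_FactGroup one_FactGroup)
    qed
    ultimately have "(K #> x) [^]\<^bsub>G Mod K\<^esub> (a ^ (p - 1)) = (K #> x) [^]\<^bsub>G Mod K\<^esub> (1::nat)"
      using fl unfolding cong_def by metis
    then have "K #> x [^] (a ^ (p - 1)) = K #> x [^] (1::nat)" by (simp only: rcoset_pow[OF L(2) xc])
    then have "K #> x [^] (a ^ (p - 1)) = K #> x" using xc by simp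
    then show ?thesis using cmt_mem_iff_rcoset[OF L(2)] pw[OF x] g xc by simp
  qed
qed

text \<open>\<open>B\<close> consists of the elements acting trivially on all factors of the series: a \<open>p'\<close>-element
  stabilizing a chain of a \<open>p\<close>-group acts trivially on it.\<close>

lemma p_series_centralizer:
  fixes p :: nat
  assumes p: "Factorial_Ring.prime p" and M: "p_series G p N M" and cM: "card M = p ^ m"
  shows "\<exists>B. B \<lhd> G \<and> (\<forall>g\<in>carrier G. \<forall>h\<in>carrier G. cmt g h \<in> B) \<and> (\<forall>g\<in>carrier G. g [^] (p - 1) \<in> B) \<and>
    (\<forall>b\<in>B. coprime (ord b) p \<longrightarrow> (\<forall>x\<in>M. cmt b x \<in> N))"
  using M cM
proof (induction arbitrary: m rule: p_series.induct)
  case refl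
  have "cmt b x \<in> N" if "b \<in> carrier G" "x \<in> N" for b x
    using that normalD_cj[OF refl(1)] normalD_subgroup[OF refl(1)] by (simp add: subgroup.m_closed subgroup.m_inv_closed)
  then show ?case using normal_self by (intro exI[of _ "carrier G"]) auto
next
  case (step Y Z)
  have Y: "Y \<lhd> G" "N \<lhd> G" "N \<subseteq> Y" using step p_series_normal by blast+
  note Z = \<open>Z \<lhd> G\<close>
  note Ns = normalD_subgroup[OF Y(2)]
  note Zc = normal_carrierD[OF Z] and Yc = normal_carrierD[OF Y(1)]
  have "card Y dvd p ^ m" using card_subgroup_dvd[OF normalD_subgroup[OF Y(1)] normalD_subgroup[OF Z]] step by simp
  then obtain y where y: "card Y = p ^ y" using divides_primepow_nat[OF p] by blast
  obtain B where B: "B \<lhd> G" "\<And>g h. g \<in> carrier G \<Longrightarrow> h \<in> carrier G \<Longrightarrow> cmt g h \<in> B"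
    "\<And>g. g \<in> carrier G \<Longrightarrow> g [^] (p - 1) \<in> B"
    "\<And>b x. b \<in> B \<Longrightarrow> coprime (ord b) p \<Longrightarrow> x \<in> Y \<Longrightarrow> cmt b x \<in> N"
    using step.IH[OF y] by blast
  define C where "C = {g \<in> carrier G. \<forall>x\<in>Z. cmt g x \<in> Y}"
  have C: "C \<lhd> G" unfolding C_def by (rule centralizer_normal[OF Y(1) Z])
  have ch: "chief_factor G Z Y" by (rule prime_index_chief[OF p Y(1) Z]) (use step in auto)
  note pa = power_action[OF p Z step.prems ch \<open>card Z = p * card Y\<close>]
  have "B \<inter> C \<lhd> G" using normal_Int B C by blast
  moreover have "cmt g h \<in> B \<inter> C" if "g \<in> carrier G" "h \<in> carrier G" for g h
    using that B(2) pa(2) by (auto simp: C_def)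
  moreover have "g [^] (p - 1) \<in> B \<inter> C" if "g \<in> carrier G" for g
    using that B(3) pa(3) by (auto simp: C_def)
  moreover have "cmt b x \<in> N" if b: "b \<in> B \<inter> C" "coprime (ord b) p" and x: "x \<in> Z" for b x
  proof -
    have c: "b \<in> carrier G" "x \<in> carrier G" using b x Zc by (auto simp: C_def)
    define u where "u = cmt b x"
    have u: "u \<in> Y" "u \<in> carrier G" using b x Yc by (auto simp: C_def u_def)
    have up: "u [^] n \<in> Y" for n :: nat by (rule nat_pow_mem[OF normalD_subgroup[OF Y(1)] u(1)])
    \<comment> \<open>\<open>b\<close> fixes \<open>u \<in> Y\<close> modulo \<open>N\<close>, so
      the displacements of \<open>x\<close> accumulate to \<open>u [^] n\<close>. For
      \<open>n = ord b\<close> nothing has moved, so \<open>u [^] ord b\<close> lies in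
      \<open>N\<close>; as \<open>ord b\<close> is prime to \<open>p\<close> and \<open>u\<close> is
      a \<open>p\<close>-element, so does \<open>u\<close>.\<close>
    have "N #> cj (b [^] (n::nat)) x = N #> (u [^] n \<otimes> x)" for n
    proof (induction n)
      case (Suc n)
      have "N #> cj (b [^] Suc n) x = N #> cj b (cj (b [^] n) x)"
        using c by (simp add: cj_cj nat_pow_Suc2[symmetric] del: nat_pow_Suc)
      also have "\<dots> = N #> cj b (u [^] n \<otimes> x)"
        by (rule rcoset_cong_cj[OF Y(2)]) (use c u Suc in auto)
      also have "\<dots> = N #> (cj b (u [^] n) \<otimes> cj b x)" using c u by (simp add: cj_mult)
      also have "\<dots> = N #> (u [^] n \<otimes> (u \<otimes> x))"
      proof (rule rcoset_cong_mult[OF Y(2)])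
        have "cmt b (u [^] n) \<in> N" using B(4) b up by blast
        then show "N #> cj b (u [^] n) = N #> u [^] n" using cmt_mem_iff_rcoset[OF Y(2)] c u by simp
        show "N #> cj b x = N #> (u \<otimes> x)" using c by (simp add: u_def m_assoc)
      qed (use c u in auto)
      also have "\<dots> = N #> (u [^] Suc n \<otimes> x)" using c u by (simp add: m_assoc)
      finally show ?case .
    qed (use c in simp)
    from this[of "ord b"] have "N #> x = N #> (u [^] ord b \<otimes> x)" using c by simp
    then have "(u [^] ord b \<otimes> x) \<otimes> inv x \<in> N" using rcoset_eq_iff[OF Ns, of "u [^] ord b \<otimes> x" x] c u by simp
    then have uN: "u [^] ord b \<in> N" using c u by (simp add: m_assoc)
    show "u \<in> N"
    proof (rule ccontr)
      assume nu: "u \<notin> N"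
      obtain n where n: "u [^] (p ^ n) \<notin> N" "(u [^] (p ^ n)) [^] p \<in> N"
        using exists_prime_root[OF p normalD_subgroup[OF Y(1)] y Ns u(1) nu] by blast
      have "(u [^] (p ^ n)) [^] ord b = (u [^] ord b) [^] (p ^ n)" using u by (simp add: nat_pow_pow mult.commute)
      then have "(u [^] (p ^ n)) [^] ord b \<in> N" using nat_pow_mem[OF Ns uN] by simp
      then have "p dvd ord b" using pow_mem_iff_dvd[OF p Ns _ n] u by simp
      then show False using b(2) p by (metis coprime_absorb_right not_prime_unit)
    qed
  qed
  ultimately show ?case by (intro exI[of _ "B \<inter> C"]) auto
qed

text \<open>If all of \<open>G\<close> acts by powers, every subgroup of \<open>L/K\<close> is
  invariant, in particular one generated by a single coset; irreducibility leaves no room for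
  more.\<close>

lemma chief_card_prime:
  fixes p :: nat
  assumes p: "Factorial_Ring.prime p" and LK: "chief_factor G L K" and cL: "card L = p ^ l"
    and act: "\<And>g. g \<in> carrier G \<Longrightarrow> \<exists>a::nat. \<forall>x\<in>L. K #> cj g x = K #> x [^] a"
  shows "card L = p * card K"
proof -
  have L: "L \<lhd> G" "K \<lhd> G" "K \<subset> L" using LK by (auto simp: chief_factor_def)
  note Ls = normalD_subgroup[OF L(1)] and Ks = normalD_subgroup[OF L(2)]
  note Lc = normal_carrierD[OF L(1)] and Kc = normal_carrierD[OF L(2)]
  obtain z where z: "z \<in> L" "z \<notin> K" using L by blast
  have zc: "z \<in> carrier G" using z Lc by blast
  have zp: "z [^] p \<in> K" by (rule chief_power[OF p L(1) cL LK order_refl z(1)])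
  let ?W = "generate G {z} <#> K"
  have gen: "generate G {z} = range (\<lambda>n::nat. z [^] n)" using generate_singleton_finite zc by simp
  have e: "subgroup ?W G" "card ?W = p * card K"
    using prime_extension[OF p Ks zc z(2) zp] normalD_cj[OF L(2) zc] by auto
  have "generate G {z} \<subseteq> L" using gen nat_pow_mem[OF Ls z(1)] by auto
  then have sub: "?W \<subseteq> L" using set_mult_subset[OF Ls] L by blast
  have KW: "K \<subseteq> ?W" using set_mult_subset_right[of "generate G {z}" K] subgroup.subset[OF Ks] zc by (simp add: generate_is_subgroup)
  have zW: "z [^] (n::nat) \<otimes> k \<in> ?W" if "k \<in> K" for n k using gen that by (auto intro: set_multI)
  have "?W \<lhd> G" unfolding normal_iff_cj
  proof (intro conjI ballI)
    fix g w assume g: "g \<in> carrier G" and "w \<in> ?W"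
    then obtain n :: nat and k where w: "k \<in> K" "w = z [^] n \<otimes> k" by (auto simp: mem_set_mult gen)
    obtain a :: nat where a: "\<forall>x\<in>L. K #> cj g x = K #> x [^] a" using act g by blast
    have c: "w \<in> carrier G" "w \<in> L" using sub \<open>w \<in> ?W\<close> Lc by auto
    have "K #> cj g w = K #> w [^] a" using a c by blast
    then have "cj g w \<otimes> inv (w [^] a) \<in> K" using rcoset_eq_iff[OF Ks] g c by simp
    moreover have "w [^] a \<in> ?W" using nat_pow_mem[OF e(1) \<open>w \<in> ?W\<close>] .
    ultimately have "cj g w \<otimes> inv (w [^] a) \<otimes> w [^] a \<in> ?W" using KW subgroup.m_closed[OF e(1)] by blast
    then show "cj g w \<in> ?W" using g c by (simp add: m_assoc)
  qed (rule e(1))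
  moreover have "?W \<noteq> K" using zW[of \<one> 1] z zc subgroup.one_closed[OF Ks] by auto
  ultimately have "?W = L" using LK sub KW unfolding chief_factor_def by blast
  then show ?thesis using e by simp
qed

text \<open>The Sylow subgroups of \<open>B\<close> for primes other than \<open>p\<close> act trivially by assumption, and a Sylow
  \<open>p\<close>-subgroup has a nontrivial fixed point on \<open>L/K\<close>.  So \<open>B\<close> fixes a nontrivial coset.\<close>

lemma chief_trivial_action:
  fixes p :: nat
  assumes p: "Factorial_Ring.prime p" and LK: "chief_factor G L K" and cL: "card L = p ^ l"
    and B: "B \<lhd> G" and triv: "\<And>b x. b \<in> B \<Longrightarrow> coprime (ord b) p \<Longrightarrow> x \<in> L \<Longrightarrow> cmt b x \<in> K"
    and bx: "b \<in> B" "x \<in> L"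
  shows "cmt b x \<in> K"
proof -
  have L: "L \<lhd> G" "K \<lhd> G" "K \<subset> L" using LK by (auto simp: chief_factor_def)
  note Ls = normalD_subgroup[OF L(1)] and Ks = normalD_subgroup[OF L(2)] and Bs = normalD_subgroup[OF B]
  note Lc = normal_carrierD[OF L(1)] and Bc = normal_carrierD[OF B]
  have "card K dvd p ^ l" using card_subgroup_dvd[OF Ks Ls] L cL by auto
  then obtain k where k: "card K = p ^ k" using divides_primepow_nat[OF p] by blast
  have "k < l" using card_psubset_subgroup[OF Ls L(3)] k cL prime_power_less_iff[OF p] by simp
  then have dv: "p * card K dvd card L" using k cL prime_power_dvd_iff[OF p, of "Suc k" l] by simp
  interpret B: fin_group "G\<lparr>carrier := B\<rparr>" by (rule subgroup_fin_group[OF Bs])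
  have subB: "subgroup S G" if "subgroup S (G\<lparr>carrier := B\<rparr>)" for S using incl_subgroup[OF Bs that] .
  obtain S where S: "subgroup S (G\<lparr>carrier := B\<rparr>)" "card S = p ^ multiplicity p (card B)"
    using B.sylow_exists[OF p] by auto
  note S' = subB[OF S(1)]
  have "normalizes S K" "normalizes S L" using normalD_cj L subgroup.mem_carrier[OF S'] by auto
  from fixed_coset[OF p S' S(2) Ks Ls psubset_imp_subset[OF L(3)] this dv]
  obtain z where z: "z \<in> L" "z \<notin> K" "\<forall>s\<in>S. cmt s z \<in> K" by blast
  define Y where "Y = {g \<in> B. cmt g z \<in> K}"
  have Y: "subgroup Y G" unfolding Y_def by (rule fixer_subgroup[OF L(2) Lc[OF z(1)] Bs])
  have "Y = carrier (G\<lparr>carrier := B\<rparr>)"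
  proof (rule B.subgroup_eq_carrierI)
    show "subgroup Y (G\<lparr>carrier := B\<rparr>)" by (rule subgroup_incl[OF Y Bs]) (auto simp: Y_def)
    fix q :: nat assume q: "Factorial_Ring.prime q"
    obtain T where T: "subgroup T (G\<lparr>carrier := B\<rparr>)" "card T = q ^ multiplicity q (card B)"
      using B.sylow_exists[OF q] by auto
    have TB: "T \<subseteq> B" using subgroup.subset[OF T(1)] by simp
    show "\<exists>S. subgroup S (G\<lparr>carrier := B\<rparr>) \<and> S \<subseteq> Y \<and> card S = q ^ multiplicity q (card (carrier (G\<lparr>carrier := B\<rparr>)))"
    proof (cases "q = p")
      case True
      moreover have "S \<subseteq> Y" using z(3) subgroup.subset[OF S(1)] by (auto simp: Y_def)
      ultimately show ?thesis using S by auto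
    next
      case False
      have "t \<in> Y" if t: "t \<in> T" for t
      proof -
        have tc: "t \<in> carrier G" using t TB Bc by blast
        interpret T: group "G\<lparr>carrier := T\<rparr>" by (rule subgroup_imp_group[OF subB[OF T(1)]])
        have "t [^]\<^bsub>G\<lparr>carrier := T\<rparr>\<^esub> order (G\<lparr>carrier := T\<rparr>) = \<one>" using T.pow_order_eq_1 t by simp
        then have "t [^] card T = \<one>" by (simp add: order_def nat_pow_consistent[symmetric])
        then have "ord t dvd q ^ multiplicity q (card B)" using pow_eq_id[OF tc] T(2) by simp
        moreover have "coprime (q ^ multiplicity q (card B)) p"
          using primes_coprime[OF q p False] by simp
        ultimately have "coprime (ord t) p" by (metis coprime_divisors dvd_refl)
        then show ?thesis using triv t TB z(1) by (auto simp: Y_def)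
      qed
      then show ?thesis using T by auto
    qed
  qed
  then have "cmt s z \<in> K" if "s \<in> B" for s using that by (auto simp: Y_def)
  then show ?thesis
    using chief_fixed[OF LK subgroup.subset[OF Bs], of z x b] z bx B normalD_cj by blast
qed

end

context fin_group
begin

lemma finite_subgroupI:
  assumes "H \<subseteq> carrier G" "\<one> \<in> H" "\<And>x y. x \<in> H \<Longrightarrow> y \<in> H \<Longrightarrow> x \<otimes> y \<in> H"
  shows "subgroup H G"
proof (rule subgroupI')
  fix x assume x: "x \<in> H"
  have xc: "x \<in> carrier G" using x assms by blast
  have pw: "x [^] (n::nat) \<in> H" for n by (induction n) (use x assms in auto)
  have "order G \<noteq> 0" using fin order_gt_0_iff_finite by simp
  then have "x [^] (order G - 1) \<otimes> x = \<one>"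
    using pow_order_eq_1[OF xc] by (metis Suc_pred' nat_pow_Suc neq0_conv)
  then have "inv x = x [^] (order G - 1)" using xc by (simp add: inv_equality)
  then show "inv x \<in> H" using pw by simp
qed (use assms in auto)

lemma ord_cj_dvd: "g \<in> carrier G \<Longrightarrow> b \<in> carrier G \<Longrightarrow> ord (cj g b) dvd ord b"
  using pow_eq_id[of "cj g b" "ord b"] by (simp add: cj_pow[symmetric])

lemma factor_comm_group:
  fixes p :: nat
  assumes p: "Factorial_Ring.prime p" and LK: "chief_factor G L K" and cL: "card L = p ^ l"
  shows "comm_group (factor_group G L K)"
proof -
  have L: "L \<lhd> G" "K \<lhd> G" "K \<subset> L" using LK by (auto simp: chief_factor_def)
  have "K \<lhd> G\<lparr>carrier := L\<rparr>" using normal_restrict_supergroup[OF normalD_subgroup[OF L(1)] L(2)] L(3) by blast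
  then interpret V: group "factor_group G L K" by (rule normal.factorgroup_is_group)
  show ?thesis
  proof (rule V.group_comm_groupI)
    fix A B assume "A \<in> carrier (factor_group G L K)" "B \<in> carrier (factor_group G L K)"
    then obtain a b where ab: "a \<in> L" "b \<in> L" "A = K #> a" "B = K #> b" by (auto simp: carrier_FactGroup)
    have "cmt a b \<in> K" by (rule chief_commutator[OF p L(1) cL LK order_refl ab(2,1)])
    then show "A \<otimes>\<^bsub>factor_group G L K\<^esub> B = B \<otimes>\<^bsub>factor_group G L K\<^esub> A"
      using cmt_mem_iff[OF L(2)] ab normal_carrierD[OF L(1)] by simp
  qed
qed

lemma factor_pow:
  assumes "L \<lhd> G" "K \<lhd> G" "K \<subseteq> L" "x \<in> L"
  shows "(K #> x) [^]\<^bsub>factor_group G L K\<^esub> (n::nat) = K #> x [^] n"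
proof -
  have "K \<lhd> G\<lparr>carrier := L\<rparr>" using normal_restrict_supergroup[OF normalD_subgroup[OF assms(1)] assms(2,3)] .
  from normal.FactGroup_pow[OF this, of x n] show ?thesis using assms by (simp add: nat_pow_consistent[symmetric])
qed

text \<open>\<open>L/K\<close> is an abelian group of exponent \<open>p\<close>, and conjugation by
  \<open>g\<close> induces on it an endomorphism whose \<open>(p - 1)\<close>-st iterate is the
  identity; this is the setting of \<open>exists_eigenvector\<close>.\<close>

lemma chief_eigenvector:
  fixes p :: nat
  assumes p: "Factorial_Ring.prime p" and LK: "chief_factor G L K" and cL: "card L = p ^ l"
    and g: "g \<in> carrier G" and triv: "\<And>x. x \<in> L \<Longrightarrow> cmt (g [^] (p - 1)) x \<in> K"
  shows "\<exists>y\<in>L. y \<notin> K \<and> (\<exists>i::nat. K #> cj g y = K #> y [^] i)"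
proof -
  have L: "L \<lhd> G" "K \<lhd> G" "K \<subseteq> L" "K \<subset> L" using LK by (auto simp: chief_factor_def)
  note Ls = normalD_subgroup[OF L(1)] and Ks = normalD_subgroup[OF L(2)]
  note Lc = normal_carrierD[OF L(1)] and Kc = normal_carrierD[OF L(2)]
  interpret V: comm_group "factor_group G L K" by (rule factor_comm_group[OF p LK cL])
  have cV: "carrier (factor_group G L K) = (\<lambda>x. K #> x) ` L" by (simp add: carrier_FactGroup)
  define \<tau> where "\<tau> C = cj g ` C" for C
  have \<tau>: "\<tau> (K #> x) = K #> cj g x" if "x \<in> L" for x
    unfolding \<tau>_def by (rule cj_rcoset[OF Ks g Lc[OF that]]) (use normalD_cj[OF L(2)] g in auto)
  have hom: "\<tau> \<in> hom (factor_group G L K) (factor_group G L K)"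
  proof (rule homI)
    fix A assume "A \<in> carrier (factor_group G L K)"
    then show "\<tau> A \<in> carrier (factor_group G L K)" using \<tau> normalD_cj[OF L(1) g] by (auto simp: cV)
  next
    fix A B assume "A \<in> carrier (factor_group G L K)" "B \<in> carrier (factor_group G L K)"
    then obtain a b where ab: "a \<in> L" "b \<in> L" "A = K #> a" "B = K #> b" by (auto simp: cV)
    have "A <#> B = K #> (a \<otimes> b)" using normal.rcos_sum[OF L(2)] ab Lc by simp
    then have "\<tau> (A <#> B) = K #> (cj g a \<otimes> cj g b)"
      using \<tau>[OF subgroup.m_closed[OF Ls ab(1,2)]] ab g Lc by (simp add: cj_mult)
    also have "\<dots> = \<tau> A <#> \<tau> B" using normal.rcos_sum[OF L(2)] ab g Lc \<tau> by simp
    finally show "\<tau> (A \<otimes>\<^bsub>factor_group G L K\<^esub> B) = \<tau> A \<otimes>\<^bsub>factor_group G L K\<^esub> \<tau> B" by simp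
  qed
  obtain z where z: "z \<in> L" "z \<notin> K" using L by blast
  have it: "(\<tau> ^^ n) (K #> z) = K #> cj (g [^] n) z" for n
  proof (induction n)
    case (Suc n)
    have "(\<tau> ^^ Suc n) (K #> z) = K #> cj g (cj (g [^] n) z)"
      using Suc \<tau> normalD_cj[OF L(1) _ z(1)] g by simp
    also have "cj g (cj (g [^] n) z) = cj (g [^] Suc n) z"
      using g z Lc by (simp add: cj_cj nat_pow_Suc2[symmetric] del: nat_pow_Suc)
    finally show ?case .
  qed (use z Lc in simp)
  have per: "(\<tau> ^^ (p - 1)) (K #> z) = K #> z"
    using it[of "p - 1"] cmt_mem_iff_rcoset[OF L(2)] triv[OF z(1)] g z Lc by simp
  have e1: "A [^]\<^bsub>factor_group G L K\<^esub> p = \<one>\<^bsub>factor_group G L K\<^esub>" if A: "A \<in> carrier (factor_group G L K)" for A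
  proof -
    obtain a where a: "a \<in> L" "A = K #> a" using A by (auto simp: cV)
    have "a [^] p \<in> K" by (rule chief_power[OF p L(1) cL LK order_refl a(1)])
    then show ?thesis using factor_pow[OF L(1-3) a(1)] a rcoset_eq_self_iff[OF Ks] Lc by simp
  qed
  have zV: "K #> z \<in> carrier (factor_group G L K)" using z by (auto simp: cV)
  have z1: "K #> z \<noteq> \<one>\<^bsub>factor_group G L K\<^esub>" using z rcoset_eq_self_iff[OF Ks] Lc by simp
  obtain E i where E: "E \<in> carrier (factor_group G L K)" "E \<noteq> \<one>\<^bsub>factor_group G L K\<^esub>"
    "\<tau> E = E [^]\<^bsub>factor_group G L K\<^esub> (i::nat)"
    using V.exists_eigenvector[OF p e1 hom zV z1 per] by blast
  obtain y where y: "y \<in> L" "E = K #> y" using E(1) by (auto simp: cV)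
  have "y \<notin> K" using E(2) y rcoset_eq_self_iff[OF Ks] Lc by simp
  moreover have "K #> cj g y = K #> y [^] i" using E(3) y \<tau> factor_pow[OF L(1-3) y(1)] by simp
  ultimately show ?thesis using y(1) by blast
qed

text \<open>\<open>Q\<close> consists of the \<open>p'\<close>-elements of the subgroup
  \<open>B\<close> from \<open>p_series_centralizer\<close>. It is a conjugation-invariant set
  rather than a subgroup; that is all the later fixed-point arguments ask for.\<close>

lemma exists_centralizing_set:
  fixes p :: nat
  assumes p: "Factorial_Ring.prime p" and M: "p_series G p N M" "card M = p ^ m"
    and LK: "chief_factor G L K" and cL: "card L = p ^ l" and ne: "card L \<noteq> p * card K"
  shows "\<exists>Q\<subseteq>carrier G. normalizes (carrier G) Q \<and> (\<forall>q\<in>Q. \<forall>x\<in>M. cmt q x \<in> N) \<and> (\<exists>q\<in>Q. \<exists>x\<in>L. cmt q x \<notin> K)"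
proof -
  have L: "L \<lhd> G" "K \<lhd> G" "K \<subseteq> L" using LK by (auto simp: chief_factor_def)
  note Ls = normalD_subgroup[OF L(1)] and Ks = normalD_subgroup[OF L(2)]
  note Lc = normal_carrierD[OF L(1)] and Kc = normal_carrierD[OF L(2)]
  obtain B where B: "B \<lhd> G" "\<And>g h. g \<in> carrier G \<Longrightarrow> h \<in> carrier G \<Longrightarrow> cmt g h \<in> B"
    "\<And>g. g \<in> carrier G \<Longrightarrow> g [^] (p - 1) \<in> B"
    "\<And>b x. b \<in> B \<Longrightarrow> coprime (ord b) p \<Longrightarrow> x \<in> M \<Longrightarrow> cmt b x \<in> N"
    using p_series_centralizer[OF p M] by blast
  define Q where "Q = {b \<in> B. coprime (ord b) p}"
  have Q: "Q \<subseteq> carrier G" using normal_carrierD[OF B(1)] by (auto simp: Q_def)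
  have "cj g b \<in> Q" if "g \<in> carrier G" "b \<in> Q" for g b
    using that normalD_cj[OF B(1)] ord_cj_dvd[of g b] Q coprime_divisors[of "ord (cj g b)" "ord b" p p]
    by (auto simp: Q_def)
  then have nQ: "normalizes (carrier G) Q" by blast
  have "\<exists>q\<in>Q. \<exists>x\<in>L. cmt q x \<notin> K"
  proof (rule ccontr)
    assume "\<not> (\<exists>q\<in>Q. \<exists>x\<in>L. cmt q x \<notin> K)"
    then have triv: "cmt b x \<in> K" if "b \<in> B" "x \<in> L" for b x
      using chief_trivial_action[OF p LK cL B(1) _ that] by (auto simp: Q_def)
    have "card L = p * card K"
    proof (rule chief_card_prime[OF p LK cL])
      fix g assume g: "g \<in> carrier G"
      obtain y i where y: "y \<in> L" "y \<notin> K" "K #> cj g y = K #> y [^] (i::nat)"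
        using chief_eigenvector[OF p LK cL g] triv B(3)[OF g] by blast
      \<comment> \<open>The eigenspace of \<open>g\<close> for the exponent \<open>i\<close>. It is
        invariant under every \<open>h\<close> because \<open>cmt g h\<close> lies in
        \<open>B\<close> and so acts trivially: the actions of \<open>g\<close> and \<open>h\<close>
        on \<open>L/K\<close> commute.\<close>
      define F where "F = {x \<in> L. K #> cj g x = K #> x [^] i}"
      have "F \<lhd> G" unfolding normal_iff_cj
      proof (intro conjI ballI)
        show "subgroup F G"
        proof (rule finite_subgroupI)
          show "F \<subseteq> carrier G" using Lc by (auto simp: F_def)
          show "\<one> \<in> F" using g by (simp add: F_def subgroup.one_closed[OF Ls])
          fix a b assume "a \<in> F" "b \<in> F"
          then have ab: "a \<in> L" "b \<in> L" "K #> cj g a = K #> a [^] i" "K #> cj g b = K #> b [^] i" by (auto simp: F_def)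
          note c = Lc[OF ab(1)] Lc[OF ab(2)]
          have "K #> cj g (a \<otimes> b) = K #> (a [^] i \<otimes> b [^] i)"
            using rcoset_cong_mult[OF L(2) _ _ _ _ ab(3,4)] g c by (simp add: cj_mult)
          also have "\<dots> = K #> (a \<otimes> b) [^] i"
            using pow_mult_mod[OF L(2) c] chief_commutator[OF p L(1) cL LK order_refl ab(2,1)] by simp
          finally show "a \<otimes> b \<in> F" using subgroup.m_closed[OF Ls ab(1,2)] by (simp add: F_def)
        qed
        fix h x assume h: "h \<in> carrier G" and "x \<in> F"
        then have x: "x \<in> L" "K #> cj g x = K #> x [^] i" by (auto simp: F_def)
        note c = Lc[OF x(1)]
        have gh: "cmt g h \<otimes> (h \<otimes> g) = g \<otimes> h"
          using g h by (simp add: conjugate_def m_assoc) (simp add: m_assoc[symmetric])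
        have "cj g (cj h x) = cj (cmt g h) (cj (h \<otimes> g) x)" using g h c gh by (simp add: cj_cj)
        then have "K #> cj g (cj h x) = K #> cj (h \<otimes> g) x"
          using triv[OF B(2)[OF g h] normalD_cj[OF L(1) _ x(1), of "h \<otimes> g"]] cmt_mem_iff_rcoset[OF L(2)] g h c by simp
        also have "\<dots> = K #> cj h (cj g x)" using g h c by (simp add: cj_cj)
        also have "\<dots> = K #> cj h (x [^] i)"
          by (rule rcoset_cong_cj[OF L(2) h]) (use g c x in auto)
        also have "\<dots> = K #> (cj h x) [^] i" using h c by (simp add: cj_pow)
        finally show "cj h x \<in> F" using normalD_cj[OF L(1) h x(1)] by (simp add: F_def)
      qed
      moreover have "K \<subseteq> F"
      proof
        fix x assume x: "x \<in> K"
        then have "cj g x \<in> K" "x [^] i \<in> K" using normalD_cj[OF L(2) g] nat_pow_mem[OF Ks] by auto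
        then have "K #> cj g x = K" "K #> x [^] i = K" using rcoset_eq_self_iff[OF Ks] Kc by auto
        then show "x \<in> F" using x L by (auto simp: F_def)
      qed
      moreover have "F \<subseteq> L" "F \<noteq> K" using y by (auto simp: F_def)
      ultimately have "F = L" using LK unfolding chief_factor_def by blast
      then show "\<exists>a::nat. \<forall>x\<in>L. K #> cj g x = K #> x [^] a" by (auto simp: F_def)
    qed
    then show False using ne by simp
  qed
  moreover have "\<forall>q\<in>Q. \<forall>x\<in>M. cmt q x \<in> N" using B(4) by (auto simp: Q_def)
  ultimately show ?thesis using Q nQ by blast
qed

end

section \<open>Quaternion sections\<close>

context fin_group
begin

text \<open>The collection formula in class 2. Moving the \<open>(k + 1)\<close>-st \<open>x\<close>
  to the left across \<open>y [^] k\<close> costs \<open>k\<close> commutators, in total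
  \<open>0 + 1 + ... + (n - 1) = n choose 2\<close>.\<close>

lemma class2_pow:
  assumes c: "x \<in> carrier G" "y \<in> carrier G"
    and z: "cmt y x \<otimes> x = x \<otimes> cmt y x" "cmt y x \<otimes> y = y \<otimes> cmt y x"
  shows "y [^] (n::nat) \<otimes> x = cmt y x [^] n \<otimes> (x \<otimes> y [^] n)"
    and "(x \<otimes> y) [^] n = x [^] n \<otimes> (y [^] n \<otimes> cmt y x [^] (n choose 2))"
proof -
  define k where "k = cmt y x"
  have kc: "k \<in> carrier G" using c by (simp add: k_def)
  have yx: "y \<otimes> x = k \<otimes> (x \<otimes> y)" using c by (simp add: k_def conjugate_def m_assoc)
      (simp add: m_assoc[symmetric])
  have kp: "k [^] (m::nat) \<otimes> x = x \<otimes> k [^] m" "k [^] (m::nat) \<otimes> y = y \<otimes> k [^] m" for m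
    using z c kc by (simp_all add: k_def[symmetric] group_commutes_pow)
  have A: "y [^] (n::nat) \<otimes> x = k [^] n \<otimes> (x \<otimes> y [^] n)" for n
  proof (induction n)
    case (Suc n)
    have "y [^] Suc n \<otimes> x = y [^] n \<otimes> (k \<otimes> (x \<otimes> y))" using c yx by (simp add: m_assoc)
    also have "\<dots> = k \<otimes> (y [^] n \<otimes> x) \<otimes> y"
    proof -
      have "y [^] n \<otimes> k = k \<otimes> y [^] n" using z(2) c kc by (simp add: k_def[symmetric] group_commutes_pow)
      then show ?thesis using c kc by (simp add: m_assoc[symmetric])
    qed
    also have "\<dots> = k \<otimes> (k [^] n \<otimes> (x \<otimes> y [^] n)) \<otimes> y" using Suc by simp
    also have "\<dots> = k [^] Suc n \<otimes> (x \<otimes> y [^] Suc n)"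
      using c kc by (simp add: m_assoc nat_pow_Suc2 del: nat_pow_Suc) (simp add: m_assoc[symmetric] nat_pow_Suc2[symmetric])
    finally show ?case .
  qed (use c kc in simp)
  show "y [^] (n::nat) \<otimes> x = cmt y x [^] n \<otimes> (x \<otimes> y [^] n)" using A by (simp add: k_def)
  have "(x \<otimes> y) [^] n = x [^] n \<otimes> (y [^] n \<otimes> k [^] (n choose 2))"
  proof (induction n)
    case (Suc n)
    have ch: "Suc n choose 2 = n + (n choose 2)" by (simp add: numeral_2_eq_2)
    have kn: "k [^] (n choose 2) \<otimes> x = x \<otimes> k [^] (n choose 2)" "k [^] (n choose 2) \<otimes> y = y \<otimes> k [^] (n choose 2)"
      using kp by auto
    have kx: "k [^] n \<otimes> x = x \<otimes> k [^] n" by (rule kp)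
    have kyn: "k [^] n \<otimes> y [^] n = y [^] n \<otimes> k [^] n" "k [^] n \<otimes> y = y \<otimes> k [^] n"
      using kp(2) c kc by (simp_all add: group_commutes_pow)
    have "(x \<otimes> y) [^] Suc n = x [^] n \<otimes> (y [^] n \<otimes> (k [^] (n choose 2) \<otimes> x)) \<otimes> y"
      using Suc c kc by (simp add: m_assoc)
    also have "\<dots> = x [^] n \<otimes> ((y [^] n \<otimes> x) \<otimes> (k [^] (n choose 2) \<otimes> y))"
      using c kc by (simp only: kn(1)) (simp add: m_assoc)
    also have "\<dots> = x [^] n \<otimes> (((k [^] n \<otimes> x) \<otimes> y [^] n) \<otimes> (y \<otimes> k [^] (n choose 2)))"
      using c kc A by (simp only: kn(2)) (simp add: m_assoc)
    also have "\<dots> = x [^] n \<otimes> (x \<otimes> ((k [^] n \<otimes> y [^] n) \<otimes> (y \<otimes> k [^] (n choose 2))))"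
      using c kc by (simp only: kx) (simp add: m_assoc)
    also have "\<dots> = x [^] n \<otimes> (x \<otimes> (y [^] n \<otimes> ((k [^] n \<otimes> y) \<otimes> k [^] (n choose 2))))"
      using c kc by (simp only: kyn(1)) (simp add: m_assoc)
    also have "\<dots> = x [^] n \<otimes> (x \<otimes> (y [^] n \<otimes> (y \<otimes> (k [^] n \<otimes> k [^] (n choose 2)))))"
      using c kc by (simp only: kyn(2)) (simp add: m_assoc)
    also have "\<dots> = x [^] Suc n \<otimes> (y [^] Suc n \<otimes> k [^] (Suc n choose 2))"
      using c kc by (simp add: ch nat_pow_mult[symmetric] m_assoc)
    finally show ?case .
  qed (use c in \<open>simp add: numeral_2_eq_2\<close>)
  then show "(x \<otimes> y) [^] n = x [^] n \<otimes> (y [^] n \<otimes> cmt y x [^] (n choose 2))" by (simp add: k_def)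
qed

end

section \<open>The quaternion group by generators and relations\<close>

lemma quaternion_carrier_iff: "q \<in> carrier quaternion_group \<longleftrightarrow>
    q = (1, 0, 0, 0) \<or> q = (-1, 0, 0, 0) \<or> q = (0, 1, 0, 0) \<or> q = (0, -1, 0, 0) \<or>
    q = (0, 0, 1, 0) \<or> q = (0, 0, -1, 0) \<or> q = (0, 0, 0, 1) \<or> q = (0, 0, 0, -1)"
  by (simp add: quaternion_group_def)

lemma quaternion_mult: "(a, b, c, d) \<otimes>\<^bsub>quaternion_group\<^esub> (a', b', c', d') =
    (a * a' - b * b' - c * c' - d * d', a * b' + b * a' + c * d' - d * c',
     a * c' - b * d' + c * a' + d * b', a * d' + b * c' - c * b' + d * a')"
  by (simp add: quaternion_group_def)

context group
begin

text \<open>\<open>x\<close>, \<open>y\<close> and \<open>z\<close> play the parts of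
  \<open>i\<close>, \<open>j\<close> and \<open>-1\<close>. The last branch serves \<open>-k\<close>
  and, as a default, all tuples outside the quaternion group.\<close>

definition quat_map :: "'a \<Rightarrow> 'a \<Rightarrow> 'a \<Rightarrow> int \<times> int \<times> int \<times> int \<Rightarrow> 'a" where
  "quat_map z x y q =
    (if q = (1, 0, 0, 0) then \<one> else if q = (-1, 0, 0, 0) then z
     else if q = (0, 1, 0, 0) then x else if q = (0, -1, 0, 0) then z \<otimes> x
     else if q = (0, 0, 1, 0) then y else if q = (0, 0, -1, 0) then z \<otimes> y
     else if q = (0, 0, 0, 1) then x \<otimes> y else z \<otimes> (x \<otimes> y))"

text \<open>The relations rewrite every product to one of eight normal forms, and
  \<open>z \<noteq> \<one>\<close> keeps these apart. Closure is part of the conclusion because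
  \<open>quaternion_group\<close> is used as a bare multiplication table, without a proof of the
  group axioms.\<close>

lemma quat_map_hom:
  assumes c: "x \<in> carrier G" "y \<in> carrier G" "z \<in> carrier G"
    and xx: "x \<otimes> x = z" and yy: "y \<otimes> y = z" and zz: "z \<otimes> z = \<one>" and yx: "y \<otimes> x = z \<otimes> (x \<otimes> y)"
    and xz: "x \<otimes> z = z \<otimes> x" and yz: "y \<otimes> z = z \<otimes> y" and z1: "z \<noteq> \<one>"
  shows "quat_map z x y \<in> hom quaternion_group G" "inj_on (quat_map z x y) (carrier quaternion_group)"
    "\<And>q r. q \<in> carrier quaternion_group \<Longrightarrow> r \<in> carrier quaternion_group \<Longrightarrow>
      q \<otimes>\<^bsub>quaternion_group\<^esub> r \<in> carrier quaternion_group"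
proof -
  \<comment> \<open>Each relation is repeated with a further factor \<open>w\<close>, so that it
    also applies inside products bracketed to the right.\<close>
  have ext: "x \<otimes> (x \<otimes> w) = z \<otimes> w" "y \<otimes> (y \<otimes> w) = z \<otimes> w" "z \<otimes> (z \<otimes> w) = w"
    "y \<otimes> (x \<otimes> w) = z \<otimes> (x \<otimes> (y \<otimes> w))" "x \<otimes> (z \<otimes> w) = z \<otimes> (x \<otimes> w)" "y \<otimes> (z \<otimes> w) = z \<otimes> (y \<otimes> w)"
    if "w \<in> carrier G" for w
    using that c xx yy zz yx xz yz by (simp_all add: m_assoc[symmetric])
  note rules = xx yy zz yx xz yz ext c m_assoc
  have hom: "quat_map z x y (q \<otimes>\<^bsub>quaternion_group\<^esub> r) = quat_map z x y q \<otimes> quat_map z x y r"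
    if "q \<in> carrier quaternion_group" "r \<in> carrier quaternion_group" for q r
    using that unfolding quaternion_carrier_iff
    by (elim disjE; simp add: quaternion_mult quat_map_def rules)
  show "quat_map z x y \<in> hom quaternion_group G"
    by (rule homI) (use hom c in \<open>auto simp: quat_map_def\<close>)
  show cl: "q \<otimes>\<^bsub>quaternion_group\<^esub> r \<in> carrier quaternion_group"
    if "q \<in> carrier quaternion_group" "r \<in> carrier quaternion_group" for q r
    using that unfolding quaternion_carrier_iff by (elim disjE; simp add: quaternion_mult)
  have can: "a = b \<longleftrightarrow> inv a \<otimes> b = \<one>" if "a \<in> carrier G" "b \<in> carrier G" for a b
    using that by (metis inv_closed inv_comm inv_equality inv_inv r_inv)
  have ne: "x \<noteq> \<one>" "y \<noteq> \<one>" "x \<noteq> z" "y \<noteq> z" using xx yy zz z1 c by auto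
  have xy1: "x \<noteq> y"
  proof
    assume "x = y"
    then have "z = z \<otimes> z" using yx xx by simp
    then show False using zz z1 by simp
  qed
  have xy2: "x \<noteq> z \<otimes> y"
  proof
    assume e: "x = z \<otimes> y"
    have "x \<otimes> y = z \<otimes> (y \<otimes> y)" using e c by (simp add: m_assoc)
    then have "x \<otimes> y = \<one>" using yy zz by simp
    moreover have "y \<otimes> x = \<one>" using e c yz yy zz by (simp add: m_assoc[symmetric]) (simp add: m_assoc)
    ultimately show False using yx z1 c by simp
  qed
  have y_zx: "y \<noteq> z \<otimes> x" using xy2 c zz by (metis ext(3))
  have zx_zy: "z \<otimes> x \<noteq> z \<otimes> y" using xy1 c by simp
  have xy_1: "x \<otimes> y \<noteq> \<one>" using xy2 c xx yy zz ext by (metis r_one)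
  have xy_z: "x \<otimes> y \<noteq> z" using xy1 c xx by (metis l_cancel)
  have xy_x: "x \<otimes> y \<noteq> x" using ne c by simp
  have xy_y: "x \<otimes> y \<noteq> y" using ne c by simp
  have xy_zx: "x \<otimes> y \<noteq> z \<otimes> x" using ne c xz by (metis l_cancel)
  have xy_zy: "x \<otimes> y \<noteq> z \<otimes> y" using ne c by (metis r_cancel)
  have zl: "z \<otimes> a = b \<longleftrightarrow> a = z \<otimes> b" if "a \<in> carrier G" "b \<in> carrier G" for a b
    using that ext(3) by metis
  have n1: "z \<otimes> x \<noteq> \<one>" "z \<otimes> y \<noteq> \<one>" "z \<otimes> x \<noteq> z" "z \<otimes> y \<noteq> z" "z \<otimes> x \<noteq> x" "z \<otimes> y \<noteq> y"
    using ne z1 c zl[of x \<one>] zl[of y \<one>] by auto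
  have n2: "z \<otimes> (x \<otimes> y) \<noteq> \<one>" "z \<otimes> (x \<otimes> y) \<noteq> z" "z \<otimes> (x \<otimes> y) \<noteq> x" "z \<otimes> (x \<otimes> y) \<noteq> y"
    "z \<otimes> (x \<otimes> y) \<noteq> z \<otimes> x" "z \<otimes> (x \<otimes> y) \<noteq> z \<otimes> y" "z \<otimes> (x \<otimes> y) \<noteq> x \<otimes> y"
    using c z1 zl[of "x \<otimes> y" \<one>] zl[of "x \<otimes> y" x] zl[of "x \<otimes> y" y] xy_1 xy_z xy_x xy_y xy_zx xy_zy by auto
  note nes = ne xy1 xy2 y_zx zx_zy xy_1 xy_z xy_x xy_y xy_zx xy_zy n1 n2 z1
  note nes' = nes nes[symmetric]
  show "inj_on (quat_map z x y) (carrier quaternion_group)"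
  proof (rule inj_onI)
    fix q r assume "q \<in> carrier quaternion_group" "r \<in> carrier quaternion_group" "quat_map z x y q = quat_map z x y r"
    then show "q = r" unfolding quaternion_carrier_iff
      by (elim disjE; simp add: quat_map_def nes')
  qed
qed

end

context fin_group
begin

lemma not_quaternion_freeI:
  assumes M: "M \<lhd> G" and c: "x \<in> carrier G" "y \<in> carrier G"
    and z: "z \<in> carrier G" "z \<notin> M" "z \<otimes> z \<in> M" "cmt x z \<in> M" "cmt y z \<in> M"
    and xx: "M #> (x \<otimes> x) = M #> z" and yy: "M #> (y \<otimes> y) = M #> z" and yx: "M #> cmt y x = M #> z"
  shows "\<not> quaternion_free 2 G"
proof -
  note Ms = normalD_subgroup[OF M]
  interpret Q: fin_group "G Mod M" by (rule Mod_fin_group[OF M])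
  have sum: "(M #> a) <#> (M #> b) = M #> (a \<otimes> b)" if "a \<in> carrier G" "b \<in> carrier G" for a b
    using normal.rcos_sum[OF M] that by simp
  define h where "h = Q.quat_map (M #> z) (M #> x) (M #> y)"
  have car: "M #> a \<in> carrier (G Mod M)" if "a \<in> carrier G" for a using that by (auto simp: carrier_FactGroup)
  have yxe: "y \<otimes> x = cmt y x \<otimes> (x \<otimes> y)" using c by (simp add: conjugate_def m_assoc) (simp add: m_assoc[symmetric])
  have "M #> (y \<otimes> x) = M #> (z \<otimes> (x \<otimes> y))"
    unfolding yxe by (rule rcoset_cong_mult[OF M]) (use c z yx in auto)
  then have "(M #> y) \<otimes>\<^bsub>G Mod M\<^esub> (M #> x) = (M #> z) \<otimes>\<^bsub>G Mod M\<^esub> ((M #> x) \<otimes>\<^bsub>G Mod M\<^esub> (M #> y))"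
    using sum c z by simp
  moreover have "(M #> x) \<otimes>\<^bsub>G Mod M\<^esub> (M #> x) = M #> z" "(M #> y) \<otimes>\<^bsub>G Mod M\<^esub> (M #> y) = M #> z"
    using sum c xx yy by simp_all
  moreover have "(M #> z) \<otimes>\<^bsub>G Mod M\<^esub> (M #> z) = \<one>\<^bsub>G Mod M\<^esub>" using sum z rcoset_eq_self_iff[OF Ms] by simp
  moreover have "(M #> x) \<otimes>\<^bsub>G Mod M\<^esub> (M #> z) = (M #> z) \<otimes>\<^bsub>G Mod M\<^esub> (M #> x)"
    "(M #> y) \<otimes>\<^bsub>G Mod M\<^esub> (M #> z) = (M #> z) \<otimes>\<^bsub>G Mod M\<^esub> (M #> y)"
    using cmt_mem_iff[OF M] c z by auto
  moreover have "M #> z \<noteq> \<one>\<^bsub>G Mod M\<^esub>" using rcoset_eq_self_iff[OF Ms] z by simp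
  ultimately have h: "h \<in> hom quaternion_group (G Mod M)" "inj_on h (carrier quaternion_group)"
    "\<And>q r. q \<in> carrier quaternion_group \<Longrightarrow> r \<in> carrier quaternion_group \<Longrightarrow>
      q \<otimes>\<^bsub>quaternion_group\<^esub> r \<in> carrier quaternion_group"
    using Q.quat_map_hom[OF car[OF c(1)] car[OF c(2)] car[OF z(1)]] unfolding h_def by blast+
  let ?A = "h ` carrier quaternion_group"
  have one: "(1, 0, 0, 0) \<in> carrier quaternion_group" "h (1, 0, 0, 0) = M"
    by (auto simp: quaternion_group_def h_def Q.quat_map_def)
  have A: "subgroup ?A (G Mod M)"
  proof (rule Q.finite_subgroupI)
    show "?A \<subseteq> carrier (G Mod M)" using h(1) by (auto simp: hom_def)
    show "\<one>\<^bsub>G Mod M\<^esub> \<in> ?A" using one by (metis image_eqI one_FactGroup)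
    fix a b assume "a \<in> ?A" "b \<in> ?A"
    then show "a \<otimes>\<^bsub>G Mod M\<^esub> b \<in> ?A" using h(3) hom_mult[OF h(1)] by (metis (no_types, lifting) image_iff)
  qed
  have UA: "subgroup (\<Union>?A) G" by (rule normal.factgroup_subgroup_union_subgroup[OF M A])
  have carA: "carrier (factor_group G (\<Union>?A) M) = ?A"
    using normal.factgroup_subgroup_union_factor[OF M A] by (simp add: FactGroup_def)
  have "M \<in> ?A" using one by (metis image_eqI)
  then have "M \<lhd> G\<lparr>carrier := \<Union>?A\<rparr>" by (intro normal_restrict_supergroup[OF UA M]) blast
  \<comment> \<open>In the definition of quaternion-free the isomorphism starts at the section, so
    it is the inverse of the embedding \<open>h\<close>.\<close>
  moreover have "the_inv_into (carrier quaternion_group) h \<in> iso (factor_group G (\<Union>?A) M) quaternion_group"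
  proof -
    let ?k = "the_inv_into (carrier quaternion_group) h"
    have bij: "bij_betw ?k ?A (carrier quaternion_group)"
      using h(2) bij_betw_the_inv_into by (metis bij_betw_imageI)
    moreover have "?k \<in> hom (factor_group G (\<Union>?A) M) quaternion_group"
    proof (rule homI)
      fix a assume "a \<in> carrier (factor_group G (\<Union>?A) M)"
      then show "?k a \<in> carrier quaternion_group" using bij_betwE[OF bij] unfolding carA by blast
    next
      fix a b assume "a \<in> carrier (factor_group G (\<Union>?A) M)" "b \<in> carrier (factor_group G (\<Union>?A) M)"
      then obtain q r where qr: "q \<in> carrier quaternion_group" "r \<in> carrier quaternion_group" "a = h q" "b = h r"
        unfolding carA by blast
      have "a <#> b = h (q \<otimes>\<^bsub>quaternion_group\<^esub> r)" using hom_mult[OF h(1) qr(1,2)] qr by simp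
      then have "?k (a <#> b) = q \<otimes>\<^bsub>quaternion_group\<^esub> r"
        using the_inv_into_f_f[OF h(2)] h(3)[OF qr(1,2)] by simp
      then show "?k (a \<otimes>\<^bsub>factor_group G (\<Union>?A) M\<^esub> b) = ?k a \<otimes>\<^bsub>quaternion_group\<^esub> ?k b"
        using the_inv_into_f_f[OF h(2)] qr by simp
    qed
    ultimately show ?thesis by (simp add: iso_def carA)
  qed
  ultimately show ?thesis using UA unfolding quaternion_free_def is_iso_def by blast
qed

end

section \<open>The structure of a minimal counterexample\<close>

context group
begin

lemma pow_two: "x \<in> carrier G \<Longrightarrow> x [^] (2::nat) = x \<otimes> x"
  by (simp add: numeral_2_eq_2)

lemma cmt_mult_right:
  assumes "x \<in> carrier G" "y \<in> carrier G" "z \<in> carrier G"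
  shows "cmt x (y \<otimes> z) = cmt x y \<otimes> cj y (cmt x z)"
  using assms by (simp add: cj_mult inv_mult_group conjugate_def[of G y] m_assoc)
    (simp add: m_assoc[symmetric])

lemma cmt_mult_left:
  assumes "x \<in> carrier G" "y \<in> carrier G" "z \<in> carrier G"
  shows "cmt (x \<otimes> y) z = cj x (cmt y z) \<otimes> cmt x z"
  using assms by (simp add: cj_mult cj_inv m_assoc cj_cj)
    (simp add: m_assoc[symmetric])

lemma cj_cmt:
  assumes "g \<in> carrier G" "x \<in> carrier G" "y \<in> carrier G"
  shows "cj g (cmt x y) = cmt (cj g x) (cj g y)"
proof -
  have "cj (cj g x) (cj g y) = cj g (cj x y)"
    using assms by (simp add: cj_cj cj_mult_left)
  then show ?thesis using assms by (simp add: cj_mult cj_inv)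
qed

lemma cmt_eq_one_iff:
  assumes "x \<in> carrier G" "y \<in> carrier G"
  shows "cmt x y = \<one> \<longleftrightarrow> x \<otimes> y = y \<otimes> x" "cmt x y = \<one> \<longleftrightarrow> cj x y = y"
proof -
  show "cmt x y = \<one> \<longleftrightarrow> cj x y = y"
    using assms by (metis cj_closed inv_solve_right' l_one one_closed)
  then show "cmt x y = \<one> \<longleftrightarrow> x \<otimes> y = y \<otimes> x"
    using assms by (metis cj_closed cj_mult_left r_cancel)
qed

lemma inv_cmt: "x \<in> carrier G \<Longrightarrow> y \<in> carrier G \<Longrightarrow> inv (cmt x y) = cmt y x"
  by (simp add: conjugate_def inv_mult_group m_assoc)

end

text \<open>What minimality provides for \<open>|D| = 1\<close>, with the induction hypothesis
  stripped off. \<open>Q\<close> comes from \<open>exists_centralizing_set\<close> for the series of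
  \<open>M\<close>.\<close>

locale irreducible_top = fin_group +
  fixes p m :: nat and P M Q :: "'a set"
  assumes p: "Factorial_Ring.prime p"
    and Pn: "P \<lhd> G" and cP: "card P = p ^ m"
    and ch: "chief_factor G P M"
    and maxM: "\<And>Y. Y \<lhd> G \<Longrightarrow> Y \<subset> P \<Longrightarrow> Y \<subseteq> M"
    and Q: "Q \<subseteq> carrier G" "normalizes (carrier G) Q"
    and QM: "\<And>q x. q \<in> Q \<Longrightarrow> x \<in> M \<Longrightarrow> cmt q x = \<one>"
    and Qne: "\<exists>q\<in>Q. \<exists>x\<in>P. cmt q x \<notin> M"
begin

lemma Mn: "M \<lhd> G" and MP: "M \<subseteq> P"
  using ch by (auto simp: chief_factor_def)

lemmas Ps = normalD_subgroup[OF Pn] and Ms = normalD_subgroup[OF Mn]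
lemmas Pc = normal_carrierD[OF Pn] and Mc = normal_carrierD[OF Mn]

lemma Qc: "q \<in> Q \<Longrightarrow> q \<in> carrier G"
  using Q by blast

lemma cjQM: "q \<in> Q \<Longrightarrow> x \<in> M \<Longrightarrow> cj q x = x"
  using QM cmt_eq_one_iff(2) Qc Mc by blast

lemma cmtQ_in: "q \<in> Q \<Longrightarrow> x \<in> P \<Longrightarrow> cmt q x \<in> P"
  using normalD_cj[OF Pn] Qc by (simp add: subgroup.m_closed[OF Ps] subgroup.m_inv_closed[OF Ps])

text \<open>\<open>Q\<close> moves some coset modulo \<open>M\<close>, so a subgroup containing all
  \<open>cmt q x\<close> is not inside \<open>M\<close>. The structure of \<open>P\<close> is
  obtained by applying this to centralizers, kernels of power maps and the like.\<close>

lemma eq_top: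
  assumes "Y \<lhd> G" "Y \<subseteq> P" "\<And>q x. q \<in> Q \<Longrightarrow> x \<in> P \<Longrightarrow> cmt q x \<in> Y"
  shows "Y = P"
proof (rule ccontr)
  assume "Y \<noteq> P"
  then have "Y \<subseteq> M" using maxM assms by blast
  then show False using assms(3) Qne by blast
qed

lemma cmt_in_M: "x \<in> P \<Longrightarrow> y \<in> P \<Longrightarrow> cmt x y \<in> M"
  by (rule chief_commutator[OF p Pn cP ch order_refl])

text \<open>A three subgroups argument: \<open>Q\<close> centralizes \<open>M\<close>, and
  \<open>P\<close> maps \<open>M\<close> to itself, so every \<open>cmt q x\<close> centralizes
  \<open>M\<close>. Now \<open>eq_top\<close> applies to the centralizer of \<open>M\<close> in
  \<open>P\<close>.\<close>

lemma M_central: "x \<in> P \<Longrightarrow> u \<in> M \<Longrightarrow> cmt u x = \<one>"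
proof -
  define Y where "Y = {x \<in> P. \<forall>u\<in>M. cmt u x \<in> {\<one>}}"
  have "Y \<lhd> G" unfolding Y_def
    by (rule normal_fixed_mod[OF one_is_normal Pn])
      (use subgroup.one_closed[OF Ps] Mc normalD_cj[OF Mn] in auto)
  moreover have "Y \<subseteq> P" by (auto simp: Y_def)
  moreover have "cmt q x \<in> Y" if q: "q \<in> Q" and x: "x \<in> P" for q x
  proof -
    have c: "q \<in> carrier G" "x \<in> carrier G" using q x Qc Pc by auto
    have "cmt u (cmt q x) = \<one>" if u: "u \<in> M" for u
    proof -
      have uc: "u \<in> carrier G" using u Mc by blast
      define v where "v = cj (inv x) u"
      have v: "v \<in> M" "v \<in> carrier G" using u c normalD_cj[OF Mn] Mc by (auto simp: v_def)
      have "cj (inv q) v = v" using cjQM[OF q v(1)] c v by (metis cj_inv_cancel(2))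
      then have "cj q (cj x (cj (inv q) v)) = u"
        using c uc cjQM[OF q u] by (simp add: v_def)
      moreover have "cj q (cj x (cj (inv q) v)) = cj (cmt q x) u"
        using c uc by (simp add: v_def cj_cj conjugate_def[of G q x] m_assoc)
      ultimately have "cj (cmt q x) u = u" by simp
      then have "cmt (cmt q x) u = \<one>" using cmt_eq_one_iff(2)[of "cmt q x" u] c uc by simp
      then show ?thesis using cmt_eq_one_iff(1) c uc by (metis cmt_closed)
    qed
    then show ?thesis using cmtQ_in[OF q x] by (simp add: Y_def)
  qed
  ultimately have "Y = P" by (rule eq_top)
  then show "x \<in> P \<Longrightarrow> u \<in> M \<Longrightarrow> cmt u x = \<one>" by (auto simp: Y_def)
qed

lemma M_comm: "x \<in> P \<Longrightarrow> u \<in> M \<Longrightarrow> u \<otimes> x = x \<otimes> u"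
  using M_central cmt_eq_one_iff(1) Pc Mc by blast

lemma cjM: "x \<in> P \<Longrightarrow> u \<in> M \<Longrightarrow> cj x u = u"
  using M_comm[of x u] cmt_eq_one_iff[of x u] Pc Mc by metis

lemma cmt_right: "x \<in> P \<Longrightarrow> y \<in> P \<Longrightarrow> z \<in> P \<Longrightarrow> cmt x (y \<otimes> z) = cmt x y \<otimes> cmt x z"
  using cmt_mult_right[of x y z] cjM[OF _ cmt_in_M, of y x z] Pc by simp

lemma cmt_left: "x \<in> P \<Longrightarrow> y \<in> P \<Longrightarrow> z \<in> P \<Longrightarrow> cmt (x \<otimes> y) z = cmt x z \<otimes> cmt y z"
  using cmt_mult_left[of x y z] cjM[OF _ cmt_in_M, of x y z] M_comm[OF _ cmt_in_M, of "cmt x z" y z] cmt_in_M[of x z] MP Pc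
  by auto

lemma class2:
  assumes "x \<in> P" "y \<in> P"
  shows "y [^] (n::nat) \<otimes> x = cmt y x [^] n \<otimes> (x \<otimes> y [^] n)"
    and "(x \<otimes> y) [^] n = x [^] n \<otimes> (y [^] n \<otimes> cmt y x [^] (n choose 2))"
  using class2_pow[of x y n] M_comm[OF _ cmt_in_M] assms Pc by auto

lemma power_in_M: "x \<in> P \<Longrightarrow> x [^] p \<in> M"
  by (rule chief_power[OF p Pn cP ch order_refl])

text \<open>\<open>y [^] p\<close> lies in \<open>M\<close> and so is central, which gives
  \<open>[y, x]\<^sup>p = [y\<^sup>p, x] = 1\<close>.\<close>

lemma cmt_pow: "x \<in> P \<Longrightarrow> y \<in> P \<Longrightarrow> cmt y x [^] p = \<one>"
proof -
  assume xy: "x \<in> P" "y \<in> P"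
  have c: "x \<in> carrier G" "y \<in> carrier G" "cmt y x \<in> carrier G" using xy Pc by auto
  have "y [^] p \<otimes> x = x \<otimes> y [^] p" using M_comm[OF xy(1) power_in_M[OF xy(2)]] .
  then have "cmt y x [^] p \<otimes> (x \<otimes> y [^] p) = x \<otimes> y [^] p" using class2(1)[OF xy, of p] by simp
  then show ?thesis using c by (metis l_cancel_one m_closed nat_pow_closed r_cancel_one)
qed

text \<open>The second assumption removes the commutator from the collection formula, so the
  \<open>n\<close>-th power is a homomorphism on \<open>P\<close>. Its kernel contains every
  \<open>cmt q x\<close>, since \<open>q\<close> fixes \<open>x [^] n \<in> M\<close>.\<close>

lemma power_trivial:
  assumes n: "\<And>x. x \<in> P \<Longrightarrow> x [^] (n::nat) \<in> M"
    and k: "\<And>x y. x \<in> P \<Longrightarrow> y \<in> P \<Longrightarrow> cmt y x [^] (n choose 2) = \<one>"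
  shows "x \<in> P \<Longrightarrow> x [^] n = \<one>"
proof -
  define Y where "Y = {x \<in> P. x [^] n = \<one>}"
  have mult: "(x \<otimes> y) [^] n = x [^] n \<otimes> y [^] n" if "x \<in> P" "y \<in> P" for x y
    using class2(2)[OF that, of n] k[OF that] that Pc by simp
  have "Y \<lhd> G" unfolding normal_iff_cj
  proof (intro conjI ballI)
    show "subgroup Y G"
      by (rule finite_subgroupI)
        (use Pc mult subgroup.m_closed[OF Ps] subgroup.one_closed[OF Ps] in \<open>auto simp: Y_def\<close>)
    show "cj g x \<in> Y" if "g \<in> carrier G" "x \<in> Y" for g x
      using that normalD_cj[OF Pn] Pc by (simp add: Y_def cj_pow[symmetric])
  qed
  moreover have "Y \<subseteq> P" by (auto simp: Y_def)
  moreover have "cmt q x \<in> Y" if q: "q \<in> Q" and x: "x \<in> P" for q x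
  proof -
    have c: "q \<in> carrier G" "x \<in> carrier G" using q x Qc Pc by auto
    have "cmt q x [^] n = (cj q x) [^] n \<otimes> (inv x) [^] n"
      by (rule mult) (use normalD_cj[OF Pn] c x subgroup.m_inv_closed[OF Ps] in auto)
    also have "(cj q x) [^] n = x [^] n" using cjQM[OF q n[OF x]] c by (simp add: cj_pow)
    also have "x [^] n \<otimes> (inv x) [^] n = \<one>" using c by (simp add: nat_pow_inv)
    finally show ?thesis using cmtQ_in[OF q x] by (simp add: Y_def)
  qed
  ultimately have "Y = P" by (rule eq_top)
  then show "x \<in> P \<Longrightarrow> x [^] n = \<one>" by (auto simp: Y_def)
qed

lemma exponent_odd: "odd p \<Longrightarrow> x \<in> P \<Longrightarrow> x [^] p = \<one>"
proof (rule power_trivial[of p])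
  assume "odd p"
  then have "p choose 2 = p * ((p - 1) div 2)" by (simp add: choose_two div_mult_swap)
  then show "cmt y x [^] (p choose 2) = \<one>" if "x \<in> P" "y \<in> P" for x y
    using cmt_pow[OF that] that Pc by (simp add: nat_pow_pow[symmetric])
qed (auto intro: power_in_M)

text \<open>\<open>2 choose 2 = 1\<close> leaves the commutator in place, while
  \<open>4 choose 2 = 6\<close> is even; hence exponent 4 in place of 2.\<close>

lemma exponent_two: "p = 2 \<Longrightarrow> x \<in> P \<Longrightarrow> x [^] (4::nat) = \<one>"
proof (rule power_trivial[of 4])
  assume p2: "p = 2"
  show "x [^] (4::nat) \<in> M" if "x \<in> P" for x
  proof -
    have "x [^] (4::nat) = (x [^] p) [^] (2::nat)" using that Pc p2 by (simp add: nat_pow_pow)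
    then show ?thesis using nat_pow_mem[OF Ms power_in_M[OF that]] by simp
  qed
  show "cmt y x [^] (4 choose 2 :: nat) = \<one>" if "x \<in> P" "y \<in> P" for x y
  proof -
    have "(4 choose 2 :: nat) = 2 * 3" by (simp add: choose_two)
    then have "cmt y x [^] (4 choose 2 :: nat) = (cmt y x [^] (2::nat)) [^] (3::nat)" using that Pc
      by (simp add: nat_pow_pow)
    also have "cmt y x [^] (2::nat) = \<one>" using cmt_pow[OF that] p2 by simp
    finally show ?thesis by simp
  qed
qed

end

section \<open>Squares and commutators for \<open>p = 2\<close>\<close>

context irreducible_top
begin

text \<open>The derived subgroup of \<open>P\<close>, which is central since it lies in
  \<open>M\<close>.\<close>

definition cgen :: "'a set"
  where "cgen = generate G {cmt x y | x y. x \<in> P \<and> y \<in> P}"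

lemma cgen_mem: "x \<in> P \<Longrightarrow> y \<in> P \<Longrightarrow> cmt x y \<in> cgen"
  by (auto simp: cgen_def intro!: generate.incl)

lemma cgen_in_M: "cgen \<subseteq> M"
  unfolding cgen_def by (rule generate_subgroup_incl[OF _ Ms]) (use cmt_in_M in auto)

lemma cgen_normal: "cgen \<lhd> G"
  unfolding cgen_def
proof (rule normal_generateI)
  show "{cmt x y |x y. x \<in> P \<and> y \<in> P} \<subseteq> carrier G" using Pc by auto
  fix h g assume "h \<in> {cmt x y |x y. x \<in> P \<and> y \<in> P}" and g: "g \<in> carrier G"
  then obtain x y where xy: "x \<in> P" "y \<in> P" "h = cmt x y" by blast
  have "g \<otimes> h \<otimes> inv g = cmt (cj g x) (cj g y)"
    using cj_cmt[of g x y] xy g Pc by (simp add: conjugate_def[of G g "cmt x y"])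
  then show "g \<otimes> h \<otimes> inv g \<in> {cmt x y |x y. x \<in> P \<and> y \<in> P}"
    using normalD_cj[OF Pn g] xy by blast
qed

lemma cgen_square:
  assumes p2: "p = 2" and d: "d \<in> cgen"
  shows "d \<otimes> d = \<one>"
proof -
  let ?E = "{d \<in> M. d \<otimes> d = \<one>}"
  have "subgroup ?E G"
  proof (rule finite_subgroupI)
    fix x y assume "x \<in> ?E" "y \<in> ?E"
    then have xy: "x \<in> M" "y \<in> M" "x \<otimes> x = \<one>" "y \<otimes> y = \<one>" "x \<in> carrier G" "y \<in> carrier G" using Mc by auto
    have "x \<otimes> y \<otimes> (x \<otimes> y) = x \<otimes> (y \<otimes> x) \<otimes> y" using xy by (simp add: m_assoc)
    also have "y \<otimes> x = x \<otimes> y" using M_comm xy MP by blast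
    also have "x \<otimes> (x \<otimes> y) \<otimes> y = (x \<otimes> x) \<otimes> (y \<otimes> y)" using xy(5,6) by (simp add: m_assoc)
    finally show "x \<otimes> y \<in> ?E" using xy subgroup.m_closed[OF Ms] by simp
  qed (use Mc subgroup.one_closed[OF Ms] in auto)
  moreover have "{cmt x y |x y. x \<in> P \<and> y \<in> P} \<subseteq> ?E"
  proof clarify
    fix x y assume xy: "x \<in> P" "y \<in> P"
    have "cmt x y [^] (2::nat) = \<one>" using cmt_pow[OF xy(2,1)] p2 by simp
    then show "cmt x y \<in> M \<and> cmt x y \<otimes> cmt x y = \<one>" using cmt_in_M[OF xy] xy Pc by (simp add: pow_two)
  qed
  ultimately have "cgen \<subseteq> ?E" unfolding cgen_def by (rule generate_subgroup_incl[rotated])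
  then show ?thesis using d by blast
qed

text \<open>Modulo \<open>cgen\<close> squaring is a homomorphism, and \<open>q\<close> fixes the
  square of \<open>x\<close>, which lies in \<open>M\<close>; so all \<open>cmt q x\<close> have
  their squares in \<open>cgen\<close>, and \<open>eq_top\<close> applies.\<close>

lemma square_in_cgen:
  assumes p2: "p = 2" and "x \<in> P"
  shows "x \<otimes> x \<in> cgen"
proof -
  note Cs = normalD_subgroup[OF cgen_normal]
  define Y where "Y = {x \<in> P. x [^] (2::nat) \<in> cgen}"
  have mult: "(x \<otimes> y) [^] (2::nat) = x [^] (2::nat) \<otimes> (y [^] (2::nat) \<otimes> cmt y x)" if "x \<in> P" "y \<in> P" for x y
    using class2(2)[OF that, of 2] that Pc by simp
  have "Y \<lhd> G" unfolding normal_iff_cj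
  proof (intro conjI ballI)
    show "subgroup Y G"
    proof (rule finite_subgroupI)
      show "Y \<subseteq> carrier G" using Pc by (auto simp: Y_def)
      show "\<one> \<in> Y" by (simp add: Y_def subgroup.one_closed[OF Ps] subgroup.one_closed[OF Cs])
      fix x y assume xy: "x \<in> Y" "y \<in> Y"
      then have "(x \<otimes> y) [^] (2::nat) \<in> cgen"
        using mult[of x y] cgen_mem[of y x] subgroup.m_closed[OF Cs] by (simp add: Y_def)
      then show "x \<otimes> y \<in> Y" using xy subgroup.m_closed[OF Ps] by (simp add: Y_def)
    qed
    show "cj g x \<in> Y" if "g \<in> carrier G" "x \<in> Y" for g x
      using that normalD_cj[OF Pn] normalD_cj[OF cgen_normal] Pc by (simp add: Y_def cj_pow[symmetric])
  qed
  moreover have "Y \<subseteq> P" by (auto simp: Y_def)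
  moreover have "cmt q x \<in> Y" if q: "q \<in> Q" and x: "x \<in> P" for q x
  proof -
    have c: "q \<in> carrier G" "x \<in> carrier G" using q x Qc Pc by auto
    have a: "cj q x \<in> P" "inv x \<in> P" using normalD_cj[OF Pn] c x subgroup.m_inv_closed[OF Ps] by auto
    have "x [^] (2::nat) \<in> M" using power_in_M[OF x] p2 by simp
    from cjQM[OF q this] have "(cj q x) [^] (2::nat) = x [^] (2::nat)" using c by (simp add: cj_pow)
    then have "cmt q x [^] (2::nat) = x [^] (2::nat) \<otimes> (inv x [^] (2::nat) \<otimes> cmt (inv x) (cj q x))"
      using mult[OF a] by simp
    also have "\<dots> = cmt (inv x) (cj q x)"
    proof -
      have "a \<otimes> (inv a \<otimes> b) = b" if "a \<in> carrier G" "b \<in> carrier G" for a b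
        using that by (simp add: m_assoc[symmetric])
      from this[of "x [^] (2::nat)" "cmt (inv x) (cj q x)"] show ?thesis using c by (simp add: nat_pow_inv)
    qed
    finally show ?thesis using cmtQ_in[OF q x] cgen_mem[OF a(2,1)] by (simp add: Y_def)
  qed
  ultimately have "Y = P" by (rule eq_top)
  then have "x \<in> Y" using assms(2) by simp
  then show ?thesis using pow_two[OF Pc[OF assms(2)]] by (simp add: Y_def)
qed

text \<open>Fix a maximal subgroup \<open>M\<^sub>0\<close> of the derived group.  If two elements whose squares lie outside
  \<open>M\<^sub>0\<close> do not commute modulo \<open>M\<^sub>0\<close>, they generate a quaternion group modulo \<open>M\<^sub>0\<close>.  Otherwise the
  centralizer modulo \<open>M\<^sub>0\<close> of these elements has index at most 2 in \<open>P\<close> and, containing every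
  \<open>[q, x]\<close>, it is \<open>P\<close>; hence \<open>P\<close> would be abelian modulo \<open>M\<^sub>0\<close>.\<close>

lemma quaternion_free_abelian:
  assumes p2: "p = 2" and qf: "quaternion_free 2 (G\<lparr>carrier := P\<rparr>)"
  shows "cgen = {\<one>}"
proof (rule ccontr)
  assume ne: "cgen \<noteq> {\<one>}"
  note Cs = normalD_subgroup[OF cgen_normal]
  have Cc: "d \<in> carrier G" if "d \<in> cgen" for d using that cgen_in_M Mc by blast
  let ?P = "\<lambda>N. subgroup N G \<and> N \<subset> cgen"
  have P1: "?P {\<one>}" using ne subgroup.one_closed[OF Cs] triv_subgroup by blast
  have "\<forall>N. ?P N \<longrightarrow> card N < Suc (card cgen)"
    using finite_subgroup[OF Cs] by (meson less_SucI psubset_card_mono)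
  from ex_has_greatest_nat[of ?P, OF P1 this]
  obtain N where N': "?P N \<and> (\<forall>N'. ?P N' \<longrightarrow> card N' \<le> card N)" ..
  then have N: "subgroup N G" "N \<subset> cgen" and Nmax: "\<And>N'. ?P N' \<Longrightarrow> card N' \<le> card N" by blast+
  have NM: "N \<subseteq> M" using N cgen_in_M by blast
  have prime2: "Factorial_Ring.prime (2::nat)" by simp
  \<comment> \<open>Maximality gives \<open>N\<close> index 2 in \<open>cgen\<close>, so the
    elements outside \<open>N\<close> form a single coset.\<close>
  have two: "d \<otimes> e \<in> N" if de: "d \<in> cgen" "d \<notin> N" "e \<in> cgen" "e \<notin> N" for d e
  proof -
    have dc: "d \<in> carrier G" using de Cc by blast
    have cjd: "cj d h \<in> N" if h: "h \<in> N" for h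
    proof -
      have "cj d h = h" by (rule cjM) (use h NM de(1) cgen_in_M MP in auto)
      then show ?thesis using h by simp
    qed
    have "d [^] (2::nat) = \<one>" using cgen_square[OF p2 de(1)] pow_two dc by simp
    then have d2: "d [^] (2::nat) \<in> N" using subgroup.one_closed[OF N(1)] by simp
    let ?N = "generate G {d} <#> N"
    have gen: "generate G {d} = range (\<lambda>n::nat. d [^] n)" using generate_singleton_finite dc by simp
    have ext: "subgroup ?N G" "card ?N = 2 * card N"
      using prime_extension[OF prime2 N(1) dc de(2) d2 cjd] by auto
    have "generate G {d} \<subseteq> cgen" using gen nat_pow_mem[OF Cs de(1)] by auto
    then have "?N \<subseteq> cgen" using set_mult_subset[OF Cs] N by blast
    then have "?N = cgen" using Nmax[of ?N] ext card_subgroup_pos[OF N(1)] by fastforce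
    then have "e \<in> ?N" using de(3) by simp
    then obtain n :: nat and u where u: "u \<in> N" "e = d [^] n \<otimes> u" unfolding gen mem_set_mult by blast
    have uc: "u \<in> carrier G" using u N(1) subgroup.mem_carrier by fastforce
    have "odd n"
    proof (rule ccontr)
      assume "\<not> odd n"
      then have "d [^] n \<in> N" using pow_mem_iff_dvd[OF prime2 N(1) dc de(2) d2, of n] by simp
      then have "e \<in> N" using u subgroup.m_closed[OF N(1)] by simp
      then show False using de by simp
    qed
    then have "2 dvd Suc n" by simp
    then have "d [^] Suc n \<in> N" using pow_mem_iff_dvd[OF prime2 N(1) dc de(2) d2, of "Suc n"] by blast
    moreover have "d \<otimes> e = d [^] Suc n \<otimes> u" using u dc uc by (simp only: nat_pow_Suc2) (simp add: m_assoc)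
    ultimately show ?thesis using u subgroup.m_closed[OF N(1)] by simp
  qed
  have one: "d \<otimes> e \<notin> N" if de: "d \<in> N" "e \<notin> N" "e \<in> cgen" for d e
  proof
    assume "d \<otimes> e \<in> N"
    then have "inv d \<otimes> (d \<otimes> e) \<in> N" using de N(1) by (simp add: subgroup.m_closed subgroup.m_inv_closed)
    moreover have "d \<in> carrier G" using de(1) N(1) subgroup.mem_carrier by fastforce
    ultimately show False using de Cc[OF de(3)] by (simp add: m_assoc[symmetric])
  qed
  \<comment> \<open>Lying in \<open>N\<close> is thus a character of \<open>cgen\<close> with two
    values, and the computations below are parity counts.\<close>
  have chi: "d \<otimes> e \<in> N \<longleftrightarrow> (d \<in> N \<longleftrightarrow> e \<in> N)" if de: "d \<in> cgen" "e \<in> cgen" for d e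
  proof -
    have "d \<otimes> e = e \<otimes> d" using M_comm[of e d] de cgen_in_M MP by blast
    then show ?thesis using two[of d e] one[of d e] one[of e d] subgroup.m_closed[OF N(1)] de by metis
  qed
  have chi3: "d \<otimes> (e \<otimes> f) \<in> N \<longleftrightarrow> (d \<in> N \<longleftrightarrow> (e \<in> N \<longleftrightarrow> f \<in> N))" if "d \<in> cgen" "e \<in> cgen" "f \<in> cgen" for d e f
    using chi that subgroup.m_closed[OF Cs] by metis
  have sq: "(x \<otimes> y) \<otimes> (x \<otimes> y) = (x \<otimes> x) \<otimes> ((y \<otimes> y) \<otimes> cmt y x)" if "x \<in> P" "y \<in> P" for x y
    using class2(2)[OF that, of 2] that Pc by (simp add: pow_two)
  have comm_sym: "cmt x y \<in> N \<longleftrightarrow> cmt y x \<in> N" if "x \<in> P" "y \<in> P" for x y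
    using that inv_cmt[of x y] inv_cmt[of y x] Pc subgroup.m_inv_closed[OF N(1)] by metis
  define S where "S = {x \<in> P. x \<otimes> x \<notin> N}"
  have SP: "S \<subseteq> P" by (auto simp: S_def)
  \<comment> \<open>Otherwise \<open>x \<otimes> x\<close>, \<open>y \<otimes> y\<close> and
    \<open>cmt y x\<close> all lie in the one coset of \<open>cgen\<close> outside \<open>N\<close>.
    These are the relations of the quaternion group, with \<open>z = x \<otimes> x\<close>.\<close>
  have SS: "cmt x y \<in> N" if xy: "x \<in> S" "y \<in> S" for x y
  proof (rule ccontr)
    assume "cmt x y \<notin> N"
    then have yx: "cmt y x \<notin> N" using comm_sym xy SP by blast
    interpret H: fin_group "G\<lparr>carrier := P\<rparr>" by (rule subgroup_fin_group[OF Ps])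
    have cjH: "conjugate (G\<lparr>carrier := P\<rparr>) g h = cj g h" if "g \<in> P" for g h
      using that m_inv_consistent[OF Ps that] by (simp add: conjugate_def)
    have NH: "N \<lhd> G\<lparr>carrier := P\<rparr>" unfolding H.normal_iff_cj
    proof (intro conjI ballI)
      show "subgroup N (G\<lparr>carrier := P\<rparr>)" by (rule subgroup_incl[OF N(1) Ps]) (use NM MP in blast)
      show "conjugate (G\<lparr>carrier := P\<rparr>) g x \<in> N" if "g \<in> carrier (G\<lparr>carrier := P\<rparr>)" "x \<in> N" for g x
        using that cjH cjM NM by auto
    qed
    have x: "x \<in> P" "x \<otimes> x \<notin> N" "x \<in> carrier G" and y: "y \<in> P" "y \<otimes> y \<notin> N" "y \<in> carrier G"
      using xy Pc by (auto simp: S_def)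
    have D: "x \<otimes> x \<in> cgen" "y \<otimes> y \<in> cgen" "cmt y x \<in> cgen"
      using square_in_cgen[OF p2] cgen_mem x y by auto
    have invz: "inv (x \<otimes> x) = x \<otimes> x" using cgen_square[OF p2 D(1)] x by (simp add: inv_equality)
    have eq: "N #> d = N #> (x \<otimes> x)" if "d \<in> cgen" "d \<notin> N" for d
      using rcoset_eq_iff[OF N(1), of d "x \<otimes> x"] invz two[OF that D(1) x(2)] Cc that x by simp
    have cz: "cmt w (x \<otimes> x) \<in> N" if "w \<in> P" for w
    proof -
      have "cmt w (x \<otimes> x) = \<one>" using cjM[OF that, of "x \<otimes> x"] cmt_eq_one_iff(2)[of w "x \<otimes> x"] D cgen_in_M that Pc x by auto
      then show ?thesis using subgroup.one_closed[OF N(1)] by simp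
    qed
    have inH: "inv\<^bsub>G\<lparr>carrier := P\<rparr>\<^esub> w = inv w" if "w \<in> P" for w using m_inv_consistent[OF Ps that] .
    let ?H = "G\<lparr>carrier := P\<rparr>"
    have xxP: "x \<otimes> x \<in> P" using subgroup.m_closed[OF Ps x(1) x(1)] .
    have "\<not> quaternion_free 2 ?H"
    proof (rule H.not_quaternion_freeI[OF NH, of x y "x \<otimes> x"])
      show "x \<in> carrier ?H" "y \<in> carrier ?H" "x \<otimes> x \<in> carrier ?H" "x \<otimes> x \<notin> N" using x y xxP by auto
      show "(x \<otimes> x) \<otimes>\<^bsub>?H\<^esub> (x \<otimes> x) \<in> N" using cgen_square[OF p2 D(1)] subgroup.one_closed[OF N(1)] by simp
      show "conjugate ?H x (x \<otimes> x) \<otimes>\<^bsub>?H\<^esub> inv\<^bsub>?H\<^esub> (x \<otimes> x) \<in> N" using cz[OF x(1)] by (simp add: cjH[OF x(1)] inH[OF xxP])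
      show "conjugate ?H y (x \<otimes> x) \<otimes>\<^bsub>?H\<^esub> inv\<^bsub>?H\<^esub> (x \<otimes> x) \<in> N" using cz[OF y(1)] by (simp add: cjH[OF y(1)] inH[OF xxP])
      show "N #>\<^bsub>?H\<^esub> (x \<otimes>\<^bsub>?H\<^esub> x) = N #>\<^bsub>?H\<^esub> (x \<otimes> x)" by simp
      show "N #>\<^bsub>?H\<^esub> (y \<otimes>\<^bsub>?H\<^esub> y) = N #>\<^bsub>?H\<^esub> (x \<otimes> x)" using eq[OF D(2) y(2)] by simp
      show "N #>\<^bsub>?H\<^esub> (conjugate ?H y x \<otimes>\<^bsub>?H\<^esub> inv\<^bsub>?H\<^esub> x) = N #>\<^bsub>?H\<^esub> (x \<otimes> x)"
        using eq[OF D(3) yx] by (simp add: cjH[OF y(1)] inH[OF x(1)])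
    qed
    then show False using qf by simp
  qed
  define W where "W = {x \<in> P. \<forall>s\<in>S. cmt s x \<in> N}"
  have SW: "S \<subseteq> W" using SS SP by (auto simp: W_def)
  have WP: "W \<subseteq> P" by (auto simp: W_def)
  have Ws: "subgroup W G"
  proof (rule finite_subgroupI)
    show "W \<subseteq> carrier G" using Pc by (auto simp: W_def)
    show "\<one> \<in> W" using SP Pc by (auto simp: W_def subgroup.one_closed[OF Ps] subgroup.one_closed[OF N(1)])
    show "x \<otimes> y \<in> W" if "x \<in> W" "y \<in> W" for x y
      using that SP cmt_right subgroup.m_closed[OF Ps] subgroup.m_closed[OF N(1)] by (auto simp: W_def)
  qed
  \<comment> \<open>As \<open>t \<in> W\<close>, neither \<open>x\<close> nor
    \<open>x \<otimes> t\<close> lies in \<open>W\<close>, so neither lies in \<open>S\<close>, and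
    both squares are in \<open>N\<close>. In the formula for the square of
    \<open>x \<otimes> t\<close> the factor \<open>t \<otimes> t\<close> must then be balanced by
    the commutator.\<close>
  have outside: "cmt t x \<notin> N" if t: "t \<in> S" and x: "x \<in> P" "x \<notin> W" for t x
  proof -
    have tP: "t \<in> P" "t \<in> W" using t SP SW by auto
    have "x \<otimes> t \<notin> W"
    proof
      assume "x \<otimes> t \<in> W"
      then have "(x \<otimes> t) \<otimes> inv t \<in> W" using tP subgroup.m_closed[OF Ws] subgroup.m_inv_closed[OF Ws] by simp
      then show False using x tP Pc by (simp add: m_assoc)
    qed
    then have "x \<otimes> t \<notin> S" "x \<notin> S" using SW x by auto
    then have "(x \<otimes> t) \<otimes> (x \<otimes> t) \<in> N" "x \<otimes> x \<in> N" using x tP subgroup.m_closed[OF Ps] by (auto simp: S_def)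
    moreover have "t \<otimes> t \<notin> N" using t by (simp add: S_def)
    ultimately show ?thesis
      using sq[OF x(1) tP(1)] chi3[of "x \<otimes> x" "t \<otimes> t" "cmt t x"] square_in_cgen[OF p2] cgen_mem x tP by auto
  qed
  have cjqS: "cj g s \<in> S" if g: "g \<in> carrier G" "\<And>u. u \<in> M \<Longrightarrow> cj g u = u" and s: "s \<in> S" for g s
  proof -
    have "s \<otimes> s \<in> M" using square_in_cgen[OF p2] cgen_in_M s SP by blast
    then have "cj g s \<otimes> cj g s = s \<otimes> s" using g s SP Pc by (auto simp: cj_mult[symmetric])
    then show ?thesis using s normalD_cj[OF Pn g(1)] by (auto simp: S_def)
  qed
  \<comment> \<open>For fixed \<open>x\<close> the answer to \<open>cmt s x \<in> N\<close> is the
    same for all \<open>s \<in> S\<close>. Since \<open>S\<close> is invariant under conjugation by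
    \<open>inv q\<close>, conjugating \<open>x\<close> by \<open>q\<close> does not change the
    answer, and the two contributions to \<open>cmt s (cmt q x)\<close> cancel.\<close>
  have cmtQ: "cmt q x \<in> W" if q: "q \<in> Q" and x: "x \<in> P" for q x
  proof -
    have c: "q \<in> carrier G" "x \<in> carrier G" using q x Qc Pc by auto
    have qi: "cj (inv q) u = u" if "u \<in> M" for u
      using cjQM[OF q that] c Mc[OF that] by (metis cj_inv_cancel(2))
    have par: "cmt s (cj q x) \<in> N \<longleftrightarrow> cmt (cj (inv q) s) x \<in> N" if s: "s \<in> S" for s
    proof -
      have sc: "s \<in> carrier G" "s \<in> P" using s SP Pc by auto
      have s': "cj (inv q) s \<in> P" "cj (inv q) s \<in> carrier G" using normalD_cj[OF Pn, of "inv q" s] c sc by auto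
      have "cmt s (cj q x) = cj q (cmt (cj (inv q) s) x)" using cj_cmt[of q "cj (inv q) s" x] c sc s' by simp
      also have "\<dots> = cmt (cj (inv q) s) x" by (rule cjQM[OF q cmt_in_M[OF s'(1) x]])
      finally show ?thesis by simp
    qed
    have "cmt s (cmt q x) \<in> N" if s: "s \<in> S" for s
    proof -
      have s': "cj (inv q) s \<in> S" by (rule cjqS) (use c qi s in auto)
      have sP: "s \<in> P" using s SP by blast
      have xP: "cj q x \<in> P" "inv x \<in> P" using x c normalD_cj[OF Pn] subgroup.m_inv_closed[OF Ps] by auto
      have "cmt s (x \<otimes> inv x) = cmt s x \<otimes> cmt s (inv x)" by (rule cmt_right[OF sP x xP(2)])
      then have "cmt s x \<otimes> cmt s (inv x) \<in> N" using c sP Pc subgroup.one_closed[OF N(1)] by simp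
      then have i: "cmt s (inv x) \<in> N \<longleftrightarrow> cmt s x \<in> N" using chi[of "cmt s x" "cmt s (inv x)"] cgen_mem sP x xP by auto
      have "cmt s (cj q x) \<in> N \<longleftrightarrow> cmt s x \<in> N"
      proof (cases "x \<in> W")
        case True
        then have "cmt s x \<in> N" "cmt (cj (inv q) s) x \<in> N" using s s' by (simp_all add: W_def)
        then show ?thesis using par[OF s] by simp
      next
        case False
        then show ?thesis using par[OF s] outside[OF s x] outside[OF s' x] by simp
      qed
      moreover have "cmt s (cmt q x) = cmt s (cj q x) \<otimes> cmt s (inv x)" by (rule cmt_right[OF sP xP])
      ultimately show ?thesis using i chi[OF cgen_mem[OF sP xP(1)] cgen_mem[OF sP xP(2)]] by simp
    qed
    then show ?thesis using cmtQ_in[OF q x] by (simp add: W_def)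
  qed
  let ?C = "{cmt q x | q x. q \<in> Q \<and> x \<in> P}"
  have "generate G ?C = P"
  proof (rule eq_top)
    show "generate G ?C \<lhd> G"
    proof (rule normal_generateI)
      show "?C \<subseteq> carrier G" using Pc Qc by auto
      fix h g assume "h \<in> ?C" and g: "g \<in> carrier G"
      then obtain q x where qx: "q \<in> Q" "x \<in> P" "h = cmt q x" by blast
      have "g \<otimes> h \<otimes> inv g = cmt (cj g q) (cj g x)"
        using cj_cmt[of g q x] qx g Pc Qc by (simp add: conjugate_def[of G g "cmt q x"])
      then show "g \<otimes> h \<otimes> inv g \<in> ?C" using normalD_cj[OF Pn g] Q(2) g qx by blast
    qed
    show "generate G ?C \<subseteq> P" by (rule generate_subgroup_incl[OF _ Ps]) (use cmtQ_in in auto)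
    show "cmt q x \<in> generate G ?C" if "q \<in> Q" "x \<in> P" for q x using that by (intro generate.incl) blast
  qed
  moreover have "generate G ?C \<subseteq> W" by (rule generate_subgroup_incl[OF _ Ws]) (use cmtQ in auto)
  ultimately have "W = P" using WP by blast
  then have SN: "cmt s x \<in> N" if "s \<in> S" "x \<in> P" for s x using that by (auto simp: W_def)
  \<comment> \<open>Elements of \<open>S\<close> are now central modulo \<open>N\<close>. Two
    elements that do not commute modulo \<open>N\<close> would lie outside \<open>S\<close>, but
    their product would lie in \<open>S\<close>.\<close>
  have "cmt x y \<in> N" if xy: "x \<in> P" "y \<in> P" for x y
  proof (rule ccontr)
    assume n: "cmt x y \<notin> N"
    then have "cmt y x \<notin> N" using comm_sym xy by blast
    then have "x \<notin> S" "y \<notin> S" using SN xy n by auto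
    then have "x \<otimes> x \<in> N" "y \<otimes> y \<in> N" using xy by (auto simp: S_def)
    then have "(x \<otimes> y) \<otimes> (x \<otimes> y) \<notin> N"
      using sq[OF xy] chi3[of "x \<otimes> x" "y \<otimes> y" "cmt y x"] \<open>cmt y x \<notin> N\<close> square_in_cgen[OF p2] cgen_mem xy by auto
    then have "x \<otimes> y \<in> S" using xy subgroup.m_closed[OF Ps] by (simp add: S_def)
    then have "cmt (x \<otimes> y) y \<in> N" using SN xy by blast
    moreover have "cmt (x \<otimes> y) y = cmt x y" using cmt_left[OF xy(1,2,2)] cmt_eq_one_iff(1)[of y y] xy Pc by simp
    ultimately show False using n by simp
  qed
  then have "cgen \<subseteq> N" unfolding cgen_def by (intro generate_subgroup_incl[OF _ N(1)]) auto
  then show False using N by blast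
qed

lemma exponent_quaternion_free:
  assumes p2: "p = 2" and qf: "quaternion_free 2 (G\<lparr>carrier := P\<rparr>)" and "x \<in> P"
  shows "x [^] (2::nat) = \<one>"
proof (rule power_trivial[of 2])
  show "x [^] (2::nat) \<in> M" if "x \<in> P" for x using power_in_M[OF that] p2 by simp
  show "cmt y x [^] (2 choose 2 :: nat) = \<one>" if "x \<in> P" "y \<in> P" for x y
    using cgen_mem[OF that(2,1)] quaternion_free_abelian[OF p2 qf] by simp
qed fact

end

section \<open>A unique minimal normal subgroup whose order is not \<open>p\<close>\<close>

context fin_group
begin

text \<open>The mirror image of \<open>irreducible_top\<close>: now \<open>Q\<close> acts trivially
  on \<open>P/R\<close> but not on \<open>R\<close>. Its fixed points in \<open>P\<close> form a
  normal subgroup not containing \<open>R\<close>, so they are trivial by uniqueness. As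
  \<open>R\<close> is central in \<open>P\<close> and of exponent \<open>p\<close>, commutators and
  \<open>p\<close>-th powers are fixed by \<open>Q\<close>.\<close>

lemma elementary_abelian_top:
  fixes p :: nat
  assumes p: "Factorial_Ring.prime p" and Pn: "P \<lhd> G" "card P = p ^ m"
    and ch: "chief_factor G R {\<one>}" and ser: "p_series G p R P"
    and uniq: "\<And>Y. Y \<lhd> G \<Longrightarrow> Y \<subseteq> P \<Longrightarrow> Y \<noteq> {\<one>} \<Longrightarrow> R \<subseteq> Y"
    and bad: "card R \<noteq> p"
  shows "\<And>x y. x \<in> P \<Longrightarrow> y \<in> P \<Longrightarrow> x \<otimes> y = y \<otimes> x" "\<And>x. x \<in> P \<Longrightarrow> x [^] p = \<one>"
proof -
  note Ps = normalD_subgroup[OF Pn(1)] and Pc = normal_carrierD[OF Pn(1)]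
  have R: "R \<lhd> G" "R \<subseteq> P" "R \<noteq> {\<one>}" using ch p_series_normal[OF ser] by (auto simp: chief_factor_def)
  note Rs = normalD_subgroup[OF R(1)] and Rc = normal_carrierD[OF R(1)]
  have "card R dvd p ^ m" using card_subgroup_dvd[OF Rs Ps R(2)] Pn by simp
  then obtain r where r: "card R = p ^ r" using divides_primepow_nat[OF p] by blast
  have "card R \<noteq> p * card {\<one>}" using bad by simp
  from exists_centralizing_set[OF p ser Pn(2) ch r this]
  obtain Q where Q: "Q \<subseteq> carrier G" "normalizes (carrier G) Q" "\<And>q x. q \<in> Q \<Longrightarrow> x \<in> P \<Longrightarrow> cmt q x \<in> R"
    "\<exists>q\<in>Q. \<exists>x\<in>R. cmt q x \<notin> {\<one>}" by blast
  have Qc: "q \<in> carrier G" if "q \<in> Q" for q using Q that by blast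
  define C where "C = {x \<in> P. \<forall>q\<in>Q. cmt q x \<in> {\<one>}}"
  have "C \<lhd> G" unfolding C_def
    by (rule normal_fixed_mod[OF one_is_normal Pn(1) _ Q(1,2)]) (use subgroup.one_closed[OF Ps] in auto)
  moreover have "\<not> R \<subseteq> C" using Q(4) by (auto simp: C_def)
  ultimately have C1: "C = {\<one>}" using uniq[of C] by (auto simp: C_def)
  have Rcent: "u \<otimes> x = x \<otimes> u" if "x \<in> P" "u \<in> R" for x u
  proof -
    have "cmt x u \<in> {\<one>}" by (rule chief_commutator[OF p Pn ch R(2) that(2,1)])
    then show ?thesis using cmt_eq_one_iff(1)[of x u] that Pc Rc by simp
  qed
  have cjR: "cj x u = u" if "x \<in> P" "u \<in> R" for x u
    using Rcent[OF that] cmt_eq_one_iff[of x u] that Pc Rc by metis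
  show comm: "x \<otimes> y = y \<otimes> x" if xy: "x \<in> P" "y \<in> P" for x y
  proof -
    have c: "x \<in> carrier G" "y \<in> carrier G" using xy Pc by auto
    have "cmt q (cmt x y) = \<one>" if q: "q \<in> Q" for q
    proof -
      have qc: "q \<in> carrier G" using q Qc by blast
      define u v where "u = cmt q x" and "v = cmt q y"
      have uv: "u \<in> R" "v \<in> R" "u \<in> carrier G" "v \<in> carrier G" "u \<in> P" "v \<in> P"
        using Q(3)[OF q] xy Rc R(2) by (auto simp: u_def v_def)
      have e: "cj q x = u \<otimes> x" "cj q y = v \<otimes> y" unfolding u_def v_def using cj_eq_cmt qc c by auto
      have u1: "cmt u w = \<one>" "cmt w u = \<one>" if "w \<in> P" for w
        using Rcent[OF that uv(1)] cmt_eq_one_iff(1)[of u w] cmt_eq_one_iff(1)[of w u] that Pc uv by auto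
      have v1: "cmt w v = \<one>" if "w \<in> P" for w
        using Rcent[OF that uv(2)] cmt_eq_one_iff(1)[of w v] that Pc uv by auto
      have P': "v \<otimes> y \<in> P" using subgroup.m_closed[OF Ps] uv xy by simp
      have "cmt x (v \<otimes> y) = cmt x v \<otimes> cj v (cmt x y)" using cmt_mult_right[of x v y] c uv by simp
      also have "cj v (cmt x y) = cmt x y"
        using cmt_eq_one_iff[of v "cmt x y"] Rcent[of "cmt x y" v] uv xy c subgroup.m_closed[OF Ps] subgroup.m_inv_closed[OF Ps] subgroup_cj[OF Ps] by auto
      finally have 1: "cmt x (v \<otimes> y) = cmt x y" using v1[OF xy(1)] c by simp
      have "cmt (u \<otimes> x) (v \<otimes> y) = cj u (cmt x (v \<otimes> y)) \<otimes> cmt u (v \<otimes> y)"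
        using cmt_mult_left[of u x "v \<otimes> y"] c uv by simp
      also have "\<dots> = cj u (cmt x y)" using 1 u1(1)[OF P'] c uv by simp
      also have "cj u (cmt x y) = cmt x y"
        using cmt_eq_one_iff[of u "cmt x y"] Rcent[of "cmt x y" u] uv xy c subgroup.m_closed[OF Ps] subgroup.m_inv_closed[OF Ps] subgroup_cj[OF Ps] by auto
      finally have "cj q (cmt x y) = cmt x y" using cj_cmt[of q x y] e qc c by simp
      then show ?thesis using cmt_eq_one_iff(2)[of q "cmt x y"] qc c by simp
    qed
    then have "cmt x y \<in> C"
      using xy subgroup.m_closed[OF Ps] subgroup.m_inv_closed[OF Ps] subgroup_cj[OF Ps] by (auto simp: C_def)
    then have "cmt x y = \<one>" using C1 by simp
    then show ?thesis using cmt_eq_one_iff(1) c by simp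
  qed
  show "x [^] p = \<one>" if x: "x \<in> P" for x
  proof -
    have c: "x \<in> carrier G" using x Pc by auto
    have "cmt q (x [^] p) = \<one>" if q: "q \<in> Q" for q
    proof -
      have qc: "q \<in> carrier G" using q Qc by blast
      define u where "u = cmt q x"
      have u: "u \<in> R" "u \<in> carrier G" using Q(3)[OF q x] Rc by (auto simp: u_def)
      have "u [^] p \<in> {\<one>}" by (rule chief_power[OF p Pn ch R(2) u(1)])
      moreover have "cj q x = u \<otimes> x" unfolding u_def using cj_eq_cmt qc c by auto
      ultimately have "cj q (x [^] p) = x [^] p"
        using pow_mult_distrib[OF Rcent[OF x u(1)] u(2) c, of p] qc c by (simp add: cj_pow)
      then show ?thesis using cmt_eq_one_iff(2)[of q "x [^] p"] qc c by simp
    qed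
    then have "x [^] p \<in> C" using nat_pow_mem[OF Ps x] by (auto simp: C_def)
    then show ?thesis using C1 by simp
  qed
qed

end

section \<open>Controlled supplements\<close>

text \<open>The common consequence of being \<open>\<Pi>\<close>-supplemented and of having a \<open>p\<close>-supersoluble supplement.\<close>

definition controlled_supplement ::
  "('a, 'b) monoid_scheme \<Rightarrow> nat \<Rightarrow> 'a set \<Rightarrow> 'a set \<Rightarrow> 'a set \<Rightarrow> bool"
  where "controlled_supplement G p P H T \<longleftrightarrow> subgroup T G \<and> H <#>\<^bsub>G\<^esub> T = carrier G \<and>
    (\<forall>L K. chief_factor G L K \<and> L \<subseteq> P \<and> L \<subseteq> T <#>\<^bsub>G\<^esub> K \<and> H \<inter> L \<subseteq> (H \<inter> T) <#>\<^bsub>G\<^esub> K \<longrightarrow>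
      card L = p * card K \<or>
      (\<exists>m. card (carrier G) = p ^ m * card {g \<in> carrier G. \<forall>x\<in>(H \<inter> L) <#>\<^bsub>G\<^esub> K.
        conjugate G g x \<in> (H \<inter> L) <#>\<^bsub>G\<^esub> K}))"

definition controlled :: "('a, 'b) monoid_scheme \<Rightarrow> nat \<Rightarrow> 'a set \<Rightarrow> 'a set \<Rightarrow> bool"
  where "controlled G p P H \<longleftrightarrow> (\<exists>T. controlled_supplement G p P H T)"

lemma controlled_mono: "controlled G p P H \<Longrightarrow> P' \<subseteq> P \<Longrightarrow> controlled G p P' H"
  unfolding controlled_def controlled_supplement_def by (meson subset_trans)

lemma quaternion_free_subgroup:
  assumes "group G" "subgroup P' G" "subgroup P G" "P' \<subseteq> P" "quaternion_free p (G\<lparr>carrier := P\<rparr>)"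
  shows "quaternion_free p (G\<lparr>carrier := P'\<rparr>)"
proof -
  interpret group G by fact
  have "subgroup A (G\<lparr>carrier := P\<rparr>)" if "subgroup A (G\<lparr>carrier := P'\<rparr>)" for A
  proof -
    have "subgroup A G" by (rule incl_subgroup[OF assms(2) that])
    moreover have "A \<subseteq> P" using subgroup.subset[OF that] assms(4) by simp
    ultimately show ?thesis using assms(3) by (simp add: subgroup_incl)
  qed
  then show ?thesis using assms(5) unfolding quaternion_free_def by auto
qed

context fin_group
begin

lemma subgroup_Int_subgroup: "subgroup H G \<Longrightarrow> subgroup K G \<Longrightarrow> subgroup (H \<inter> K) G"
  using subgroups_Inter[of "{H, K}"] by auto

lemma normalizer_subgroup:
  assumes "A \<subseteq> carrier G"
  shows "subgroup {g \<in> carrier G. \<forall>x\<in>A. cj g x \<in> A} G"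
proof (rule finite_subgroupI)
  fix g h assume "g \<in> {g \<in> carrier G. \<forall>x\<in>A. cj g x \<in> A}" "h \<in> {g \<in> carrier G. \<forall>x\<in>A. cj g x \<in> A}"
  then have gh: "g \<in> carrier G" "h \<in> carrier G" "\<forall>x\<in>A. cj g (cj h x) \<in> A" by auto
  then have "\<forall>x\<in>A. cj (g \<otimes> h) x \<in> A" using assms by (metis cj_cj subsetD)
  then show "g \<otimes> h \<in> {g \<in> carrier G. \<forall>x\<in>A. cj g x \<in> A}" using gh by simp
qed (use assms in auto)

text \<open>The normalizer contains \<open>S\<close> and so is \<open>G\<close>; irreducibility of
  \<open>L/K\<close> leaves only the two extreme subgroups. Each application chooses
  \<open>H\<close> so that neither can occur.\<close>

lemma controlled_supplement_key:
  fixes p :: nat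
  assumes p: "Factorial_Ring.prime p" and T: "controlled_supplement G p P H T" and H: "subgroup H G"
    and LK: "chief_factor G L K" and LP: "L \<subseteq> P" and LT: "L \<subseteq> T <#> K" and HT: "H \<inter> L \<subseteq> (H \<inter> T) <#> K"
    and ne: "card L \<noteq> p * card K"
    and S: "subgroup S G" "card S = p ^ multiplicity p (card (carrier G))"
    and nS: "normalizes S ((H \<inter> L) <#> K)"
  shows "(H \<inter> L) <#> K = K \<or> (H \<inter> L) <#> K = L"
proof -
  have L: "L \<lhd> G" "K \<lhd> G" "K \<subseteq> L" using LK by (auto simp: chief_factor_def)
  note Ls = normalD_subgroup[OF L(1)] and Ks = normalD_subgroup[OF L(2)]
  let ?A = "(H \<inter> L) <#> K" and ?Y = "{g \<in> carrier G. \<forall>x\<in>(H \<inter> L) <#> K. cj g x \<in> (H \<inter> L) <#> K}"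
  have HL: "subgroup (H \<inter> L) G" using subgroup_Int_subgroup[OF H Ls] .
  have A: "subgroup ?A G" by (rule subgroup_set_mult_normal[OF HL L(2)])
  have sub: "K \<subseteq> ?A" "?A \<subseteq> L"
    using set_mult_subset_right[OF HL subgroup.subset[OF Ks]] set_mult_subset[OF Ls] L by auto
  obtain m where m: "card (carrier G) = p ^ m * card ?Y"
    using T LK LP LT HT ne unfolding controlled_supplement_def by blast
  have Y: "subgroup ?Y G" by (rule normalizer_subgroup[OF subgroup.subset[OF A]])
  have "?Y = carrier G"
    by (rule sylow_prime_power_index[OF p S Y _ m]) (use nS subgroup.subset[OF S(1)] in auto)
  then have "?A \<lhd> G" unfolding normal_iff_cj using A by blast
  then show ?thesis using LK sub unfolding chief_factor_def by blast
qed

text \<open>An element of \<open>G\<close> is a product of elements of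
  \<open>H \<subseteq> P\<close> and of \<open>T\<close>, so these two invariances suffice. It makes
  \<open>T \<inter> P\<close> and the like normal although \<open>T\<close> need not be.\<close>

lemma supplement_normalI:
  assumes T: "subgroup T G" "H <#> T = carrier G" and P: "P \<subseteq> carrier G" "H \<subseteq> P"
    and W: "subgroup W G" "normalizes T W" "normalizes P W"
  shows "W \<lhd> G"
  unfolding normal_iff_cj
proof (intro conjI ballI)
  fix g x assume "g \<in> carrier G" and x: "x \<in> W"
  then obtain h t where ht: "h \<in> H" "t \<in> T" "g = h \<otimes> t" unfolding T(2)[symmetric] mem_set_mult by blast
  have "cj g x = cj h (cj t x)"
    using ht x P T(1) W(1) by (auto simp: cj_cj subgroup.mem_carrier)
  then show "cj g x \<in> W" using ht x W P by auto
qed (rule W(1))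

lemma supplement_whole:
  assumes "subgroup T G" "H <#> T = carrier G" "H \<subseteq> T"
  shows "T = carrier G"
  using set_mult_subset[OF assms(1,3) order_refl] assms subgroup.subset by blast

lemma p_series_of_controlled_elements:
  fixes p :: nat
  assumes p: "Factorial_Ring.prime p"
  shows "P \<lhd> G \<Longrightarrow> card P = p ^ m \<Longrightarrow>
    (\<And>x. x \<in> P \<Longrightarrow> x \<noteq> \<one> \<Longrightarrow> x [^] p = \<one> \<Longrightarrow> controlled G p P (generate G {x})) \<Longrightarrow>
    (\<And>x. p = 2 \<Longrightarrow> \<not> quaternion_free 2 (G\<lparr>carrier := P\<rparr>) \<Longrightarrow> x \<in> P \<Longrightarrow> x \<otimes> x \<noteq> \<one> \<Longrightarrow>
      x [^] (4::nat) = \<one> \<Longrightarrow> controlled G p P (generate G {x})) \<Longrightarrow>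
    p_series G p {\<one>} P"
proof (induction "card P" arbitrary: P m rule: less_induct)
  case less
  note Pn = less.prems(1) and cP = less.prems(2) and order_p = less.prems(3) and order_4 = less.prems(4)
  note Ps = normalD_subgroup[OF Pn] and Pc = normal_carrierD[OF Pn]
  show ?case
  proof (rule ccontr)
    assume nser: "\<not> p_series G p {\<one>} P"
    have ser: "p_series G p {\<one>} Y" if Y: "Y \<lhd> G" "Y \<subset> P" for Y
    proof -
      note Ys = normalD_subgroup[OF Y(1)]
      have "card Y dvd p ^ m" using card_subgroup_dvd[OF Ys Ps] Y cP by auto
      then obtain y where y: "card Y = p ^ y" using divides_primepow_nat[OF p] by blast
      show ?thesis
      proof (rule less.hyps[OF card_psubset_subgroup[OF Ps Y(2)] Y(1) y])
        show "controlled G p Y (generate G {x})" if "x \<in> Y" "x \<noteq> \<one>" "x [^] p = \<one>" for x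
          using order_p[of x] that Y(2) controlled_mono by blast
        show "controlled G p Y (generate G {x})"
          if "p = 2" "\<not> quaternion_free 2 (G\<lparr>carrier := Y\<rparr>)" "x \<in> Y" "x \<otimes> x \<noteq> \<one>" "x [^] (4::nat) = \<one>" for x
          using order_4[of x] that Y(2) controlled_mono quaternion_free_subgroup[OF group_axioms Ys Ps] by blast
      qed
    qed
    have P1: "P \<noteq> {\<one>}" using nser p_series.refl[OF one_is_normal] by auto
    let ?P = "\<lambda>M. M \<lhd> G \<and> M \<subset> P"
    have "?P {\<one>}" using P1 one_is_normal subgroup.one_closed[OF Ps] by blast
    moreover have "\<forall>M. ?P M \<longrightarrow> card M < Suc (card P)"
      using card_psubset_subgroup[OF Ps] less_SucI by blast
    ultimately have "\<exists>M. ?P M \<and> (\<forall>M'. ?P M' \<longrightarrow> card M' \<le> card M)" by (rule ex_has_greatest_nat)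
    then obtain M where M': "?P M \<and> (\<forall>M'. ?P M' \<longrightarrow> card M' \<le> card M)" ..
    then have M: "M \<lhd> G" "M \<subset> P" and Mmax: "\<And>M'. ?P M' \<Longrightarrow> card M' \<le> card M" by blast+
    note Ms = normalD_subgroup[OF M(1)] and Mc = normal_carrierD[OF M(1)]
    have serM: "p_series G p {\<one>} M" by (rule ser[OF M])
    have ch: "chief_factor G P M" unfolding chief_factor_def
    proof (intro conjI allI impI)
      fix N assume N: "N \<lhd> G \<and> M \<subseteq> N \<and> N \<subseteq> P"
      show "N = M \<or> N = P"
      proof (cases "N = P")
        case False
        then have "card N \<le> card M" using Mmax[of N] N by blast
        then show ?thesis using subgroup_eqI[OF Ms] N normalD_subgroup by blast
      qed simp
    qed (use Pn M in auto)
    \<comment> \<open>If \<open>Y\<close> is not in \<open>M\<close>, then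
      \<open>M <#> Y = P\<close>. Multiplied by \<open>Y\<close>, the series of \<open>M\<close>
      leads from \<open>Y\<close> to \<open>P\<close>, and together with the series of
      \<open>Y\<close> it would be one for \<open>P\<close>.\<close>
    have maxM: "Y \<subseteq> M" if Y: "Y \<lhd> G" "Y \<subset> P" for Y
    proof (rule ccontr)
      assume nY: "\<not> Y \<subseteq> M"
      note Ys = normalD_subgroup[OF Y(1)]
      have n: "M <#> Y \<lhd> G" by (rule normal_set_mult[OF M(1) Y(1)])
      have s: "M \<subseteq> M <#> Y" "Y \<subseteq> M <#> Y" "M <#> Y \<subseteq> P"
        using set_mult_subset_left[OF Ys subgroup.subset[OF Ms]] set_mult_subset_right[OF Ms subgroup.subset[OF Ys]]
          set_mult_subset[OF Ps, of M Y] M Y by auto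
      then have "M <#> Y = P" using ch n nY unfolding chief_factor_def by blast
      moreover have "{\<one>} \<subseteq> Y" using subgroup.one_closed[OF Ys] by simp
      ultimately have "p_series G p Y P" using p_series_mult[OF p serM Y(1)] by simp
      then show False using p_series_trans ser[OF Y] nser by blast
    qed
    have ne: "card P \<noteq> p * card M" using nser p_series.step[OF serM Pn] M by blast
    have "card M dvd p ^ m" using card_subgroup_dvd[OF Ms Ps] M cP by auto
    then obtain k where k: "card M = p ^ k" using divides_primepow_nat[OF p] by blast
    have "card M < card P" by (rule card_psubset_subgroup[OF Ps M(2)])
    then have km: "k < m" using k cP prime_power_less_iff[OF p] by simp
    obtain Q where Q: "Q \<subseteq> carrier G" "normalizes (carrier G) Q" "\<And>q x. q \<in> Q \<Longrightarrow> x \<in> M \<Longrightarrow> cmt q x \<in> {\<one>}"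
      "\<exists>q\<in>Q. \<exists>x\<in>P. cmt q x \<notin> M"
      using exists_centralizing_set[OF p serM k ch cP ne] by blast
    interpret I: irreducible_top G p m P M Q
      by (intro irreducible_top.intro irreducible_top_axioms.intro fin_group_axioms p Pn cP ch maxM Q(1,2))
        (use Q(3,4) in auto)
    obtain S where S: "subgroup S G" "card S = p ^ multiplicity p (card (carrier G))"
      using sylow_exists[OF p] by blast
    have Sc: "s \<in> carrier G" if "s \<in> S" for s using that S subgroup.mem_carrier by fastforce
    have "normalizes S M" "normalizes S P" using normalD_cj M(1) Pn Sc by blast+
    moreover have "p * card M dvd card P" using k cP km prime_power_dvd_iff[OF p, of "Suc k" m] by simp
    ultimately obtain x where x: "x \<in> P" "x \<notin> M" "\<forall>s\<in>S. cmt s x \<in> M"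
      using fixed_coset[OF p S Ms Ps] M by blast
    have xc: "x \<in> carrier G" using x Pc by blast
    have x1: "x \<noteq> \<one>" using x subgroup.one_closed[OF Ms] by blast
    have xp: "x [^] p \<in> M" by (rule I.power_in_M[OF x(1)])
    let ?H = "generate G {x}"
    have gen: "?H = range (\<lambda>n::nat. x [^] n)" using generate_singleton_finite xc by simp
    have H: "subgroup ?H G" using xc by (simp add: generate_is_subgroup)
    have HP: "?H \<subseteq> P" using gen nat_pow_mem[OF Ps x(1)] by auto
    \<comment> \<open>The exponent bounds place \<open>x\<close> under one of the two assumptions:
      order \<open>p\<close>, or order 4 when \<open>P\<close> is not quaternion-free.\<close>
    have "controlled G p P ?H"
    proof (cases "x [^] p = \<one>")
      case True
      then show ?thesis using order_p x x1 by blast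
    next
      case False
      then have p2: "p = 2" using I.exponent_odd x(1) prime_odd_nat[OF p] prime_ge_2_nat[OF p] by fastforce
      then have "\<not> quaternion_free 2 (G\<lparr>carrier := P\<rparr>)" using False I.exponent_quaternion_free x(1) by blast
      moreover have "x \<otimes> x \<noteq> \<one>" using False p2 pow_two[OF xc] by simp
      ultimately show ?thesis using order_4 p2 x(1) I.exponent_two by blast
    qed
    then obtain T where T: "controlled_supplement G p P ?H T" by (auto simp: controlled_def)
    then have T': "subgroup T G" "?H <#> T = carrier G" by (auto simp: controlled_supplement_def)
    have ext: "subgroup (?H <#> M) G" "card (?H <#> M) = p * card M"
      using prime_extension[OF p Ms xc x(2) xp] normalD_cj[OF M(1) xc] by auto
    have HM: "?H \<subseteq> ?H <#> M" "M \<subseteq> ?H <#> M" "?H <#> M \<subseteq> P"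
      using set_mult_subset_left[OF Ms subgroup.subset[OF H]] set_mult_subset_right[OF H subgroup.subset[OF Ms]]
        set_mult_subset[OF Ps HP, of M] M by auto
    have HMP: "?H <#> M \<noteq> P" using ext ne by auto
    \<comment> \<open>The next aim is \<open>T = carrier G\<close>. \<open>?X <#> M\<close> is
      normal and not \<open>M\<close>, for otherwise \<open>?H <#> M\<close> would be
      \<open>P\<close>; so it is \<open>P\<close>. Then \<open>?X\<close> is normalized by
      \<open>P\<close>, because \<open>M\<close> is central, and it is not inside the largest proper
      normal subgroup \<open>M\<close>.\<close>
    let ?X = "T \<inter> P"
    have X: "subgroup ?X G" using subgroup_Int_subgroup[OF T'(1) Ps] .
    have TX: "normalizes T ?X"
      using subgroup_cj[OF T'(1)] normalD_cj[OF Pn] subgroup.mem_carrier[OF T'(1)] by auto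
    have P_eq: "?H <#> ?X = P"
      using set_mult_Int_eq[OF T'(1) Ps HP] T'(2) subgroup.subset[OF Ps] by auto
    have XM: "subgroup (?X <#> M) G" by (rule subgroup_set_mult_normal[OF X M(1)])
    have XMs: "?X \<subseteq> ?X <#> M" "M \<subseteq> ?X <#> M" "?X <#> M \<subseteq> P"
      using set_mult_subset_left[OF Ms subgroup.subset[OF X]] set_mult_subset_right[OF X subgroup.subset[OF Ms]]
        set_mult_subset[OF Ps, of ?X M] M by auto
    have "?X <#> M \<lhd> G"
    proof (rule supplement_normalI[OF T' subgroup.subset[OF Ps] HP XM])
      show "normalizes T (?X <#> M)"
      proof (intro ballI)
        fix t y assume t: "t \<in> T" and "y \<in> ?X <#> M"
        then obtain a b where ab: "a \<in> ?X" "b \<in> M" "y = a \<otimes> b" by (auto simp: mem_set_mult)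
        have tc: "t \<in> carrier G" using t T'(1) subgroup.mem_carrier by fastforce
        have "cj t y = cj t a \<otimes> cj t b" using ab tc Pc Mc by (simp add: cj_mult)
        then show "cj t y \<in> ?X <#> M" using TX t ab normalD_cj[OF M(1) tc] by (simp add: set_multI)
      qed
      show "normalizes P (?X <#> M)"
      proof (intro ballI)
        fix y z assume y: "y \<in> P" and z: "z \<in> ?X <#> M"
        then have zP: "z \<in> P" using XMs by blast
        have "cj y z = cmt y z \<otimes> z" using cj_eq_cmt y zP Pc by blast
        moreover have "cmt y z \<in> ?X <#> M" using I.cmt_in_M[OF y zP] XMs by blast
        ultimately show "cj y z \<in> ?X <#> M" using subgroup.m_closed[OF XM, of "cmt y z" z] z by metis
      qed
    qed
    then have "?X <#> M = M \<or> ?X <#> M = P" using ch XMs unfolding chief_factor_def by blast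
    moreover have "?X <#> M \<noteq> M"
    proof
      assume "?X <#> M = M"
      then have "?X \<subseteq> M" using XMs by blast
      then have "P \<subseteq> ?H <#> M" using P_eq mono_set_mult[of ?H ?H ?X M] by blast
      then show False using HMP HM by blast
    qed
    ultimately have XMP: "?X <#> M = P" by blast
    have "?X \<lhd> G"
    proof (rule supplement_normalI[OF T' subgroup.subset[OF Ps] HP X TX])
      show "normalizes P ?X"
      proof (intro ballI)
        fix y z assume y: "y \<in> P" and z: "z \<in> ?X"
        obtain a b where ab: "a \<in> ?X" "b \<in> M" "y = a \<otimes> b" using y XMP by (metis mem_set_mult)
        have "cj y z = cj a (cj b z)" using ab z Pc Mc by (simp add: cj_cj)
        also have "cj b z = z" using I.M_central[of z b] ab z cmt_eq_one_iff(2)[of b z] Pc Mc by auto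
        finally show "cj y z \<in> ?X" using subgroup_cj[OF X] ab z by simp
      qed
    qed
    moreover have "\<not> ?X \<subseteq> M"
    proof
      assume "?X \<subseteq> M"
      then have "?X <#> M \<subseteq> M" using set_mult_subset[OF Ms] by blast
      then show False using XMP M by blast
    qed
    ultimately have "?X = P" using maxM[of ?X] by blast
    then have TG: "T = carrier G" using supplement_whole[OF T'] HP by blast
    have "(?H \<inter> P) <#> M = M \<or> (?H \<inter> P) <#> M = P"
    proof (rule controlled_supplement_key[OF p T H ch order_refl _ _ ne S])
      show "P \<subseteq> T <#> M" using set_mult_subset_left[OF Ms, of T] TG Pc by auto
      show "?H \<inter> P \<subseteq> (?H \<inter> T) <#> M" using HM TG subgroup.subset[OF H] by (metis Int_absorb2 inf.coboundedI1)
      have HPe: "?H \<inter> P = ?H" using HP by blast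
      show "normalizes S ((?H \<inter> P) <#> M)" unfolding HPe
      proof (intro ballI)
        fix s y assume s: "s \<in> S" and "y \<in> ?H <#> M"
        then obtain n :: nat and b where b: "b \<in> M" "y = x [^] n \<otimes> b" unfolding gen mem_set_mult by blast
        have sc: "s \<in> carrier G" using s Sc by blast
        have "cj s x = cmt s x \<otimes> x" using cj_eq_cmt sc xc by blast
        moreover have "cmt s x \<in> ?H <#> M" "x \<in> ?H <#> M" using x(3) s HM generate.incl[of x "{x}" G] by auto
        ultimately have "cj s x \<in> ?H <#> M" using subgroup.m_closed[OF ext(1), of "cmt s x" x] by metis
        then have "cj s (x [^] n) \<in> ?H <#> M" using nat_pow_mem[OF ext(1)] sc xc by (simp add: cj_pow)
        moreover have "cj s b \<in> ?H <#> M" using normalD_cj[OF M(1) sc b(1)] HM by blast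
        moreover have "cj s y = cj s (x [^] n) \<otimes> cj s b" using b sc xc Mc by (simp add: cj_mult)
        ultimately show "cj s y \<in> ?H <#> M" using subgroup.m_closed[OF ext(1)] by simp
      qed
    qed
    moreover have "?H \<inter> P = ?H" using HP by blast
    moreover have "x \<in> ?H <#> M" using HM generate.incl[of x "{x}" G] by blast
    ultimately show False using HMP x by auto
  qed
qed

end

section \<open>Passing to quotient groups\<close>

lemma (in group) mult_inv_cancel:
  assumes "a \<in> carrier G" "b \<in> carrier G"
  shows "a \<otimes> (inv a \<otimes> b) = b" "inv a \<otimes> (a \<otimes> b) = b"
  using assms by (simp_all add: m_assoc[symmetric])

locale fin_group_epi = G: fin_group G + G': fin_group G'
  for G :: "('a, 'b) monoid_scheme" (structure) and G' :: "('c, 'd) monoid_scheme" +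
  fixes f :: "'a \<Rightarrow> 'c" and N :: "'a set"
  assumes hom: "f \<in> hom G G'" and surj: "f ` carrier G = carrier G'"
    and ker: "{x \<in> carrier G. f x = \<one>\<^bsub>G'\<^esub>} = N"
begin

sublocale group_hom G G' f
  by (intro group_hom.intro group_hom_axioms.intro G.group_axioms G'.group_axioms hom)

definition pre :: "'c set \<Rightarrow> 'a set"
  where "pre A = {x \<in> carrier G. f x \<in> A}"

lemma pre_carrier: "pre A \<subseteq> carrier G"
  by (auto simp: pre_def)


lemma N_iff: "x \<in> N \<longleftrightarrow> x \<in> carrier G \<and> f x = \<one>\<^bsub>G'\<^esub>"
  using ker by blast

lemma surjD: "y \<in> carrier G' \<Longrightarrow> \<exists>x\<in>carrier G. f x = y"
  by (metis surj imageE)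

lemma image_pre:
  assumes "A \<subseteq> carrier G'"
  shows "f ` pre A = A"
proof
  show "A \<subseteq> f ` pre A"
  proof
    fix y assume y: "y \<in> A"
    then obtain x where "x \<in> carrier G" "f x = y" using surjD[of y] assms by blast
    then show "y \<in> f ` pre A" using y by (auto simp: pre_def)
  qed
qed (auto simp: pre_def)

lemma N_normal: "N \<lhd> G"
  using normal_kernel unfolding kernel_def ker .

lemma pre_one: "pre {\<one>\<^bsub>G'\<^esub>} = N"
  by (auto simp: pre_def N_iff)

lemma N_subset_pre: "\<one>\<^bsub>G'\<^esub> \<in> A \<Longrightarrow> N \<subseteq> pre A"
  by (auto simp: pre_def N_iff)

lemma f_eq_iff: "x \<in> carrier G \<Longrightarrow> y \<in> carrier G \<Longrightarrow> f x = f y \<longleftrightarrow> inv x \<otimes> y \<in> N"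
  by (auto simp: N_iff G'.inv_solve_left' G'.inv_equality)

lemma pre_image:
  assumes "subgroup A G" "N \<subseteq> A"
  shows "pre (f ` A) = A"
proof
  show "pre (f ` A) \<subseteq> A"
  proof
    fix x assume "x \<in> pre (f ` A)"
    then obtain a where a: "x \<in> carrier G" "a \<in> A" "f x = f a" by (auto simp: pre_def)
    have ac: "a \<in> carrier G" using a assms(1) subgroup.mem_carrier by fastforce
    have "inv a \<otimes> x \<in> A" using f_eq_iff[OF ac a(1)] a(3) assms(2) by auto
    then have "a \<otimes> (inv a \<otimes> x) \<in> A" using a(2) assms(1) by (simp add: subgroup.m_closed)
    then show "x \<in> A" using a ac by (simp add: G.mult_inv_cancel)
  qed
next
  show "A \<subseteq> pre (f ` A)" using subgroup.subset[OF assms(1)] by (auto simp: pre_def)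
qed

lemma f_conj: "g \<in> carrier G \<Longrightarrow> x \<in> carrier G \<Longrightarrow> f (conjugate G g x) = conjugate G' (f g) (f x)"
  by (simp add: conjugate_def)

lemma pre_subgroup:
  assumes "subgroup A G'"
  shows "subgroup (pre A) G"
  by (rule G.subgroupI')
    (use assms in \<open>auto simp: pre_def subgroup.one_closed subgroup.m_closed subgroup.m_inv_closed\<close>)

lemma pre_normal:
  assumes "A \<lhd> G'"
  shows "pre A \<lhd> G"
  unfolding G.normal_iff_cj
  using pre_subgroup[OF G'.normalD_subgroup[OF assms]] G'.normalD_cj[OF assms]
  by (auto simp: pre_def f_conj)

lemma image_subgroup: "subgroup A G \<Longrightarrow> subgroup (f ` A) G'"
  by (rule subgroup_img_is_subgroup)

lemma image_normal:
  assumes "A \<lhd> G"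
  shows "f ` A \<lhd> G'"
  unfolding G'.normal_iff_cj
proof (intro conjI ballI)
  show "subgroup (f ` A) G'" using image_subgroup G.normalD_subgroup[OF assms] .
  fix g x assume "g \<in> carrier G'" "x \<in> f ` A"
  then obtain h a where ha: "h \<in> carrier G" "a \<in> A" "g = f h" "x = f a" using surjD[of g] by blast
  then have "conjugate G' g x = f (conjugate G h a)" using f_conj G.normal_carrierD[OF assms] by simp
  then show "conjugate G' g x \<in> f ` A" using ha G.normalD_cj[OF assms] by blast
qed

lemma card_pre:
  assumes "A \<subseteq> carrier G'"
  shows "card (pre A) = card A * card N"
proof -
  have finA: "finite A" using assms finite_subset G'.fin by blast
  have fib: "card {x \<in> pre A. f x = y} = card N" if y: "y \<in> A" for y
  proof -
    obtain a where a: "a \<in> carrier G" "f a = y" using surjD[of y] y assms by blast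
    have "bij_betw (\<lambda>n. a \<otimes> n) N {x \<in> pre A. f x = y}"
    proof (rule bij_betw_byWitness[where f' = "\<lambda>x. inv a \<otimes> x"])
      show "\<forall>n\<in>N. inv a \<otimes> (a \<otimes> n) = n" using a by (simp add: N_iff G.mult_inv_cancel)
      show "\<forall>x\<in>{x \<in> pre A. f x = y}. a \<otimes> (inv a \<otimes> x) = x" using a by (simp add: pre_def G.mult_inv_cancel)
      show "(\<lambda>n. a \<otimes> n) ` N \<subseteq> {x \<in> pre A. f x = y}" using a y assms by (auto simp: pre_def N_iff)
      show "(\<lambda>x. inv a \<otimes> x) ` {x \<in> pre A. f x = y} \<subseteq> N" using a by (auto simp: pre_def f_eq_iff[OF a(1), symmetric])
    qed
    then show ?thesis by (simp add: bij_betw_same_card)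
  qed
  have "card (pre A) = (\<Sum>y\<in>f ` pre A. card {x \<in> pre A. f x = y})"
    using sum.image_gen[of "pre A" "\<lambda>_. 1::nat" f] finite_subset[OF pre_carrier G.fin] by simp
  then show ?thesis using fib image_pre[OF assms] by simp
qed

lemma card_N_pos: "card N > 0"
  using G.card_subgroup_pos[OF G.normalD_subgroup[OF N_normal]] .

lemma pre_mono: "A \<subseteq> B \<Longrightarrow> pre A \<subseteq> pre B"
  by (auto simp: pre_def)

lemma pre_chief:
  assumes "chief_factor G' L K"
  shows "chief_factor G (pre L) (pre K)"
proof -
  have L: "L \<lhd> G'" "K \<lhd> G'" "K \<subset> L" using assms by (auto simp: chief_factor_def)
  note Lc = subgroup.subset[OF G'.normalD_subgroup[OF L(1)]] and Kc = subgroup.subset[OF G'.normalD_subgroup[OF L(2)]]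
  have K1: "\<one>\<^bsub>G'\<^esub> \<in> K" using G'.normalD_subgroup[OF L(2)] by (rule subgroup.one_closed)
  have "pre K \<noteq> pre L" using image_pre[OF Lc] image_pre[OF Kc] L(3) by auto
  moreover have "pre K \<subseteq> pre L" using L(3) by (intro pre_mono) auto
  moreover have "M = pre K \<or> M = pre L" if M: "M \<lhd> G" "pre K \<subseteq> M" "M \<subseteq> pre L" for M
  proof -
    have "N \<subseteq> M" using N_subset_pre[OF K1] M by blast
    then have e: "pre (f ` M) = M" using pre_image[OF G.normalD_subgroup[OF M(1)]] by blast
    have "f ` pre K \<subseteq> f ` M" "f ` M \<subseteq> f ` pre L" using M by blast+
    then have "K \<subseteq> f ` M" "f ` M \<subseteq> L" using image_pre[OF Lc] image_pre[OF Kc] by auto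
    then have "f ` M = K \<or> f ` M = L" using assms image_normal[OF M(1)] unfolding chief_factor_def by blast
    then show ?thesis using e by auto
  qed
  ultimately show ?thesis using pre_normal L unfolding chief_factor_def by blast
qed

lemma mem_pre_mult:
  assumes A: "A \<subseteq> carrier G'" and K: "K \<lhd> G'" and x: "x \<in> carrier G"
  shows "f x \<in> A <#>\<^bsub>G'\<^esub> K \<longleftrightarrow> x \<in> pre A <#> pre K"
proof
  assume "f x \<in> A <#>\<^bsub>G'\<^esub> K"
  then obtain a k where ak: "a \<in> A" "k \<in> K" "f x = a \<otimes>\<^bsub>G'\<^esub> k" by (auto simp: G'.mem_set_mult)
  have ac: "a \<in> carrier G'" using ak A by blast
  obtain b where b: "b \<in> carrier G" "f b = a" using surjD[of a] ak A by blast
  have "f (inv b \<otimes> x) = k" using ak ac b x G'.normal_carrierD[OF K ak(2)] by (simp add: G'.mult_inv_cancel)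
  then have "inv b \<otimes> x \<in> pre K" using ak b x by (auto simp: pre_def)
  moreover have "b \<in> pre A" using b ak by (simp add: pre_def)
  moreover have "x = b \<otimes> (inv b \<otimes> x)" using b x by (simp add: G.mult_inv_cancel)
  ultimately show "x \<in> pre A <#> pre K" using G.mem_set_mult by blast
next
  assume "x \<in> pre A <#> pre K"
  then obtain a k where "a \<in> pre A" "k \<in> pre K" "x = a \<otimes> k" using G.mem_set_mult by blast
  then show "f x \<in> A <#>\<^bsub>G'\<^esub> K" by (simp add: pre_def G'.set_multI)
qed

lemma pre_normalizer:
  assumes A: "A \<subseteq> carrier G'"
  shows "{g \<in> carrier G. \<forall>x\<in>pre A. conjugate G g x \<in> pre A} =
    pre {g \<in> carrier G'. \<forall>x\<in>A. conjugate G' g x \<in> A}" (is "?L = pre ?Y")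
proof (intro equalityI subsetI)
  fix g assume g: "g \<in> ?L"
  have "conjugate G' (f g) y \<in> A" if y: "y \<in> A" for y
  proof -
    obtain x where x: "x \<in> carrier G" "y = f x" using surjD[of y] y A by blast
    then have "conjugate G g x \<in> pre A" using g y by (simp add: pre_def)
    then show ?thesis using f_conj g x by (simp add: pre_def)
  qed
  then show "g \<in> pre ?Y" using g by (simp add: pre_def)
next
  fix g assume g: "g \<in> pre ?Y"
  then show "g \<in> ?L" using f_conj by (auto simp: pre_def)
qed

lemma card_carrier_epi: "card (carrier G) = card (carrier G') * card N"
proof -
  have "carrier G = pre (carrier G')" by (auto simp: pre_def)
  then show ?thesis using card_pre[of "carrier G'"] by simp
qed

lemma p_series_pre:
  assumes "p_series G' p {\<one>\<^bsub>G'\<^esub>} M"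
  shows "p_series G p N (pre M)"
  using assms
proof (induction rule: p_series.induct)
  case refl
  then show ?case using N_normal pre_one by (simp add: p_series.refl)
next
  case (step K L)
  have "card (pre L) = p * card (pre K)"
    using card_pre[of L] card_pre[of K] step.hyps G'.normal_carrierD p_series_normal(2)[OF step.hyps(1)]
    by (metis mult.assoc subsetI)
  then show ?case using step pre_normal pre_mono p_series.step by metis
qed

text \<open>The image of a supplement \<open>T\<close> of \<open>pre H\<close> serves for
  \<open>H\<close>. Chief factors, the covering conditions and normalizers in \<open>G'\<close>
  correspond to their preimages, and the orders involved change by the common factor
  \<open>card N\<close>.\<close>

lemma controlled_quotient:
  assumes p: "Factorial_Ring.prime p" and P: "P \<lhd> G" "N \<subseteq> P" and H: "subgroup H G'" "H \<subseteq> f ` P"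
    and c: "controlled G p P (pre H)"
  shows "controlled G' p (f ` P) H"
proof -
  obtain T where T: "subgroup T G" "pre H <#> T = carrier G"
    and Tc: "\<And>L K. chief_factor G L K \<Longrightarrow> L \<subseteq> P \<Longrightarrow> L \<subseteq> T <#> K \<Longrightarrow> pre H \<inter> L \<subseteq> (pre H \<inter> T) <#> K \<Longrightarrow>
      card L = p * card K \<or> (\<exists>m. card (carrier G) = p ^ m * card {g \<in> carrier G. \<forall>x\<in>(pre H \<inter> L) <#> K.
        conjugate G g x \<in> (pre H \<inter> L) <#> K})"
    using c unfolding controlled_def controlled_supplement_def by blast
  note Ts = subgroup.subset[OF T(1)] and Hc = subgroup.subset[OF H(1)]
  have "H <#>\<^bsub>G'\<^esub> (f ` T) = carrier G'"
  proof
    show "H <#>\<^bsub>G'\<^esub> (f ` T) \<subseteq> carrier G'"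
      using G'.setmult_subset_G[OF Hc subgroup.subset[OF image_subgroup[OF T(1)]]] .
    show "carrier G' \<subseteq> H <#>\<^bsub>G'\<^esub> (f ` T)"
    proof
      fix y assume "y \<in> carrier G'"
      then obtain x where x: "x \<in> carrier G" "y = f x" using surjD[of y] by blast
      have "x \<in> pre H <#> T" using T(2) x(1) by simp
      then obtain h t where ht: "h \<in> pre H" "t \<in> T" "x = h \<otimes> t" unfolding G.mem_set_mult by blast
      have "t \<in> carrier G" using ht(2) Ts by blast
      then have "y = f h \<otimes>\<^bsub>G'\<^esub> f t" using x ht by (simp add: pre_def)
      then show "y \<in> H <#>\<^bsub>G'\<^esub> (f ` T)" using ht by (simp add: pre_def G'.set_multI)
    qed
  qed
  moreover have "card L = p * card K \<or> (\<exists>m. card (carrier G') = p ^ m * card {g \<in> carrier G'.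
      \<forall>x\<in>(H \<inter> L) <#>\<^bsub>G'\<^esub> K. conjugate G' g x \<in> (H \<inter> L) <#>\<^bsub>G'\<^esub> K})"
    if ch: "chief_factor G' L K" and LP: "L \<subseteq> f ` P" and LT: "L \<subseteq> (f ` T) <#>\<^bsub>G'\<^esub> K"
      and HL: "H \<inter> L \<subseteq> (H \<inter> f ` T) <#>\<^bsub>G'\<^esub> K" for L K
  proof -
    have L: "L \<lhd> G'" "K \<lhd> G'" "K \<subset> L" using ch by (auto simp: chief_factor_def)
    have K1: "\<one>\<^bsub>G'\<^esub> \<in> K" using G'.normalD_subgroup[OF L(2)] by (rule subgroup.one_closed)
    have pK: "f k \<in> K" "k \<in> carrier G" if "k \<in> pre K" for k using that by (auto simp: pre_def)
    have lift: "x \<in> B <#> pre K" if x: "x \<in> carrier G" "f x \<in> (f ` B) <#>\<^bsub>G'\<^esub> K" and B: "B \<subseteq> carrier G" for x B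
    proof -
      obtain b k where bk: "b \<in> B" "k \<in> K" "f x = f b \<otimes>\<^bsub>G'\<^esub> k" using x(2) by (auto simp: G'.mem_set_mult)
      have bc: "b \<in> carrier G" using bk B by blast
      have "f (inv b \<otimes> x) = k" using bk bc x G'.normal_carrierD[OF L(2) bk(2)] by (simp add: G'.mult_inv_cancel)
      then have "inv b \<otimes> x \<in> pre K" using bk bc x by (auto simp: pre_def)
      moreover have "x = b \<otimes> (inv b \<otimes> x)" using bc x by (simp add: G.mult_inv_cancel)
      ultimately show ?thesis using bk(1) G.mem_set_mult by blast
    qed
    \<comment> \<open>Here it counts that \<open>pre H\<close> is the full preimage: an element of
      \<open>T\<close> whose image is in \<open>H\<close> lies in \<open>pre H\<close>.\<close>
    have Hf: "H \<inter> f ` T \<subseteq> f ` (pre H \<inter> T)" using Ts by (auto simp: pre_def)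
    have 1: "chief_factor G (pre L) (pre K)" by (rule pre_chief[OF ch])
    have 2: "pre L \<subseteq> P" using pre_mono[OF LP] pre_image[OF G.normalD_subgroup[OF P(1)] P(2)] by simp
    have 3: "pre L \<subseteq> T <#> pre K" using lift[of _ T] LT Ts by (auto simp: pre_def)
    have 4: "pre H \<inter> pre L \<subseteq> (pre H \<inter> T) <#> pre K"
    proof
      fix x assume x: "x \<in> pre H \<inter> pre L"
      then have "f x \<in> (H \<inter> f ` T) <#>\<^bsub>G'\<^esub> K" "x \<in> carrier G" using HL by (auto simp: pre_def)
      moreover have "(H \<inter> f ` T) <#>\<^bsub>G'\<^esub> K \<subseteq> (f ` (pre H \<inter> T)) <#>\<^bsub>G'\<^esub> K" by (rule mono_set_mult[OF Hf order_refl])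
      ultimately show "x \<in> (pre H \<inter> T) <#> pre K" using lift[of x "pre H \<inter> T"] Ts by auto
    qed
    let ?A = "(H \<inter> L) <#>\<^bsub>G'\<^esub> K"
    have A: "?A \<subseteq> carrier G'"
      using G'.setmult_subset_G[of "H \<inter> L" K] Hc subgroup.subset[OF G'.normalD_subgroup[OF L(2)]] by auto
    have preA: "(pre H \<inter> pre L) <#> pre K = pre ?A"
    proof -
      have e: "pre H \<inter> pre L = pre (H \<inter> L)" by (auto simp: pre_def)
      have memb: "x \<in> pre (H \<inter> L) <#> pre K \<longleftrightarrow> x \<in> pre ?A" for x
      proof (cases "x \<in> carrier G")
        case True
        have "H \<inter> L \<subseteq> carrier G'" using Hc by blast
        then show ?thesis using mem_pre_mult[OF _ L(2) True] True by (simp add: pre_def)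
      next
        case False
        then show ?thesis using G.setmult_subset_G[OF pre_carrier pre_carrier] pre_carrier by blast
      qed
      show ?thesis unfolding e by (rule Set.set_eqI) (rule memb)
    qed
    from Tc[OF 1 2 3 4] show ?thesis
    proof
      assume "card (pre L) = p * card (pre K)"
      then have "card L * card N = p * card K * card N"
        using card_pre[OF subgroup.subset[OF G'.normalD_subgroup[OF L(1)]]]
          card_pre[OF subgroup.subset[OF G'.normalD_subgroup[OF L(2)]]] by (simp only: mult.assoc)
      then show ?thesis using card_N_pos by simp
    next
      assume "\<exists>m. card (carrier G) = p ^ m * card {g \<in> carrier G. \<forall>x\<in>(pre H \<inter> pre L) <#> pre K.
        conjugate G g x \<in> (pre H \<inter> pre L) <#> pre K}"
      then obtain m where m: "card (carrier G) = p ^ m * card {g \<in> carrier G. \<forall>x\<in>pre ?A. conjugate G g x \<in> pre ?A}"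
        unfolding preA by blast
      let ?Y = "{g \<in> carrier G'. \<forall>x\<in>?A. conjugate G' g x \<in> ?A}"
      note e1 = pre_normalizer[OF A]
      have e2: "card (pre ?Y) = card ?Y * card N" by (rule card_pre) auto
      note e3 = card_carrier_epi
      have "card (carrier G') * card N = p ^ m * card ?Y * card N" using m unfolding e1 e2 e3 by (simp only: mult.assoc)
      then have "card (carrier G') = p ^ m * card ?Y" using card_N_pos by simp
      then show ?thesis by blast
    qed
  qed
  ultimately show ?thesis
    using image_subgroup[OF T(1)] unfolding controlled_def controlled_supplement_def by blast
qed

end

text \<open>A quotient of \<open>G\<close> realised on coset representatives, so that its elements have the same type
  as those of \<open>G\<close> and one can induct on the group order.\<close>

lemma (in fin_group) exists_quotient:
  assumes N: "N \<lhd> G"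
  shows "\<exists>(G' :: 'a monoid) f. fin_group_epi G G' f N"
proof -
  note Ns = normalD_subgroup[OF N]
  \<comment> \<open>The chosen element depends on the coset only, so \<open>f\<close> is constant on
    cosets.\<close>
  define f where "f x = (SOME y. y \<in> N #> x)" for x
  have f: "f x \<in> N #> x" if "x \<in> carrier G" for x
    unfolding f_def using rcos_self[OF that Ns] by (rule someI)
  have fc: "f x \<in> carrier G" if "x \<in> carrier G" for x
    using f[OF that] r_coset_subset_G[OF subgroup.subset[OF Ns] that] by blast
  have fN: "N #> f x = N #> x" if "x \<in> carrier G" for x
    using repr_independence[OF f[OF that] that Ns] by simp
  have feq: "f x = f y \<longleftrightarrow> N #> x = N #> y" if "x \<in> carrier G" "y \<in> carrier G" for x y
    using fN that unfolding f_def by metis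
  define G' :: "'a monoid" where "G' = \<lparr>carrier = f ` carrier G, monoid.mult = (\<lambda>x y. f (x \<otimes> y)), one = f \<one>\<rparr>"
  have mult: "f (f x \<otimes> f y) = f (x \<otimes> y)" if "x \<in> carrier G" "y \<in> carrier G" for x y
    using rcoset_cong_mult[OF N fc[OF that(1)] fc[OF that(2)] that fN[OF that(1)] fN[OF that(2)]]
    by (simp add: feq that fc)
  have G': "group G'"
  proof (rule groupI)
    have E: "\<exists>a\<in>carrier G. x = f a" if "x \<in> carrier G'" for x using that unfolding G'_def by auto
    have M: "f a \<otimes>\<^bsub>G'\<^esub> f b = f (a \<otimes> b)" if "a \<in> carrier G" "b \<in> carrier G" for a b
      using mult[OF that] by (simp add: G'_def)
    have C: "f a \<in> carrier G'" if "a \<in> carrier G" for a using that by (simp add: G'_def)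
    have O: "\<one>\<^bsub>G'\<^esub> = f \<one>" by (simp add: G'_def)
    show "x \<otimes>\<^bsub>G'\<^esub> y \<in> carrier G'" if xy: "x \<in> carrier G'" "y \<in> carrier G'" for x y
    proof -
      obtain a b where "a \<in> carrier G" "b \<in> carrier G" "x = f a" "y = f b" using E xy by blast
      then show ?thesis using M C by simp
    qed
    show "\<one>\<^bsub>G'\<^esub> \<in> carrier G'" using O C by simp
    show "x \<otimes>\<^bsub>G'\<^esub> y \<otimes>\<^bsub>G'\<^esub> z = x \<otimes>\<^bsub>G'\<^esub> (y \<otimes>\<^bsub>G'\<^esub> z)"
      if xyz: "x \<in> carrier G'" "y \<in> carrier G'" "z \<in> carrier G'" for x y z
    proof -
      obtain a b c where "a \<in> carrier G" "b \<in> carrier G" "c \<in> carrier G" "x = f a" "y = f b" "z = f c"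
        using E xyz by metis
      then show ?thesis using M by (simp add: m_assoc)
    qed
    show "\<one>\<^bsub>G'\<^esub> \<otimes>\<^bsub>G'\<^esub> x = x" if x: "x \<in> carrier G'" for x
    proof -
      obtain a where "a \<in> carrier G" "x = f a" using E x by blast
      then show ?thesis using M[of \<one> a] O by simp
    qed
    show "\<exists>y\<in>carrier G'. y \<otimes>\<^bsub>G'\<^esub> x = \<one>\<^bsub>G'\<^esub>" if x: "x \<in> carrier G'" for x
    proof -
      obtain a where a: "a \<in> carrier G" "x = f a" using E x by blast
      then have "f (inv a) \<otimes>\<^bsub>G'\<^esub> x = \<one>\<^bsub>G'\<^esub>" using M[of "inv a" a] O by simp
      then show ?thesis using C[of "inv a"] a by blast
    qed
  qed
  then have fin': "fin_group G'" by (intro fin_group.intro fin_group_axioms.intro) (auto simp: G'_def)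
  have "{x \<in> carrier G. f x = \<one>\<^bsub>G'\<^esub>} = N"
    using feq[OF _ one_closed] rcoset_eq_self_iff[OF Ns] subgroup.subset[OF Ns] by (auto simp: G'_def)
  moreover have "f \<in> hom G G'" using mult by (intro homI) (auto simp: G'_def)
  moreover have "f ` carrier G = carrier G'" by (simp add: G'_def)
  ultimately have "fin_group_epi G G' f N"
    by (intro fin_group_epi.intro fin_group_epi_axioms.intro fin_group_axioms fin')
  then show ?thesis by blast
qed

section \<open>Subgroups of a fixed order greater than 1\<close>

context fin_group
begin

lemma set_mult_one: "A \<subseteq> carrier G \<Longrightarrow> A <#> {\<one>} = A"
  using r_coset_eq_set_mult[of G A \<one>] by simp

text \<open>A larger \<open>R\<close> would contain a Sylow-invariant \<open>H\<close> of order
  \<open>p ^ k\<close>. As \<open>P\<close> centralizes \<open>R\<close>, the subgroup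
  \<open>T \<inter> R\<close> is normal, and it is not trivial because
  \<open>H <#> (T \<inter> R) = R\<close>; so \<open>R \<subseteq> T\<close>, then
  \<open>T = carrier G\<close>, and \<open>controlled_supplement_key\<close> for \<open>R/1\<close>
  gives a contradiction.\<close>

lemma minimal_normal_card_le:
  fixes p :: nat
  assumes p: "Factorial_Ring.prime p" and P: "P \<lhd> G" "card P = p ^ m"
    and ch: "chief_factor G R {\<one>}" and RP: "R \<subseteq> P" and k: "1 \<le> k"
    and c: "\<And>H. subgroup H G \<Longrightarrow> H \<subset> P \<Longrightarrow> card H = p ^ k \<Longrightarrow> controlled G p P H"
  shows "card R \<le> p ^ k"
proof (rule ccontr)
  assume "\<not> card R \<le> p ^ k"
  then have lt: "p ^ k < card R" by simp
  have R: "R \<lhd> G" using ch by (simp add: chief_factor_def)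
  note Rs = normalD_subgroup[OF R] and Ps = normalD_subgroup[OF P(1)]
  note Rc = normal_carrierD[OF R] and Pc = normal_carrierD[OF P(1)]
  obtain S where S: "subgroup S G" "card S = p ^ multiplicity p (card (carrier G))"
    using sylow_exists[OF p] by blast
  have Sc: "s \<in> carrier G" if "s \<in> S" for s using that S subgroup.mem_carrier by fastforce
  have RS: "R \<subseteq> S" using normal_subset_sylow[OF p S P] RP by blast
  have n1: "normalizes S {\<one>}" "normalizes S R" using normalD_cj[OF R] Sc by auto
  have "\<exists>H. subgroup H G \<and> {\<one>} \<subseteq> H \<and> H \<subseteq> R \<and> card H = p ^ k \<and> normalizes S H"
    by (rule prime_chain[OF p S triv_subgroup _ Rs _ RS n1, of 0])
      (use lt subgroup.one_closed[OF Rs] in auto)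
  then obtain H where H: "subgroup H G" "H \<subseteq> R" "card H = p ^ k" "normalizes S H" by blast
  have HR: "H \<noteq> R" using H lt by auto
  have HP: "H \<subset> P" using H HR RP by blast
  obtain T where T: "controlled_supplement G p P H T" using c[OF H(1) HP H(3)] by (auto simp: controlled_def)
  then have T': "subgroup T G" "H <#> T = carrier G" by (auto simp: controlled_supplement_def)
  have X: "subgroup (T \<inter> R) G" by (rule subgroup_Int_subgroup[OF T'(1) Rs])
  have "T \<inter> R \<lhd> G"
  proof (rule supplement_normalI[OF T' _ _ X])
    show "P \<subseteq> carrier G" "H \<subseteq> P" using subgroup.subset[OF Ps] HP by auto
    show "normalizes T (T \<inter> R)"
      using subgroup_cj[OF T'(1)] normalD_cj[OF R] subgroup.mem_carrier[OF T'(1)] by auto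
    show "normalizes P (T \<inter> R)"
    proof (intro ballI)
      fix y x assume yx: "y \<in> P" "x \<in> T \<inter> R"
      then have "cmt y x \<in> {\<one>}" using chief_commutator[OF p P ch RP] by blast
      then have "cj y x = x" using cmt_eq_one_iff(2)[of y x] yx Pc Rc by auto
      then show "cj y x \<in> T \<inter> R" using yx by simp
    qed
  qed
  then have "T \<inter> R = {\<one>} \<or> T \<inter> R = R"
    using ch subgroup.one_closed[OF X] unfolding chief_factor_def by blast
  moreover have "T \<inter> R \<noteq> {\<one>}"
  proof
    assume e: "T \<inter> R = {\<one>}"
    have "H <#> (T \<inter> R) = R" using set_mult_Int_eq[OF T'(1) Rs H(2)] T'(2) subgroup.subset[OF Rs] by auto
    moreover have "H <#> {\<one>} = H" by (rule set_mult_one[OF subgroup.subset[OF H(1)]])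
    ultimately show False using e HR by simp
  qed
  ultimately have "R \<subseteq> T" by blast
  then have TG: "T = carrier G" using supplement_whole[OF T'] H(2) by blast
  note one = set_mult_one
  have HRe: "H \<inter> R = H" using H by blast
  have Hc: "H \<subseteq> carrier G" using subgroup.subset[OF H(1)] .
  have ne: "card R \<noteq> p * card {\<one>}"
    using lt k power_increasing[of 1 k p] prime_gt_0_nat[OF p] by auto
  have "(H \<inter> R) <#> {\<one>} = {\<one>} \<or> (H \<inter> R) <#> {\<one>} = R"
  proof (rule controlled_supplement_key[OF p T H(1) ch RP _ _ ne S])
    show "R \<subseteq> T <#> {\<one>}" using one[of T] TG subgroup.subset[OF Rs] by simp
    show "H \<inter> R \<subseteq> (H \<inter> T) <#> {\<one>}" using one[of "H \<inter> T"] TG Hc by auto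
    show "normalizes S ((H \<inter> R) <#> {\<one>})" unfolding HRe one[OF Hc] by (rule H(4))
  qed
  then have "H = {\<one>}" unfolding HRe one[OF Hc] using HR by simp
  then have "p ^ k = 1" using H(3) by simp
  then show False using k prime_gt_1_nat[OF p] by simp
qed

text \<open>The case \<open>|R| = |D|\<close>, where the order \<open>p|D|\<close> is used: a
  subgroup of order \<open>|D|\<close> cannot properly contain \<open>R\<close>, while a
  Sylow-invariant \<open>H\<close> of order \<open>p|R|\<close> above \<open>R\<close> gives a
  proper nontrivial part of \<open>P/R\<close>.\<close>

lemma chief_over_minimal_normal:
  fixes p :: nat
  assumes p: "Factorial_Ring.prime p" and P: "P \<lhd> G" "card P = p ^ m"
    and ch: "chief_factor G R {\<one>}" and PR: "chief_factor G P R" and cR: "card R = p ^ k"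
    and c: "\<And>H. subgroup H G \<Longrightarrow> H \<subset> P \<Longrightarrow> card H = p ^ Suc k \<Longrightarrow> controlled G p P H"
  shows "card P = p * card R"
proof (rule ccontr)
  assume ne: "card P \<noteq> p * card R"
  have R: "R \<lhd> G" "R \<subset> P" using PR by (auto simp: chief_factor_def)
  note Rs = normalD_subgroup[OF R(1)] and Ps = normalD_subgroup[OF P(1)]
  note Rc = normal_carrierD[OF R(1)] and Pc = normal_carrierD[OF P(1)]
  have "card R < card P" by (rule card_psubset_subgroup[OF Ps R(2)])
  then have km: "k < m" using cR P(2) prime_power_less_iff[OF p] by simp
  obtain S where S: "subgroup S G" "card S = p ^ multiplicity p (card (carrier G))"
    using sylow_exists[OF p] by blast
  have Sc: "s \<in> carrier G" if "s \<in> S" for s using that S subgroup.mem_carrier by fastforce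
  have PS: "P \<subseteq> S" using normal_subset_sylow[OF p S P] .
  have n1: "normalizes S R" "normalizes S P" using normalD_cj R(1) P(1) Sc by auto
  have "\<exists>H. subgroup H G \<and> R \<subseteq> H \<and> H \<subseteq> P \<and> card H = p ^ Suc k \<and> normalizes S H"
    by (rule prime_chain[OF p S Rs cR Ps _ PS n1])
      (use km P(2) R(2) prime_power_le_iff[OF p, of "Suc k" m] in auto)
  then obtain H where H: "subgroup H G" "R \<subseteq> H" "H \<subseteq> P" "card H = p ^ Suc k" "normalizes S H" by blast
  have HP: "H \<noteq> P" using H ne cR by auto
  have HR: "H \<noteq> R" using H(4) cR prime_power_less_iff[OF p, of k "Suc k"] by auto
  have "H \<subset> P" using H HP by blast
  then obtain T where T: "controlled_supplement G p P H T" using c[OF H(1) _ H(4)] by (auto simp: controlled_def)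
  then have T': "subgroup T G" "H <#> T = carrier G" by (auto simp: controlled_supplement_def)
  let ?X = "T \<inter> P"
  have X: "subgroup ?X G" by (rule subgroup_Int_subgroup[OF T'(1) Ps])
  have XR: "subgroup (?X <#> R) G" by (rule subgroup_set_mult_normal[OF X R(1)])
  have XRs: "?X \<subseteq> ?X <#> R" "R \<subseteq> ?X <#> R" "?X <#> R \<subseteq> P"
    using set_mult_subset_left[OF Rs subgroup.subset[OF X]] set_mult_subset_right[OF X subgroup.subset[OF Rs]]
      set_mult_subset[OF Ps, of ?X R] R by auto
  have "?X <#> R \<lhd> G"
  proof (rule supplement_normalI[OF T' subgroup.subset[OF Ps] H(3) XR])
    show "normalizes T (?X <#> R)"
    proof (intro ballI)
      fix t y assume t: "t \<in> T" and "y \<in> ?X <#> R"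
      then obtain a b where ab: "a \<in> ?X" "b \<in> R" "y = a \<otimes> b" by (auto simp: mem_set_mult)
      have tc: "t \<in> carrier G" using t T'(1) subgroup.mem_carrier by fastforce
      have "cj t y = cj t a \<otimes> cj t b" using ab tc Pc Rc by (simp add: cj_mult)
      moreover have "cj t a \<in> ?X" using subgroup_cj[OF T'(1) t] normalD_cj[OF P(1) tc] ab by simp
      ultimately show "cj t y \<in> ?X <#> R" using ab normalD_cj[OF R(1) tc] by (simp add: set_multI)
    qed
    show "normalizes P (?X <#> R)"
    proof (intro ballI)
      fix y z assume y: "y \<in> P" and z: "z \<in> ?X <#> R"
      then have zP: "z \<in> P" using XRs by blast
      have "cj y z = cmt y z \<otimes> z" using cj_eq_cmt y zP Pc by blast
      moreover have "cmt y z \<in> ?X <#> R" using chief_commutator[OF p P PR order_refl zP y] XRs by blast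
      ultimately show "cj y z \<in> ?X <#> R" using subgroup.m_closed[OF XR, of "cmt y z" z] z by metis
    qed
  qed
  then have "?X <#> R = R \<or> ?X <#> R = P" using PR XRs unfolding chief_factor_def by blast
  moreover have "?X <#> R \<noteq> R"
  proof
    assume "?X <#> R = R"
    then have "?X \<subseteq> H" using XRs H by blast
    moreover have "H <#> ?X = P" using set_mult_Int_eq[OF T'(1) Ps H(3)] T'(2) subgroup.subset[OF Ps] by auto
    ultimately have "P \<subseteq> H" using set_mult_subset[OF H(1) order_refl] by blast
    then show False using HP H by blast
  qed
  ultimately have XRP: "?X <#> R = P" by blast
  have PT: "P \<subseteq> T <#> R" using mono_set_mult[of ?X T R R] XRP by auto
  have "H \<inter> P \<subseteq> (H \<inter> T) <#> R"
  proof -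
    have "(T <#> R) \<inter> H = (T \<inter> H) <#> R" by (rule set_mult_Int_eq'[OF T'(1) H(1,2)])
    then show ?thesis using PT by (auto simp: Int_commute)
  qed
  moreover have HR': "(H \<inter> P) <#> R = H"
  proof -
    have "H \<inter> P = H" using H by blast
    moreover have "H <#> R \<subseteq> H" using set_mult_subset[OF H(1)] H(2) by blast
    moreover have "H \<subseteq> H <#> R" using set_mult_subset_left[OF Rs subgroup.subset[OF H(1)]] .
    ultimately show ?thesis by simp
  qed
  ultimately have "(H \<inter> P) <#> R = R \<or> (H \<inter> P) <#> R = P"
    using controlled_supplement_key[OF p T H(1) PR order_refl PT _ ne S] H(5) by simp
  then show False using HR' HR HP by simp
qed

text \<open>Adjoining an element outside \<open>H <#> R\<close> keeps the intersection with
  \<open>R\<close>. Such an element exists as long as \<open>card (H <#> R) = p * card H\<close> is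
  less than \<open>card P\<close>, hence the bound \<open>j < m\<close>.\<close>

lemma elementary_abelian_avoiding:
  fixes p :: nat
  assumes p: "Factorial_Ring.prime p" and P: "subgroup P G" "card P = p ^ m"
    and ab: "\<And>x y. x \<in> P \<Longrightarrow> y \<in> P \<Longrightarrow> x \<otimes> y = y \<otimes> x" and ex: "\<And>x. x \<in> P \<Longrightarrow> x [^] p = \<one>"
    and R: "subgroup R G" "R \<subseteq> P" and R0: "subgroup R0 G" "R0 \<subseteq> R" "card R = p * card R0" "card R0 = p ^ r"
    and j: "r \<le> j" "j < m"
  shows "\<exists>H. subgroup H G \<and> H \<subseteq> P \<and> H \<inter> R = R0 \<and> card H = p ^ j"
  using j
proof (induction j rule: dec_induct)
  case base
  have "R0 \<inter> R = R0" using R0 by blast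
  then show ?case using R0 R by (intro exI[of _ R0]) auto
next
  case (step n)
  then obtain H where H: "subgroup H G" "H \<subseteq> P" "H \<inter> R = R0" "card H = p ^ n" by auto
  note Pc = subgroup.mem_carrier[OF P(1)]
  have cjP: "cj x y = y" if "x \<in> P" "y \<in> P" for x y
    using ab[OF that] that Pc by (simp add: conjugate_def m_assoc)
  have HR: "subgroup (H <#> R) G"
    by (rule subgroup_set_mult[OF H(1) R(1)]) (metis cjP H(2) R(2) subsetD)
  have HRP: "H <#> R \<subseteq> P" by (rule set_mult_subset[OF P(1) H(2) R(2)])
  have "card (H <#> R) * card R0 = card H * card R" using card_normalizing_mult[OF H(1) R(1)] H(3) by simp
  then have "card (H <#> R) = p * card H" using R0(3) card_subgroup_pos[OF R0(1)] by simp
  then have "card (H <#> R) = p ^ Suc n" using H by simp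
  then have "H <#> R \<noteq> P" using P(2) step.prems prime_power_less_iff[OF p, of "Suc n" m] by auto
  then obtain x where x: "x \<in> P" "x \<notin> H <#> R" using HRP by blast
  have xc: "x \<in> carrier G" using x Pc by blast
  have sub: "H \<subseteq> H <#> R" "R \<subseteq> H <#> R"
    using set_mult_subset_left[OF R(1) subgroup.subset[OF H(1)]] set_mult_subset_right[OF H(1) subgroup.subset[OF R(1)]] .
  have xp: "x [^] p \<in> H" using ex[OF x(1)] subgroup.one_closed[OF H(1)] by simp
  have xH: "x \<notin> H" using x sub by blast
  let ?H = "generate G {x} <#> H"
  have gen: "generate G {x} = range (\<lambda>n::nat. x [^] n)" using generate_singleton_finite xc by simp
  have cjx: "cj x h \<in> H" if "h \<in> H" for h using cjP[OF x(1), of h] H(2) that by auto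
  have ext: "subgroup ?H G" "card ?H = p * card H"
    using prime_extension[OF p H(1) xc xH xp] cjx by blast+
  have "?H \<subseteq> P" using set_mult_subset[OF P(1) _ H(2), of "generate G {x}"] gen nat_pow_mem[OF P(1) x(1)] by auto
  moreover have "?H \<inter> R = R0"
  proof
    show "?H \<inter> R \<subseteq> R0"
    proof
      fix y assume y: "y \<in> ?H \<inter> R"
      then obtain i :: nat and h where ih: "h \<in> H" "y = x [^] i \<otimes> h" by (auto simp: mem_set_mult gen)
      have hc: "h \<in> carrier G" "y \<in> carrier G" using ih H(2) Pc y subgroup.mem_carrier[OF R(1)] by auto
      have "x [^] i = y \<otimes> inv h" using ih hc xc by (simp add: m_assoc)
      moreover have "y \<in> H <#> R" "inv h \<in> H <#> R" using y sub ih subgroup.m_inv_closed[OF H(1)] by auto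
      ultimately have "x [^] i \<in> H <#> R" using subgroup.m_closed[OF HR] by simp
      moreover have "x [^] p \<in> H <#> R" using xp sub by blast
      ultimately have "p dvd i" using pow_mem_iff_dvd[OF p HR xc x(2)] by blast
      then have "x [^] i \<in> H" using pow_mem_iff_dvd[OF p H(1) xc xH xp] by blast
      then have "y \<in> H" using ih subgroup.m_closed[OF H(1)] by simp
      then show "y \<in> R0" using y H(3) by blast
    qed
    have "H \<subseteq> ?H" using set_mult_subset_right[of "generate G {x}" H] xc subgroup.subset[OF H(1)]
      by (simp add: generate_is_subgroup)
    then show "R0 \<subseteq> ?H \<inter> R" using H(3) by blast
  qed
  ultimately show ?case using ext H(4) by (intro exI[of _ ?H]) auto
qed

text \<open>The factor tested is \<open>R/1\<close>, so only \<open>H \<inter> R\<close> has to be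
  Sylow-invariant, not \<open>H\<close>. This allows an invariant \<open>R0\<close> of index
  \<open>p\<close> in \<open>R\<close> to be extended to order \<open>p ^ k\<close> arbitrarily.
  \<open>R0\<close> is not trivial because \<open>card R \<noteq> p\<close>.\<close>

lemma unique_minimal_normal_card:
  fixes p :: nat
  assumes p: "Factorial_Ring.prime p" and P: "P \<lhd> G" "card P = p ^ m"
    and ch: "chief_factor G R {\<one>}" and ser: "p_series G p R P"
    and uniq: "\<And>Y. Y \<lhd> G \<Longrightarrow> Y \<subseteq> P \<Longrightarrow> Y \<noteq> {\<one>} \<Longrightarrow> R \<subseteq> Y"
    and k: "1 \<le> k" "k < m" "card R \<le> p ^ k"
    and c: "\<And>H. subgroup H G \<Longrightarrow> H \<subset> P \<Longrightarrow> card H = p ^ k \<Longrightarrow> controlled G p P H"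
  shows "card R = p"
proof (rule ccontr)
  assume bad: "card R \<noteq> p"
  have R: "R \<lhd> G" "R \<subseteq> P" "R \<noteq> {\<one>}" using ch p_series_normal[OF ser] by (auto simp: chief_factor_def)
  note Rs = normalD_subgroup[OF R(1)] and Ps = normalD_subgroup[OF P(1)]
  note Rc = normal_carrierD[OF R(1)] and Pc = normal_carrierD[OF P(1)]
  note ea = elementary_abelian_top[OF p P ch ser uniq bad]
  have "card R dvd p ^ m" using card_subgroup_dvd[OF Rs Ps R(2)] P(2) by simp
  then obtain r where r: "card R = p ^ r" using divides_primepow_nat[OF p] by blast
  have "r \<noteq> 0" using r R(3) card_one_subgroup[OF Rs] by auto
  moreover have "r \<noteq> 1" using r bad by auto
  ultimately obtain r' where r': "r = Suc r'" "1 \<le> r'" by (cases r) auto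
  have rk: "r \<le> k" using k(3) r prime_power_le_iff[OF p] by simp
  obtain S where S: "subgroup S G" "card S = p ^ multiplicity p (card (carrier G))"
    using sylow_exists[OF p] by blast
  have Sc: "s \<in> carrier G" if "s \<in> S" for s using that S subgroup.mem_carrier by fastforce
  have RS: "R \<subseteq> S" using normal_subset_sylow[OF p S P] R by blast
  have n1: "normalizes S {\<one>}" "normalizes S R" using normalD_cj[OF R(1)] Sc by auto
  have "\<exists>H. subgroup H G \<and> {\<one>} \<subseteq> H \<and> H \<subseteq> R \<and> card H = p ^ r' \<and> normalizes S H"
    by (rule prime_chain[OF p S triv_subgroup _ Rs _ RS n1, of 0])
      (use r r' prime_power_le_iff[OF p, of r' r] subgroup.one_closed[OF Rs] in auto)
  then obtain R0 where R0: "subgroup R0 G" "R0 \<subseteq> R" "card R0 = p ^ r'" "normalizes S R0" by blast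
  have cR: "card R = p * card R0" using r r' R0 by simp
  obtain H where H: "subgroup H G" "H \<subseteq> P" "H \<inter> R = R0" "card H = p ^ k"
    using elementary_abelian_avoiding[OF p Ps P(2) ea Rs R(2) R0(1,2) cR R0(3), of k] rk r' k by auto
  have HP: "H \<subset> P" using H P(2) k prime_power_less_iff[OF p, of k m] by auto
  obtain T where T: "controlled_supplement G p P H T" using c[OF H(1) HP H(4)] by (auto simp: controlled_def)
  then have T': "subgroup T G" "H <#> T = carrier G" by (auto simp: controlled_supplement_def)
  let ?X = "T \<inter> P"
  have X: "subgroup ?X G" by (rule subgroup_Int_subgroup[OF T'(1) Ps])
  have "?X \<lhd> G"
  proof (rule supplement_normalI[OF T' subgroup.subset[OF Ps] H(2) X])
    show "normalizes T ?X"
      using subgroup_cj[OF T'(1)] normalD_cj[OF P(1)] subgroup.mem_carrier[OF T'(1)] by auto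
    show "normalizes P ?X"
    proof (intro ballI)
      fix y z assume y: "y \<in> P" and z: "z \<in> ?X"
      then have "cj y z = z" using ea(1)[of y z] Pc by (simp add: conjugate_def m_assoc)
      then show "cj y z \<in> ?X" using z by simp
    qed
  qed
  moreover have "?X \<noteq> {\<one>}"
  proof
    assume e: "?X = {\<one>}"
    have "H <#> ?X = P" using set_mult_Int_eq[OF T'(1) Ps H(2)] T'(2) subgroup.subset[OF Ps] by auto
    moreover have "H <#> {\<one>} = H" by (rule set_mult_one[OF subgroup.subset[OF H(1)]])
    ultimately show False using e HP by simp
  qed
  ultimately have RT: "R \<subseteq> T" using uniq[of ?X] by blast
  note one = set_mult_one
  have ne: "card R \<noteq> p * card {\<one>}" using bad by simp
  note R0c = subgroup.subset[OF R0(1)]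
  have "(H \<inter> R) <#> {\<one>} = {\<one>} \<or> (H \<inter> R) <#> {\<one>} = R"
  proof (rule controlled_supplement_key[OF p T H(1) ch R(2) _ _ ne S])
    show "R \<subseteq> T <#> {\<one>}" using one[OF subgroup.subset[OF T'(1)]] RT by simp
    show "H \<inter> R \<subseteq> (H \<inter> T) <#> {\<one>}" using one[of "H \<inter> T"] RT subgroup.subset[OF H(1)] by auto
    show "normalizes S ((H \<inter> R) <#> {\<one>})" unfolding H(3) one[OF R0c] by (rule R0(4))
  qed
  then have "R0 = {\<one>} \<or> R0 = R" unfolding H(3) one[OF R0c] .
  moreover have "R0 \<noteq> {\<one>}"
  proof
    assume "R0 = {\<one>}"
    then have "p ^ r' = 1" using R0(3) by simp
    then show False using r'(2) prime_gt_1_nat[OF p] by simp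
  qed
  moreover have "R0 \<noteq> R" using cR prime_gt_1_nat[OF p] card_subgroup_pos[OF R0(1)] by auto
  ultimately show False by blast
qed

end

text \<open>The induction replaces \<open>G\<close> by quotients; all groups are plain monoids over
  one type, so that the induction hypothesis can range over them.\<close>

lemma p_series_of_controlled_subgroups:
  fixes G :: "'a monoid" and p :: nat
  assumes p: "Factorial_Ring.prime p"
  shows "fin_group G \<Longrightarrow> P \<lhd> G \<Longrightarrow> card P = p ^ m \<Longrightarrow> 1 \<le> k \<Longrightarrow> k < m \<Longrightarrow>
    (\<And>H. subgroup H G \<Longrightarrow> H \<subset> P \<Longrightarrow> card H = p ^ k \<or> card H = p ^ Suc k \<Longrightarrow> controlled G p P H) \<Longrightarrow>
    p_series G p {\<one>\<^bsub>G\<^esub>} P"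
proof (induction "card P" arbitrary: G P m k rule: less_induct)
  case less
  interpret fin_group G by (rule less.prems(1))
  note P = less.prems(2,3) and k = less.prems(4,5) and c = less.prems(6)
  note Ps = normalD_subgroup[OF P(1)] and Pc = normal_carrierD[OF P(1)]
  show ?case
  proof (rule ccontr)
    assume nser: "\<not> p_series G p {\<one>\<^bsub>G\<^esub>} P"
    have smaller: "p_series G p {\<one>\<^bsub>G\<^esub>} Y" if Y: "Y \<lhd> G" "Y \<subset> P" "p ^ k < card Y" for Y
    proof -
      note Ys = normalD_subgroup[OF Y(1)]
      have "card Y dvd p ^ m" using card_subgroup_dvd[OF Ys Ps] Y P by auto
      then obtain y where y: "card Y = p ^ y" using divides_primepow_nat[OF p] by blast
      have ky: "k < y" using Y(3) y prime_power_less_iff[OF p] by simp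
      show ?thesis
      proof (rule less.hyps[OF card_psubset_subgroup[OF Ps Y(2)] fin_group_axioms Y(1) y k(1) ky])
        show "controlled G p Y H" if "subgroup H G" "H \<subset> Y" "card H = p ^ k \<or> card H = p ^ Suc k" for H
          using c[of H] that Y(2) controlled_mono by blast
      qed
    qed
    have le: "card R \<le> p ^ k" if "chief_factor G R {\<one>\<^bsub>G\<^esub>}" "R \<subseteq> P" for R
      using minimal_normal_card_le[OF p P that k(1)] c by blast
    \<comment> \<open>Proved for every minimal normal subgroup in \<open>P\<close>, since the
      uniqueness argument below compares two of them.\<close>
    have quot: "p_series G p R P" if R: "chief_factor G R {\<one>\<^bsub>G\<^esub>}" "R \<subseteq> P" for R
    proof -
      have Rn: "R \<lhd> G" "{\<one>\<^bsub>G\<^esub>} \<subset> R" using R(1) by (auto simp: chief_factor_def)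
      note Rs = normalD_subgroup[OF Rn(1)]
      have "card R dvd p ^ m" using card_subgroup_dvd[OF Rs Ps R(2)] P(2) by simp
      then obtain r where r: "card R = p ^ r" using divides_primepow_nat[OF p] by blast
      have r0: "r \<noteq> 0" using r Rn(2) card_one_subgroup[OF Rs] by auto
      have rk: "r \<le> k" using le[OF R] r prime_power_le_iff[OF p] by simp
      then have "card R < card P" using r P(2) k prime_power_less_iff[OF p, of r m] by simp
      then have RP: "R \<subset> P" using R(2) by auto
      show ?thesis
      proof (cases "r = k")
        case False
        then have rk': "r < k" using rk by simp
        obtain G' :: "'a monoid" and f where "fin_group_epi G G' f R" using exists_quotient[OF Rn(1)] by blast
        then interpret E: fin_group_epi G G' f R .
        have prefP: "E.pre (f ` P) = P" by (rule E.pre_image[OF Ps R(2)])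
        have fPc: "f ` P \<subseteq> carrier G'" using E.image_subgroup[OF Ps] by (rule subgroup.subset)
        have "p ^ m = card (f ` P) * p ^ r" using E.card_pre[OF fPc] prefP P(2) r by simp
        moreover have "p ^ m = p ^ (m - r) * p ^ r" using rk k by (simp add: power_add[symmetric])
        ultimately have cfP: "card (f ` P) = p ^ (m - r)" using prime_gt_0_nat[OF p] by simp
        have "p ^ (m - r) < p ^ m" using r0 rk k prime_power_less_iff[OF p, of "m - r" m] by simp
        then have lt: "card (f ` P) < card P" using cfP P(2) by simp
        have "p_series G' p {\<one>\<^bsub>G'\<^esub>} (f ` P)"
        proof (rule less.hyps[OF lt E.G'.fin_group_axioms E.image_normal[OF P(1)] cfP])
          show "1 \<le> k - r" "k - r < m - r" using rk' k by auto
          fix H assume H: "subgroup H G'" "H \<subset> f ` P" "card H = p ^ (k - r) \<or> card H = p ^ Suc (k - r)"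
          have Hc: "H \<subseteq> carrier G'" using H(1) by (rule subgroup.subset)
          have "card (E.pre H) = card H * p ^ r" using E.card_pre[OF Hc] r by simp
          then have "card (E.pre H) = p ^ k \<or> card (E.pre H) = p ^ Suc k"
            using H(3) rk by (auto simp: power_add[symmetric])
          moreover have "E.pre H \<subset> P"
          proof -
            have "E.pre H \<subseteq> P" using E.pre_mono[of H "f ` P"] H(2) prefP by auto
            moreover have "E.pre H \<noteq> P" using E.image_pre[OF Hc] H(2) by auto
            ultimately show ?thesis by blast
          qed
          ultimately have "controlled G p P (E.pre H)" using c E.pre_subgroup[OF H(1)] by blast
          then show "controlled G' p (f ` P) H"
            using E.controlled_quotient[OF p P(1) R(2) H(1)] H(2) by blast
        qed
        then show ?thesis using E.p_series_pre prefP by fastforce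
      next
        case True
        show ?thesis
        proof (cases "\<exists>Y. Y \<lhd> G \<and> R \<subset> Y \<and> Y \<subset> P")
          \<comment> \<open>Induction gives a series of \<open>Y\<close>, so \<open>R\<close> has
            order \<open>p\<close> and \<open>k = 1\<close>. The orders \<open>p\<close> and
            \<open>p\<^sup>2\<close> are then both available, so elements of order \<open>p\<close>
            and, for \<open>p = 2\<close>, of order 4 are covered by the hypothesis; this leads back
            to \<open>p_series_of_controlled_elements\<close>.\<close>
          case ex: True
          then obtain Y where Y: "Y \<lhd> G" "R \<subset> Y" "Y \<subset> P" by blast
          note Ys = normalD_subgroup[OF Y(1)]
          have lt: "p ^ k < card Y" using card_psubset_subgroup[OF Ys Y(2)] r True by simp
          have serY: "p_series G p {\<one>\<^bsub>G\<^esub>} Y" by (rule smaller[OF Y(1,3) lt])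
          have "card R = p * card {\<one>\<^bsub>G\<^esub>}"
            using p_series_chief_card[OF p R(1) serY] Y(2) Rn(2) by auto
          then have "p ^ r = p ^ 1" using r by simp
          then have "r = 1" using prime_power_less_iff[OF p, of 1 r] prime_power_less_iff[OF p, of r 1] by (metis nat_neq_iff)
          then have k1: "k = 1" using True by simp
          have cY: "card Y < card P" by (rule card_psubset_subgroup[OF Ps Y(3)])
          have "card Y dvd p ^ m" using card_subgroup_dvd[OF Ys Ps] Y P by auto
          then obtain y where y: "card Y = p ^ y" using divides_primepow_nat[OF p] by blast
          have "k < y" using lt y prime_power_less_iff[OF p] by simp
          moreover have "y < m" using y cY P(2) prime_power_less_iff[OF p] by simp
          ultimately have m2: "2 < m" using k1 by simp
          have "p_series G p {\<one>\<^bsub>G\<^esub>} P"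
          proof (rule p_series_of_controlled_elements[OF p P])
            fix x assume x: "x \<in> P" "x \<noteq> \<one>\<^bsub>G\<^esub>" "x [^]\<^bsub>G\<^esub> p = \<one>\<^bsub>G\<^esub>"
            have xc: "x \<in> carrier G" using x Pc by blast
            have gs: "subgroup (generate G {x}) G" "generate G {x} \<subseteq> P"
              using generate_is_subgroup[of "{x}"] generate_subgroup_incl[OF _ Ps, of "{x}"] xc x(1) by auto
            have "ord x dvd p" using pow_eq_id[OF xc] x(3) by simp
            moreover have "ord x \<noteq> 1" using ord_eq_1[OF xc] x(2) by simp
            ultimately have "ord x = p" using p by (metis prime_nat_iff)
            then have cg: "card (generate G {x}) = p ^ k" using generate_pow_card[OF xc] k1 by simp
            then have "generate G {x} \<noteq> P" using P(2) k prime_power_less_iff[OF p, of k m] by auto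
            then show "controlled G p P (generate G {x})" using c[OF gs(1)] gs(2) cg by blast
          next
            fix x assume x: "p = 2" "x \<in> P" "x \<otimes>\<^bsub>G\<^esub> x \<noteq> \<one>\<^bsub>G\<^esub>" "x [^]\<^bsub>G\<^esub> (4::nat) = \<one>\<^bsub>G\<^esub>"
            have xc: "x \<in> carrier G" using x Pc by blast
            have gs: "subgroup (generate G {x}) G" "generate G {x} \<subseteq> P"
              using generate_is_subgroup[of "{x}"] generate_subgroup_incl[OF _ Ps, of "{x}"] xc x(2) by auto
            have "ord x dvd 2 ^ 2" using pow_eq_id[OF xc, of 4] x(4) by simp
            then obtain i where i: "ord x = 2 ^ i" "i \<le> 2" using divides_primepow_nat[of 2 "ord x" 2] two_is_prime_nat by blast
            have "\<not> ord x dvd 2" using pow_eq_id[OF xc, of 2] x(3) pow_two[OF xc] by simp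
            then have "i \<noteq> 0" "i \<noteq> 1" using i(1) by (metis one_dvd power_0, metis dvd_refl power_one_right)
            then have "i = 2" using i(2) by linarith
            then have cg: "card (generate G {x}) = p ^ Suc k" using generate_pow_card[OF xc] k1 i x(1) by simp
            then have "generate G {x} \<noteq> P" using P(2) m2 k1 prime_power_less_iff[OF p, of "Suc k" m] by auto
            then show "controlled G p P (generate G {x})" using c[OF gs(1)] gs(2) cg by blast
          qed
          then show ?thesis using nser by simp
        next
          case False
          then have "chief_factor G P R" unfolding chief_factor_def using P(1) Rn RP by blast
          then have "card P = p * card R"
            using chief_over_minimal_normal[OF p P R(1) _ , of k] c r True by blast
          then show ?thesis using p_series.step[OF p_series.refl[OF Rn(1)] P(1) R(2)] by blast
        qed
      qed
    qed
    have "P \<noteq> {\<one>\<^bsub>G\<^esub>}" using nser p_series.refl[OF one_is_normal] by auto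
    then have "{\<one>\<^bsub>G\<^esub>} \<subset> P" using subgroup.one_closed[OF Ps] by blast
    then obtain R where R: "chief_factor G R {\<one>\<^bsub>G\<^esub>}" "R \<subseteq> P"
      using exists_chief_factor_above[OF one_is_normal P(1)] by blast
    have Rn: "R \<lhd> G" "{\<one>\<^bsub>G\<^esub>} \<subseteq> R" using R(1) by (auto simp: chief_factor_def)
    have bad: "card R \<noteq> p"
    proof
      assume "card R = p"
      then have "p_series G p {\<one>\<^bsub>G\<^esub>} R" using p_series.step[OF p_series.refl[OF one_is_normal] Rn] by simp
      then show False using p_series_trans[OF quot[OF R]] nser by blast
    qed
    \<comment> \<open>\<open>P/R2\<close> has a series as well. If \<open>R2 \<inter> R\<close> were
      trivial, comparison of \<open>R/1\<close> with that series would give \<open>R\<close> order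
      \<open>p\<close>.\<close>
    have uniq: "R \<subseteq> Y" if Y: "Y \<lhd> G" "Y \<subseteq> P" "Y \<noteq> {\<one>\<^bsub>G\<^esub>}" for Y
    proof -
      have "{\<one>\<^bsub>G\<^esub>} \<subset> Y" using Y subgroup.one_closed[OF normalD_subgroup[OF Y(1)]] by blast
      then obtain R2 where R2: "chief_factor G R2 {\<one>\<^bsub>G\<^esub>}" "R2 \<subseteq> Y"
        using exists_chief_factor_above[OF one_is_normal Y(1)] by blast
      have R2n: "R2 \<lhd> G" "{\<one>\<^bsub>G\<^esub>} \<subset> R2" using R2(1) by (auto simp: chief_factor_def)
      have "R2 \<subseteq> P" using R2(2) Y(2) by blast
      then have ser2: "p_series G p R2 P" using quot[OF R2(1)] by blast
      have "R2 \<inter> R = {\<one>\<^bsub>G\<^esub>} \<or> R2 \<inter> R = R"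
        using R(1) normal_Int[OF R2n(1) Rn(1)] R2n(2) Rn(2) unfolding chief_factor_def by blast
      moreover have "R2 \<inter> R \<noteq> {\<one>\<^bsub>G\<^esub>}"
      proof
        assume "R2 \<inter> R = {\<one>\<^bsub>G\<^esub>}"
        then have "P \<inter> R \<subseteq> {\<one>\<^bsub>G\<^esub>} \<or> card R = p * card {\<one>\<^bsub>G\<^esub>}"
          using p_series_chief_card[OF p R(1) ser2] by blast
        then show False using bad R unfolding chief_factor_def by auto
      qed
      ultimately show ?thesis using R2(2) by blast
    qed
    have "card R = p"
      by (rule unique_minimal_normal_card[OF p P R(1) quot[OF R] uniq k le[OF R]]) (use c in auto)
    then show False using bad by simp
  qed
qed

section \<open>The hypotheses give controlled supplements\<close>

lemma prime_power_of_prime_factors: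
  fixes n p :: nat
  assumes "n \<noteq> 0" "prime_factors n \<subseteq> {p}"
  shows "\<exists>j. n = p ^ j"
proof (cases "prime_factors n = {}")
  case True
  then have "n = 1" using assms(1) by (simp add: prime_factorization_empty_iff)
  then show ?thesis by (intro exI[of _ 0]) simp
next
  case False
  then have "prime_factors n = {p}" using assms(2) by blast
  then have "n = p ^ multiplicity p n" using prod_prime_factors[OF assms(1)] by simp
  then show ?thesis by blast
qed

context fin_group
begin

text \<open>The definition of \<open>normalizer\<close> demands that conjugation map
  \<open>A\<close> onto itself; for a finite set, mapping into itself is the same.\<close>

lemma normalizer_eq:
  assumes "A \<subseteq> carrier G"
  shows "normalizer G A = {g \<in> carrier G. \<forall>x\<in>A. cj g x \<in> A}"
proof -
  have fA: "finite A" using assms fin finite_subset by blast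
  have im: "g <# A #> inv g = cj g ` A" for g
    by (auto simp: l_coset_def r_coset_def conjugate_def)
  have "cj g ` A = A \<longleftrightarrow> (\<forall>x\<in>A. cj g x \<in> A)" if g: "g \<in> carrier G" for g
    using endo_inj_surj[OF fA, of "cj g"] inj_on_subset[OF inj_on_cj[OF g] assms] by blast
  then show ?thesis using assms by (auto simp: normalizer_def stabilizer_def im)
qed

lemma quotient_epi:
  assumes K: "K \<lhd> G"
  shows "fin_group_epi G (G Mod K) (\<lambda>x. K #> x) K"
proof (intro fin_group_epi.intro fin_group_epi_axioms.intro fin_group_axioms Mod_fin_group[OF K] rcoset_hom[OF K])
  show "(\<lambda>x. K #> x) ` carrier G = carrier (G Mod K)" by (simp add: carrier_FactGroup)
  show "{x \<in> carrier G. K #> x = \<one>\<^bsub>G Mod K\<^esub>} = K"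
    using rcoset_eq_self_iff[OF normalD_subgroup[OF K]] normal_carrierD[OF K] by auto
qed

text \<open>From \<open>H \<inter> L \<subseteq> (H \<inter> T) <#> K\<close> and
  \<open>H \<inter> T \<subseteq> I \<subseteq> H\<close> it follows that \<open>I\<close> and
  \<open>H\<close> leave the same trace \<open>(H \<inter> L) <#> K\<close> on \<open>L\<close>
  modulo \<open>K\<close>. The \<open>\<Pi>\<close>-property of \<open>I\<close> thus speaks of
  \<open>H\<close>.\<close>

lemma Pi_supplemented_controlled:
  fixes p :: nat
  assumes p: "Factorial_Ring.prime p" and P: "P \<lhd> G" "card P = p ^ m"
    and H: "subgroup H G" "H \<subseteq> P" and Pi: "Pi_supplemented G H"
  shows "controlled G p P H"
proof -
  obtain T I where T: "subgroup T G" "H <#> T = carrier G" and I: "subgroup I G" "H \<inter> T \<subseteq> I" "I \<subseteq> H"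
    and PI: "Pi_property G I" using Pi unfolding Pi_supplemented_def by blast
  have "\<exists>m. card (carrier G) = p ^ m * card {g \<in> carrier G. \<forall>x\<in>(H \<inter> L) <#> K. cj g x \<in> (H \<inter> L) <#> K}"
    if ch: "chief_factor G L K" and LP: "L \<subseteq> P" and LT: "L \<subseteq> T <#> K" and HL: "H \<inter> L \<subseteq> (H \<inter> T) <#> K" for L K
  proof -
    have L: "L \<lhd> G" "K \<lhd> G" "K \<subseteq> L" using ch by (auto simp: chief_factor_def)
    note Ls = normalD_subgroup[OF L(1)] and Ks = normalD_subgroup[OF L(2)] and Ps = normalD_subgroup[OF P(1)]
    note Lc = normal_carrierD[OF L(1)]
    let ?B = "(H \<inter> L) <#> K"
    have HLs: "subgroup (H \<inter> L) G" by (rule subgroup_Int_subgroup[OF H(1) Ls])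
    have B: "subgroup ?B G" by (rule subgroup_set_mult_normal[OF HLs L(2)])
    have IK: "subgroup (I <#> K) G" by (rule subgroup_set_mult_normal[OF I(1) L(2)])
    have KIK: "K \<subseteq> I <#> K" by (rule set_mult_subset_right[OF I(1) subgroup.subset[OF Ks]])
    have KB: "K \<subseteq> ?B" by (rule set_mult_subset_right[OF HLs subgroup.subset[OF Ks]])
    have Beq: "(I <#> K) \<inter> L = ?B"
    proof
      have "(I <#> K) \<inter> L = (I \<inter> L) <#> K" by (rule set_mult_Int_eq'[OF I(1) Ls L(3)])
      also have "\<dots> \<subseteq> ?B" by (rule mono_set_mult) (use I(3) in auto)
      finally show "(I <#> K) \<inter> L \<subseteq> ?B" .
      have "(H \<inter> T) <#> K \<subseteq> I <#> K" by (rule mono_set_mult[OF I(2) order_refl])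
      then have "H \<inter> L \<subseteq> (I <#> K) \<inter> L" using HL by blast
      then show "?B \<subseteq> (I <#> K) \<inter> L"
        using set_mult_subset[OF subgroup_Int_subgroup[OF IK Ls]] KIK L(3) by blast
    qed
    let ?A = "carrier (factor_group G (I <#> K) K) \<inter> carrier (factor_group G L K)"
    have A: "?A = (\<lambda>x. K #> x) ` ?B"
    proof
      show "(\<lambda>x. K #> x) ` ?B \<subseteq> ?A" unfolding Beq[symmetric] by (auto simp: carrier_FactGroup)
      show "?A \<subseteq> (\<lambda>x. K #> x) ` ?B"
      proof
        fix C assume "C \<in> ?A"
        then obtain x y where xy: "x \<in> I <#> K" "y \<in> L" "C = K #> x" "C = K #> y" by (auto simp: carrier_FactGroup)
        have xc: "x \<in> carrier G" using xy(1) IK subgroup.mem_carrier by fastforce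
        have "x \<otimes> inv y \<in> K" using rcoset_eq_iff[OF Ks xc Lc[OF xy(2)]] xy by simp
        then have "x \<otimes> inv y \<otimes> y \<in> L" using L(3) xy(2) subgroup.m_closed[OF Ls] by blast
        then have "x \<in> L" using xc Lc[OF xy(2)] by (simp add: m_assoc)
        then show "C \<in> (\<lambda>x. K #> x) ` ?B" using xy Beq by blast
      qed
    qed
    interpret E: fin_group_epi G "G Mod K" "\<lambda>x. K #> x" K by (rule quotient_epi[OF L(2)])
    have Ac: "?A \<subseteq> carrier (G Mod K)" unfolding A using E.image_subgroup[OF B] by (rule subgroup.subset)
    have preA: "E.pre ?A = ?B" unfolding A by (rule E.pre_image[OF B KB])
    have cAB: "card ?B = card ?A * card K" using E.card_pre[OF Ac] preA by simp
    have "?B \<subseteq> P" using set_mult_subset[OF Ps, of "H \<inter> L" K] H LP L by blast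
    then have "card ?B dvd p ^ m" using card_subgroup_dvd[OF B Ps] P by simp
    then have "card ?A dvd p ^ m" using cAB by (metis dvd_mult_left)
    then obtain a where a: "card ?A = p ^ a" using divides_primepow_nat[OF p] by blast
    let ?N = "normalizer (G Mod K) ?A"
    let ?n = "card (rcosets\<^bsub>G Mod K\<^esub> ?N)"
    have "pi_number (prime_factors (card ?A)) ?n"
      using PI ch unfolding Pi_property_def Let_def by blast
    \<comment> \<open>Inclusion rather than equality: if \<open>?A\<close> is trivial there is no
      prime factor, and the index is 1.\<close>
    moreover have "prime_factors (card ?A) \<subseteq> {p}"
    proof
      fix q assume "q \<in> prime_factors (card ?A)"
      then have "Factorial_Ring.prime q" "q dvd p ^ a" unfolding a by auto
      then show "q \<in> {p}" using prime_dvd_power p primes_dvd_imp_eq by blast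
    qed
    ultimately have pf: "prime_factors ?n \<subseteq> {p}" unfolding pi_number_def by blast
    have lag: "?n * card ?N = card (carrier (G Mod K))"
      using E.G'.lagrange[OF E.G'.normalizer_imp_subgroup[OF Ac]] by (simp add: order_def)
    have "card (carrier (G Mod K)) \<noteq> 0" using E.G'.card_subgroup_pos[OF E.G'.subgroup_self] by linarith
    then have "?n \<noteq> 0" using lag by (metis mult_zero_left)
    then obtain j where j: "?n = p ^ j" using prime_power_of_prime_factors pf by blast
    have "{g \<in> carrier G. \<forall>x\<in>?B. cj g x \<in> ?B} = E.pre ?N"
      using E.pre_normalizer[OF Ac] unfolding preA E.G'.normalizer_eq[OF Ac] .
    then have cN: "card {g \<in> carrier G. \<forall>x\<in>?B. cj g x \<in> ?B} = card ?N * card K"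
      using E.card_pre[of ?N] subgroup.subset[OF E.G'.normalizer_imp_subgroup[OF Ac]] by simp
    have "card (carrier G) = ?n * card ?N * card K" unfolding lag by (rule E.card_carrier_epi)
    then have "card (carrier G) = p ^ j * card {g \<in> carrier G. \<forall>x\<in>?B. cj g x \<in> ?B}"
      unfolding cN j mult.assoc .
    then show ?thesis by blast
  qed
  then show ?thesis using T unfolding controlled_def controlled_supplement_def by blast
qed

text \<open>If \<open>T\<close> covers \<open>L/K\<close>, then
  \<open>(T \<inter> L)/(T \<inter> K)\<close> is a chief factor of \<open>T\<close> of the same
  order: for a \<open>T\<close>-invariant \<open>M\<close> in between, \<open>M <#> K\<close> is
  also \<open>P\<close>-invariant as \<open>P\<close> centralizes \<open>L/K\<close>, hence normal
  in \<open>G\<close>. So the first alternative in \<open>controlled_supplement\<close> always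
  holds.\<close>

lemma p_supersoluble_supplement_controlled:
  fixes p :: nat
  assumes p: "Factorial_Ring.prime p" and P: "P \<lhd> G" "card P = p ^ m"
    and H: "subgroup H G" "H \<subseteq> P" and sup: "has_p_supersoluble_supplement p G H"
  shows "controlled G p P H"
proof -
  obtain T where T: "subgroup T G" "H <#> T = carrier G" and pT: "p_supersoluble p (G\<lparr>carrier := T\<rparr>)"
    using sup unfolding has_p_supersoluble_supplement_def by blast
  note Tc = subgroup.mem_carrier[OF T(1)]
  interpret T: fin_group "G\<lparr>carrier := T\<rparr>" by (rule subgroup_fin_group[OF T(1)])
  have cjT: "conjugate (G\<lparr>carrier := T\<rparr>) g h = cj g h" if "g \<in> T" for g h
    using that m_inv_consistent[OF T(1) that] by (simp add: conjugate_def)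
  have "card L = p * card K" if ch: "chief_factor G L K" and LP: "L \<subseteq> P" and LT: "L \<subseteq> T <#> K" for L K
  proof -
    have L: "L \<lhd> G" "K \<lhd> G" "K \<subseteq> L" "K \<noteq> L" using ch by (auto simp: chief_factor_def)
    note Ls = normalD_subgroup[OF L(1)] and Ks = normalD_subgroup[OF L(2)] and Ps = normalD_subgroup[OF P(1)]
    note Lc = normal_carrierD[OF L(1)] and Kc = normal_carrierD[OF L(2)] and Pc = normal_carrierD[OF P(1)]
    let ?L = "T \<inter> L" and ?K = "T \<inter> K"
    have Lx: "?L <#> K = L"
    proof -
      have "(T <#> K) \<inter> L = ?L <#> K" by (rule set_mult_Int_eq'[OF T(1) Ls L(3)])
      then show ?thesis using LT by blast
    qed
    have nT: "T \<inter> N \<lhd> G\<lparr>carrier := T\<rparr>" if N: "N \<lhd> G" for N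
      unfolding T.normal_iff_cj
    proof (intro conjI ballI)
      show "subgroup (T \<inter> N) (G\<lparr>carrier := T\<rparr>)"
        by (rule subgroup_incl[OF subgroup_Int_subgroup[OF T(1) normalD_subgroup[OF N]] T(1)]) blast
      show "conjugate (G\<lparr>carrier := T\<rparr>) g x \<in> T \<inter> N" if "g \<in> carrier (G\<lparr>carrier := T\<rparr>)" "x \<in> T \<inter> N" for g x
        using that cjT subgroup_cj[OF T(1)] normalD_cj[OF N] Tc by auto
    qed
    have chT: "chief_factor (G\<lparr>carrier := T\<rparr>) ?L ?K" unfolding chief_factor_def
    proof (intro conjI allI impI)
      show "?L \<lhd> G\<lparr>carrier := T\<rparr>" "?K \<lhd> G\<lparr>carrier := T\<rparr>" using nT L by auto
      have "?L \<noteq> ?K"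
      proof
        assume "?L = ?K"
        then have "?L \<subseteq> K" by blast
        then have "?L <#> K \<subseteq> K" using set_mult_subset[OF Ks] by blast
        then show False using Lx L by blast
      qed
      then show "?K \<subset> ?L" using L(3) by blast
      fix M assume M: "M \<lhd> G\<lparr>carrier := T\<rparr> \<and> ?K \<subseteq> M \<and> M \<subseteq> ?L"
      have Ms: "subgroup M G" using incl_subgroup[OF T(1) T.normalD_subgroup] M by blast
      have MLT: "M \<subseteq> L" "M \<subseteq> T" using M by auto
      have MK: "subgroup (M <#> K) G" by (rule subgroup_set_mult_normal[OF Ms L(2)])
      have MKs: "K \<subseteq> M <#> K" "M \<subseteq> M <#> K" "M <#> K \<subseteq> L"
        using set_mult_subset_right[OF Ms subgroup.subset[OF Ks]] set_mult_subset_left[OF Ks subgroup.subset[OF Ms]]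
          set_mult_subset[OF Ls MLT(1) L(3)] by auto
      have "M <#> K \<lhd> G"
      proof (rule supplement_normalI[OF T subgroup.subset[OF Ps] H(2) MK])
        show "normalizes T (M <#> K)"
        proof (intro ballI)
          fix t y assume t: "t \<in> T" and "y \<in> M <#> K"
          then obtain a b where ab: "a \<in> M" "b \<in> K" "y = a \<otimes> b" by (auto simp: mem_set_mult)
          have ac: "a \<in> carrier G" using ab MLT Lc by blast
          have "cj t y = cj t a \<otimes> cj t b" using ab ac t Tc Kc by (simp add: cj_mult)
          moreover have "cj t a \<in> M" using T.normalD_cj[of M t a] M t ab(1) cjT[OF t] by simp
          ultimately show "cj t y \<in> M <#> K" using ab normalD_cj[OF L(2) Tc[OF t]] by (simp add: set_multI)
        qed
        show "normalizes P (M <#> K)"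
        proof (intro ballI)
          fix y z assume y: "y \<in> P" and z: "z \<in> M <#> K"
          then have zL: "z \<in> L" using MKs by blast
          have "cj y z = cmt y z \<otimes> z" using cj_eq_cmt y zL Pc Lc by blast
          moreover have "cmt y z \<in> M <#> K" using chief_commutator[OF p P ch LP zL y] MKs by blast
          ultimately show "cj y z \<in> M <#> K" using subgroup.m_closed[OF MK, of "cmt y z" z] z by metis
        qed
      qed
      then have "M <#> K = K \<or> M <#> K = L" using ch MKs unfolding chief_factor_def by blast
      then show "M = ?K \<or> M = ?L"
      proof
        assume "M <#> K = K"
        then have "M \<subseteq> K" using MKs(2) by simp
        then show ?thesis using M MLT by blast
      next
        assume e: "M <#> K = L"
        have "(M <#> K) \<inter> T = M <#> (K \<inter> T)" by (rule set_mult_Int_eq[OF Ks T(1) MLT(2)])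
        also have "\<dots> \<subseteq> M" using set_mult_subset[OF Ms, of M "K \<inter> T"] M by blast
        finally show ?thesis using e M by blast
      qed
    qed
    have Ts: "subgroup ?L G" "subgroup ?K G" using subgroup_Int_subgroup[OF T(1)] Ls Ks by auto
    have kl: "subgroup ?K (G\<lparr>carrier := ?L\<rparr>)" by (rule subgroup_incl[OF Ts(2,1)]) (use L in blast)
    let ?o = "order (factor_group (G\<lparr>carrier := T\<rparr>) ?L ?K)"
    have "?o = card (rcosets\<^bsub>G\<lparr>carrier := ?L\<rparr>\<^esub> ?K)" by (simp add: order_def FactGroup_def)
    then have oc: "?o * card ?K = card ?L"
      using group.lagrange[OF subgroup_imp_group[OF Ts(1)] kl] by (simp add: order_def)
    have i: "?L \<inter> K = ?K" using L(3) by blast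
    have "card L * card ?K = card ?L * card K" using card_normalizing_mult[OF Ts(1) Ks] Lx i by simp
    then have "card L * card ?K = ?o * card K * card ?K" using oc by (simp add: mult_ac)
    then have cL: "card L = ?o * card K" using card_subgroup_pos[OF Ts(2)] by simp
    have "card L dvd p ^ m" using card_subgroup_dvd[OF Ls Ps LP] P by simp
    then have "?o dvd p ^ m" using cL by (metis dvd_mult_left)
    then obtain j where j: "?o = p ^ j" using divides_primepow_nat[OF p] by blast
    have "?o \<noteq> 1" using cL subgroup_eqI[OF Ks Ls L(3)] L(4) by auto
    then have "j \<noteq> 0" using j by auto
    then have "p dvd ?o" using j by simp
    then have "?o = p" using pT chT unfolding p_supersoluble_def by blast
    then show ?thesis using cL by simp
  qed
  then show ?thesis using T unfolding controlled_def controlled_supplement_def by blast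
qed

end

section \<open>Chief factors of order \<open>p\<close> are \<open>\<U>\<close>-central\<close>

lemma semidirect_product_group:
  assumes N: "group N" and Q: "group Q"
    and hom: "\<And>q. q \<in> carrier Q \<Longrightarrow> \<phi> q \<in> hom N N"
    and one: "\<And>x. x \<in> carrier N \<Longrightarrow> \<phi> \<one>\<^bsub>Q\<^esub> x = x"
    and mult: "\<And>q r x. q \<in> carrier Q \<Longrightarrow> r \<in> carrier Q \<Longrightarrow> x \<in> carrier N \<Longrightarrow> \<phi> (q \<otimes>\<^bsub>Q\<^esub> r) x = \<phi> q (\<phi> r x)"
  shows "group (semidirect_product N Q \<phi>)"
proof -
  interpret N: group N by fact
  interpret Q: group Q by fact
  have cl: "\<phi> q x \<in> carrier N" if "q \<in> carrier Q" "x \<in> carrier N" for q x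
    using hom[OF that(1)] that(2) by (auto simp: hom_def)
  have hm: "\<phi> q (x \<otimes>\<^bsub>N\<^esub> y) = \<phi> q x \<otimes>\<^bsub>N\<^esub> \<phi> q y" if "q \<in> carrier Q" "x \<in> carrier N" "y \<in> carrier N" for q x y
    using hom[OF that(1)] that(2,3) by (auto simp: hom_def)
  have h1: "\<phi> q \<one>\<^bsub>N\<^esub> = \<one>\<^bsub>N\<^esub>" if "q \<in> carrier Q" for q
    by (rule hom_one[OF hom[OF that] N N])
  show ?thesis
  proof (rule groupI)
    fix a b c
    assume "a \<in> carrier (semidirect_product N Q \<phi>)" "b \<in> carrier (semidirect_product N Q \<phi>)"
      "c \<in> carrier (semidirect_product N Q \<phi>)"
    then show "a \<otimes>\<^bsub>semidirect_product N Q \<phi>\<^esub> b \<otimes>\<^bsub>semidirect_product N Q \<phi>\<^esub> c =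
      a \<otimes>\<^bsub>semidirect_product N Q \<phi>\<^esub> (b \<otimes>\<^bsub>semidirect_product N Q \<phi>\<^esub> c)"
      by (auto simp: semidirect_product_def cl hm mult N.m_assoc Q.m_assoc)
  next
    fix a assume "a \<in> carrier (semidirect_product N Q \<phi>)"
    then obtain x q where a: "a = (x, q)" "x \<in> carrier N" "q \<in> carrier Q" by (auto simp: semidirect_product_def)
    let ?b = "(\<phi> (inv\<^bsub>Q\<^esub> q) (inv\<^bsub>N\<^esub> x), inv\<^bsub>Q\<^esub> q)"
    have "?b \<in> carrier (semidirect_product N Q \<phi>)" using a cl by (simp add: semidirect_product_def)
    moreover have "?b \<otimes>\<^bsub>semidirect_product N Q \<phi>\<^esub> a = \<one>\<^bsub>semidirect_product N Q \<phi>\<^esub>"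
      using a hm[of "inv\<^bsub>Q\<^esub> q" "inv\<^bsub>N\<^esub> x" x] h1[of "inv\<^bsub>Q\<^esub> q"] by (simp add: semidirect_product_def)
    ultimately show "\<exists>b\<in>carrier (semidirect_product N Q \<phi>).
      b \<otimes>\<^bsub>semidirect_product N Q \<phi>\<^esub> a = \<one>\<^bsub>semidirect_product N Q \<phi>\<^esub>" by blast
  qed (auto simp: semidirect_product_def cl one)
qed

lemma cyclic_groupI_nat:
  assumes "group C" "x \<in> carrier C" "\<And>y. y \<in> carrier C \<Longrightarrow> \<exists>n::nat. y = x [^]\<^bsub>C\<^esub> n"
  shows "cyclic_group C"
proof -
  interpret group C by fact
  have "carrier C = range (\<lambda>n::int. x [^]\<^bsub>C\<^esub> n)"
  proof
    show "carrier C \<subseteq> range (\<lambda>n::int. x [^]\<^bsub>C\<^esub> n)"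
    proof
      fix y assume "y \<in> carrier C"
      then obtain n :: nat where "y = x [^]\<^bsub>C\<^esub> n" using assms(3) by blast
      then have "y = x [^]\<^bsub>C\<^esub> (int n)" by (simp add: int_pow_int)
      then show "y \<in> range (\<lambda>n::int. x [^]\<^bsub>C\<^esub> n)" by blast
    qed
  qed (use assms(2) in auto)
  then show ?thesis using cyclic_group assms(2) by blast
qed

text \<open>The series through \<open>N\<close> has two factors, which are epimorphic images of
  \<open>N\<close> and \<open>Q\<close> and so inherit cyclicity.\<close>

lemma semidirect_product_supersoluble:
  assumes N: "group N" "finite (carrier N)" "cyclic_group N"
    and Q: "group Q" "finite (carrier Q)" "cyclic_group Q"
    and hom: "\<And>q. q \<in> carrier Q \<Longrightarrow> \<phi> q \<in> hom N N"
    and one: "\<And>x. x \<in> carrier N \<Longrightarrow> \<phi> \<one>\<^bsub>Q\<^esub> x = x"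
    and mult: "\<And>q r x. q \<in> carrier Q \<Longrightarrow> r \<in> carrier Q \<Longrightarrow> x \<in> carrier N \<Longrightarrow> \<phi> (q \<otimes>\<^bsub>Q\<^esub> r) x = \<phi> q (\<phi> r x)"
  shows "supersoluble (semidirect_product N Q \<phi>)"
proof -
  let ?S = "semidirect_product N Q \<phi>"
  interpret N: group N by fact
  interpret Q: group Q by fact
  interpret S: group ?S by (rule semidirect_product_group[OF N(1) Q(1) hom one mult])
  have cS: "carrier ?S = carrier N \<times> carrier Q" by (simp add: semidirect_product_def)
  have mS: "(x, q) \<otimes>\<^bsub>?S\<^esub> (y, r) = (x \<otimes>\<^bsub>N\<^esub> \<phi> q y, q \<otimes>\<^bsub>Q\<^esub> r)" for x q y r by (simp add: semidirect_product_def)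
  have oS: "\<one>\<^bsub>?S\<^esub> = (\<one>\<^bsub>N\<^esub>, \<one>\<^bsub>Q\<^esub>)" by (simp add: semidirect_product_def)
  have cl: "\<phi> q x \<in> carrier N" if "q \<in> carrier Q" "x \<in> carrier N" for q x
    using hom[OF that(1)] that(2) by (auto simp: hom_def)
  have h1: "\<phi> q \<one>\<^bsub>N\<^esub> = \<one>\<^bsub>N\<^esub>" if "q \<in> carrier Q" for q
    by (rule hom_one[OF hom[OF that] N(1) N(1)])
  define N1 where "N1 = carrier N \<times> {\<one>\<^bsub>Q\<^esub>}"
  have "snd \<in> hom ?S Q" by (intro homI) (auto simp: cS semidirect_product_def)
  then interpret p: group_hom ?S Q snd by (intro group_hom.intro group_hom_axioms.intro S.group_axioms Q.group_axioms)
  have "kernel ?S Q snd = N1" by (auto simp: kernel_def cS N1_def)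
  then have N1: "N1 \<lhd> ?S" using p.normal_kernel by simp
  note N1s = S.normalD_subgroup[OF N1]
  have triv: "{\<one>\<^bsub>?S\<^esub>} \<lhd> ?S" by (rule S.one_is_normal)
  have "cyclic_group (factor_group ?S N1 {\<one>\<^bsub>?S\<^esub>})"
  proof (rule group.cyclic_group_epimorphic_image[OF N(1) _ N(3)])
    have n: "{\<one>\<^bsub>?S\<^esub>} \<lhd> ?S\<lparr>carrier := N1\<rparr>"
      by (rule S.normal_restrict_supergroup[OF N1s triv]) (simp add: subgroup.one_closed[OF N1s])
    show "group (factor_group ?S N1 {\<one>\<^bsub>?S\<^esub>})" by (rule normal.factorgroup_is_group[OF n])
    have h: "(\<lambda>x. (x, \<one>\<^bsub>Q\<^esub>)) \<in> hom N (?S\<lparr>carrier := N1\<rparr>)"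
      by (intro homI) (auto simp: N1_def mS one)
    have "(\<lambda>a. {\<one>\<^bsub>?S\<^esub>} #>\<^bsub>?S\<lparr>carrier := N1\<rparr>\<^esub> a) \<circ> (\<lambda>x. (x, \<one>\<^bsub>Q\<^esub>)) \<in> hom N (factor_group ?S N1 {\<one>\<^bsub>?S\<^esub>})"
      by (rule Group.hom_compose[OF h normal.r_coset_hom_Mod[OF n]])
    moreover have "((\<lambda>a. {\<one>\<^bsub>?S\<^esub>} #>\<^bsub>?S\<lparr>carrier := N1\<rparr>\<^esub> a) \<circ> (\<lambda>x. (x, \<one>\<^bsub>Q\<^esub>))) ` carrier N = carrier (factor_group ?S N1 {\<one>\<^bsub>?S\<^esub>})"
      unfolding carrier_FactGroup by (auto simp: N1_def)
    ultimately show "(\<lambda>a. {\<one>\<^bsub>?S\<^esub>} #>\<^bsub>?S\<lparr>carrier := N1\<rparr>\<^esub> a) \<circ> (\<lambda>x. (x, \<one>\<^bsub>Q\<^esub>)) \<in> epi N (factor_group ?S N1 {\<one>\<^bsub>?S\<^esub>})"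
      by (simp add: epi_def)
  qed
  moreover have "cyclic_group (factor_group ?S (carrier ?S) N1)"
  proof (rule group.cyclic_group_epimorphic_image[OF Q(1) _ Q(3)])
    have SS: "?S\<lparr>carrier := carrier ?S\<rparr> = ?S" by simp
    show "group (factor_group ?S (carrier ?S) N1)" unfolding SS by (rule normal.factorgroup_is_group[OF N1])
    have h: "(\<lambda>q. (\<one>\<^bsub>N\<^esub>, q)) \<in> hom Q ?S"
      by (intro homI) (auto simp: cS mS h1)
    have "(\<lambda>a. N1 #>\<^bsub>?S\<^esub> a) \<circ> (\<lambda>q. (\<one>\<^bsub>N\<^esub>, q)) \<in> hom Q (?S Mod N1)"
      by (rule Group.hom_compose[OF h normal.r_coset_hom_Mod[OF N1]])
    moreover have "((\<lambda>a. N1 #>\<^bsub>?S\<^esub> a) \<circ> (\<lambda>q. (\<one>\<^bsub>N\<^esub>, q))) ` carrier Q = carrier (?S Mod N1)"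
    proof
      show "((\<lambda>a. N1 #>\<^bsub>?S\<^esub> a) \<circ> (\<lambda>q. (\<one>\<^bsub>N\<^esub>, q))) ` carrier Q \<subseteq> carrier (?S Mod N1)"
        by (auto simp: carrier_FactGroup cS)
      show "carrier (?S Mod N1) \<subseteq> ((\<lambda>a. N1 #>\<^bsub>?S\<^esub> a) \<circ> (\<lambda>q. (\<one>\<^bsub>N\<^esub>, q))) ` carrier Q"
      proof
        fix A assume "A \<in> carrier (?S Mod N1)"
        then obtain x q where a: "x \<in> carrier N" "q \<in> carrier Q" "A = N1 #>\<^bsub>?S\<^esub> (x, q)"
          by (auto simp: carrier_FactGroup cS)
        have "(x, q) = (x, \<one>\<^bsub>Q\<^esub>) \<otimes>\<^bsub>?S\<^esub> (\<one>\<^bsub>N\<^esub>, q)" using a by (simp add: mS one)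
        then have "(x, q) \<in> N1 #>\<^bsub>?S\<^esub> (\<one>\<^bsub>N\<^esub>, q)"
          unfolding r_coset_def N1_def using a by blast
        moreover have "(\<one>\<^bsub>N\<^esub>, q) \<in> carrier ?S" using a by (simp add: cS)
        ultimately have "A = N1 #>\<^bsub>?S\<^esub> (\<one>\<^bsub>N\<^esub>, q)" using S.repr_independence[OF _ _ N1s] a(3) by blast
        then show "A \<in> ((\<lambda>a. N1 #>\<^bsub>?S\<^esub> a) \<circ> (\<lambda>q. (\<one>\<^bsub>N\<^esub>, q))) ` carrier Q" using a by auto
      qed
    qed
    ultimately show "(\<lambda>a. N1 #>\<^bsub>?S\<^esub> a) \<circ> (\<lambda>q. (\<one>\<^bsub>N\<^esub>, q)) \<in> epi Q (factor_group ?S (carrier ?S) N1)"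
      unfolding SS by (simp add: epi_def)
  qed
  moreover have "carrier ?S \<lhd> ?S" by (rule S.normal_self)
  moreover have "{\<one>\<^bsub>?S\<^esub>} \<subseteq> N1" "N1 \<subseteq> carrier ?S"
    using subgroup.one_closed[OF N1s] subgroup.subset[OF N1s] by auto
  moreover define F where "F = (\<lambda>i::nat. if i = 0 then {\<one>\<^bsub>?S\<^esub>} else if i = 1 then N1 else carrier ?S)"
  ultimately have "F 0 = {\<one>\<^bsub>?S\<^esub>} \<and> F 2 = carrier ?S \<and> (\<forall>i\<le>2. F i \<lhd> ?S) \<and>
      (\<forall>i<2. F i \<subseteq> F (Suc i) \<and> cyclic_group (factor_group ?S (F (Suc i)) (F i)))"
    using triv N1 by (auto simp: less_2_cases_iff)
  moreover have "finite (carrier ?S)" using N(2) Q(2) by (simp add: cS)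
  ultimately show ?thesis unfolding supersoluble_def using S.group_axioms by blast
qed

context fin_group
begin

text \<open>Every \<open>g\<close> acts on \<open>L/K\<close> as a power \<open>\<rho>\<^sup>n\<close> of a primitive root \<open>\<rho>\<close> modulo \<open>p\<close>; an element with the
  least positive exponent \<open>n\<close> generates \<open>G\<close> modulo the centralizer.\<close>

lemma factor_centralizer_cyclic:
  fixes p :: nat
  assumes p: "Factorial_Ring.prime p" and cL: "card L = p ^ l" and ch: "chief_factor G L K" and card: "card L = p * card K"
  shows "\<exists>h\<in>carrier G. \<forall>g\<in>carrier G. \<exists>q::nat. \<forall>x\<in>L. K #> cj g x = K #> cj (h [^] q) x"
proof -
  have L: "L \<lhd> G" "K \<lhd> G" "K \<subset> L" using ch by (auto simp: chief_factor_def)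
  note Ls = normalD_subgroup[OF L(1)] and Ks = normalD_subgroup[OF L(2)]
  note Lc = normal_carrierD[OF L(1)] and Kc = normal_carrierD[OF L(2)]
  obtain \<rho> where \<rho>: "residue_primroot p \<rho>" using prime_primitive_root_exists[OF prime_gt_1_nat[OF p] p] by blast
  have p1: "p - 1 > 0" using prime_gt_1_nat[OF p] by simp
  have xp: "x [^] p \<in> K" if "x \<in> L" for x by (rule chief_power[OF p L(1) cL ch order_refl that])
  have powc: "K #> x [^] a = K #> x [^] b" if x: "x \<in> L" and ab: "[a = b] (mod p)" for x and a b :: nat
  proof -
    interpret V: comm_group "factor_group G L K" by (rule factor_comm_group[OF p ch cL])
    have KL: "K \<subseteq> L" using L by blast
    have xV: "K #> x \<in> carrier (factor_group G L K)" using x by (auto simp: carrier_FactGroup)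
    have "(K #> x) [^]\<^bsub>factor_group G L K\<^esub> p = \<one>\<^bsub>factor_group G L K\<^esub>"
      using factor_pow[OF L(1,2) KL x] rcoset_eq_self_iff[OF Ks] xp[OF x] x Lc by simp
    from V.pow_cong[OF xV this ab] show ?thesis using factor_pow[OF L(1,2) KL x] by simp
  qed
  define R where "R g n \<longleftrightarrow> (\<forall>x\<in>L. K #> cj g x = K #> x [^] (\<rho> ^ n))" for g and n :: nat
  have ex: "\<exists>n. R g n" if g: "g \<in> carrier G" for g
  proof -
    obtain a :: nat where a: "\<forall>x\<in>L. K #> cj g x = K #> x [^] a"
      using power_action(1)[OF p L(1) cL ch card g] by blast
    obtain z where z: "z \<in> L" "z \<notin> K" using L(3) by blast
    have na: "\<not> p dvd a"
    proof
      assume "p dvd a"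
      then have "z [^] a \<in> K" using pow_mem_iff_dvd[OF p Ks Lc[OF z(1)] z(2) xp[OF z(1)]] by blast
      then have "K #> cj g z = K" using a z(1) rcoset_eq_self_iff[OF Ks] Lc by simp
      then have "cj g z \<in> K" using rcoset_eq_self_iff[OF Ks] g z(1) Lc by simp
      then have "cj (inv g) (cj g z) \<in> K" using normalD_cj[OF L(2)] g by blast
      then show False using g z Lc by simp
    qed
    have "coprime p (a mod p)" by (rule prime_imp_coprime[OF p]) (use \<open>\<not> p dvd a\<close> in \<open>simp add: dvd_mod_iff\<close>)
    then have "coprime (a mod p) p" by (simp only: coprime_commute)
    moreover have "0 < a mod p" using \<open>\<not> p dvd a\<close> by (simp add: dvd_eq_mod_eq_0)
    moreover have "a mod p \<le> p" by (rule less_imp_le[OF mod_less_divisor[OF prime_gt_0_nat[OF p]]])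
    ultimately have "a mod p \<in> totatives p" by (simp add: totatives_def)
    then have "a mod p \<in> (\<lambda>i. \<rho> ^ i mod p) ` {..<totient p}"
      using bij_betw_imp_surj_on[OF residue_primroot_is_generator[OF prime_gt_1_nat[OF p] \<rho>]] by simp
    then obtain n where n: "a mod p = \<rho> ^ n mod p" by (rule imageE)
    then have an: "[a = \<rho> ^ n] (mod p)" by (simp only: cong_def)
    have "R g n" unfolding R_def
    proof
      fix x assume x: "x \<in> L"
      show "K #> cj g x = K #> x [^] (\<rho> ^ n)" using bspec[OF a x] powc[OF x an] by simp
    qed
    then show ?thesis by blast
  qed
  have mul: "R (g \<otimes> h) (n + k)" if g: "g \<in> carrier G" "R g n" and h: "h \<in> carrier G" "R h k" for g h n k
    unfolding R_def
  proof
    fix x assume x: "x \<in> L"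
    have hx: "cj h x \<in> L" using normalD_cj[OF L(1) h(1) x] .
    have "K #> cj (g \<otimes> h) x = K #> cj g (cj h x)" using g h x Lc by (simp add: cj_cj)
    also have "\<dots> = K #> (cj h x) [^] (\<rho> ^ n)" using g(2) hx unfolding R_def by blast
    also have "\<dots> = K #> (x [^] (\<rho> ^ k)) [^] (\<rho> ^ n)"
      by (rule rcoset_cong_pow[OF L(2)]) (use h x Lc in \<open>auto simp: R_def\<close>)
    also have "\<dots> = K #> x [^] (\<rho> ^ (n + k))" using x Lc by (simp add: nat_pow_pow power_add mult.commute)
    finally show "K #> cj (g \<otimes> h) x = K #> x [^] (\<rho> ^ (n + k))" .
  qed
  have R1: "R \<one> 0" using Lc by (simp add: R_def)
  have powR: "R (h [^] (q::nat)) (q * n)" if h: "h \<in> carrier G" "R h n" for h q n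
  proof (induction q)
    case (Suc q)
    have "R (h [^] q \<otimes> h) (q * n + n)" by (rule mul) (use h Suc in auto)
    then show ?case by (simp add: add.commute)
  qed (use R1 in simp)
  have ndr: "\<not> p dvd \<rho>" using \<rho> p by (metis coprime_absorb_left not_prime_unit residue_primroot_def)
  have "[\<rho> ^ (p - 1) = 1] (mod p)" by (rule fermat_theorem[OF p ndr])
  \<comment> \<open>Exponents count only modulo \<open>p - 1\<close>. Giving 1 the exponent
    \<open>p - 1\<close> ensures that a least positive exponent exists even if all of
    \<open>G\<close> acts trivially.\<close>
  then have R1': "R \<one> (p - 1)"
    unfolding R_def using powc[of _ "\<rho> ^ (p - 1)" 1] Lc by simp
  define d where "d = (LEAST n. n > 0 \<and> (\<exists>g\<in>carrier G. R g n))"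
  have d: "d > 0 \<and> (\<exists>g\<in>carrier G. R g d)"
    unfolding d_def by (rule LeastI[of _ "p - 1"]) (use p1 R1' in auto)
  then obtain h where h: "h \<in> carrier G" "R h d" by blast
  have "\<exists>q::nat. \<forall>x\<in>L. K #> cj g x = K #> cj (h [^] q) x" if g: "g \<in> carrier G" for g
  proof -
    obtain n where n: "R g n" using ex g by blast
    define q r where "q = n div d" and "r = n mod d"
    have nq: "n = q * d + r" by (simp add: q_def r_def)
    have hq: "R (h [^] q) (q * d)" by (rule powR[OF h])
    have hqc: "h [^] q \<in> carrier G" using h by simp
    \<comment> \<open>Division with remainder: this element has the exponent \<open>r < d\<close>,
      so \<open>r\<close> is 0 by the choice of \<open>d\<close>.\<close>
    have "R (g \<otimes> inv (h [^] q)) r" unfolding R_def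
    proof
      fix x assume x: "x \<in> L"
      define y where "y = cj (inv (h [^] q)) x"
      have y: "y \<in> L" using normalD_cj[OF L(1) _ x, of "inv (h [^] q)"] hqc by (simp add: y_def)
      have xy: "x = cj (h [^] q) y" using hqc x Lc by (simp add: y_def)
      have "K #> cj (g \<otimes> inv (h [^] q)) x = K #> cj g y" using g hqc x Lc by (simp add: y_def cj_cj)
      also have "\<dots> = K #> y [^] (\<rho> ^ n)" using n y unfolding R_def by blast
      also have "\<dots> = K #> (y [^] (\<rho> ^ (q * d))) [^] (\<rho> ^ r)" using y Lc by (simp add: nat_pow_pow nq power_add)
      also have "\<dots> = K #> x [^] (\<rho> ^ r)"
        by (rule rcoset_cong_pow[OF L(2)]) (use hq y x Lc xy in \<open>auto simp: R_def\<close>)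
      finally show "K #> cj (g \<otimes> inv (h [^] q)) x = K #> x [^] (\<rho> ^ r)" .
    qed
    moreover have "g \<otimes> inv (h [^] q) \<in> carrier G" using g hqc by simp
    moreover have "r < d" using d by (simp add: r_def)
    ultimately have "r = 0" using not_less_Least[of r "\<lambda>n. n > 0 \<and> (\<exists>g\<in>carrier G. R g n)"]
      unfolding d_def[symmetric] by (cases "r = 0") auto
    then have "\<forall>x\<in>L. K #> cj g x = K #> cj (h [^] q) x" using n hq nq unfolding R_def by simp
    then show ?thesis by blast
  qed
  then show ?thesis using h by blast
qed

text \<open>Both parts of the semidirect product are cyclic, \<open>L/K\<close> by its order and
  \<open>G\<close> modulo the centralizer by \<open>factor_centralizer_cyclic\<close>, so
  \<open>semidirect_product_supersoluble\<close> applies.\<close>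

lemma prime_order_U_central:
  fixes p :: nat
  assumes p: "Factorial_Ring.prime p" and cL: "card L = p ^ l" and ch: "chief_factor G L K" and card: "card L = p * card K"
  shows "U_central G L K"
proof -
  have L: "L \<lhd> G" "K \<lhd> G" "K \<subseteq> L" "K \<subset> L" using ch by (auto simp: chief_factor_def)
  note Ls = normalD_subgroup[OF L(1)] and Ks = normalD_subgroup[OF L(2)]
  note Lc = normal_carrierD[OF L(1)] and Kc = normal_carrierD[OF L(2)]
  let ?C = "factor_centralizer G L K" and ?V = "factor_group G L K"
  have Ceq: "?C = {g \<in> carrier G. \<forall>x\<in>L. cmt g x \<in> K}"
  proof -
    have "K #> (g \<otimes> x \<otimes> inv g) = K #> x \<longleftrightarrow> cmt g x \<in> K" if "g \<in> carrier G" "x \<in> L" for g x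
      using cmt_mem_iff_rcoset[OF L(2) that(1) Lc[OF that(2)]] by (simp add: conjugate_def)
    then show ?thesis unfolding factor_centralizer_def by blast
  qed
  have C: "?C \<lhd> G" unfolding Ceq by (rule centralizer_normal[OF L(2,1)])
  note Cs = normalD_subgroup[OF C] and Cc = normal_carrierD[OF C]
  have Ctriv: "K #> cj c x = K #> x" if "c \<in> ?C" "x \<in> L" for c x
    using that cmt_mem_iff_rcoset[OF L(2) _ Lc[OF that(2)], of c] unfolding Ceq by blast
  interpret V: comm_group ?V by (rule factor_comm_group[OF p ch cL])
  have cV: "carrier ?V = (\<lambda>x. K #> x) ` L" by (simp add: carrier_FactGroup)
  \<comment> \<open>On representatives the set-valued \<open>conj_action\<close> is ordinary
    conjugation; everything below about it is derived from this equation.\<close>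
  have act: "conj_action G (?C #> g) (K #> x) = K #> cj g x" if g: "g \<in> carrier G" and x: "x \<in> L" for g x
  proof
    have xc: "x \<in> carrier G" using x Lc by blast
    have gx: "cj g x \<in> L" by (rule normalD_cj[OF L(1) g x])
    show "conj_action G (?C #> g) (K #> x) \<subseteq> K #> cj g x"
    proof
      fix w assume "w \<in> conj_action G (?C #> g) (K #> x)"
      then obtain c k where ck: "c \<in> ?C" "k \<in> K" "w = cj (c \<otimes> g) (k \<otimes> x)"
        unfolding conj_action_def r_coset_def conjugate_def by blast
      have cc: "c \<in> carrier G" "k \<in> carrier G" using ck Cc Kc by auto
      have kx: "k \<otimes> x \<in> L" using ck(2) x L(3) subgroup.m_closed[OF Ls] by blast
      have "K #> w = K #> cj c (cj g (k \<otimes> x))" using ck cc g xc by (simp add: cj_cj)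
      also have "\<dots> = K #> cj g (k \<otimes> x)" by (rule Ctriv[OF ck(1) normalD_cj[OF L(1) g kx]])
      also have "\<dots> = K #> cj g x"
      proof (rule rcoset_cong_cj[OF L(2) g])
        show "K #> (k \<otimes> x) = K #> x" using rcoset_eq_iff[OF Ks, of "k \<otimes> x" x] cc xc ck by (simp add: m_assoc)
      qed (use cc xc in auto)
      finally have "K #> w = K #> cj g x" .
      moreover have "w \<in> K #> w" using rcos_self[OF _ Ks] ck cc g xc by simp
      ultimately show "w \<in> K #> cj g x" by simp
    qed
    show "K #> cj g x \<subseteq> conj_action G (?C #> g) (K #> x)"
    proof
      fix w assume "w \<in> K #> cj g x"
      then obtain k where k: "k \<in> K" "w = k \<otimes> cj g x" unfolding r_coset_def by blast
      have kc: "k \<in> carrier G" using k Kc by blast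
      have "w = g \<otimes> (cj (inv g) k \<otimes> x) \<otimes> inv g"
        using k kc g xc cj_mult[of g "cj (inv g) k" x] by (simp add: conjugate_def[of G g "cj (inv g) k \<otimes> x", symmetric])
      moreover have "cj (inv g) k \<otimes> x \<in> K #> x" using normalD_cj[OF L(2) _ k(1), of "inv g"] g unfolding r_coset_def by blast
      moreover have "g \<in> ?C #> g" by (rule rcos_self[OF g Cs])
      ultimately show "w \<in> conj_action G (?C #> g) (K #> x)" unfolding conj_action_def by blast
    qed
  qed
  have "supersoluble (semidirect_product ?V (G Mod ?C) (conj_action G))"
  proof (rule semidirect_product_supersoluble)
    show "group ?V" by (rule V.is_group)
    show "finite (carrier ?V)" using finite_subgroup[OF Ls] by (simp add: cV)
    interpret Q: fin_group "G Mod ?C" by (rule Mod_fin_group[OF C])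
    show "group (G Mod ?C)" "finite (carrier (G Mod ?C))" by (rule Q.is_group, rule Q.fin)
    have cQ: "carrier (G Mod ?C) = (\<lambda>g. ?C #> g) ` carrier G" by (simp add: carrier_FactGroup)
    show "cyclic_group ?V"
    proof -
      obtain z where z: "z \<in> L" "z \<notin> K" using L by blast
      have zc: "z \<in> carrier G" using z Lc by blast
      have zp: "z [^] p \<in> K" by (rule chief_power[OF p L(1) cL ch order_refl z(1)])
      have gen: "generate G {z} = range (\<lambda>n::nat. z [^] n)" using generate_singleton_finite zc by simp
      have e: "subgroup (generate G {z} <#> K) G" "card (generate G {z} <#> K) = p * card K"
        using prime_extension[OF p Ks zc z(2) zp] normalD_cj[OF L(2) zc] by auto
      have "generate G {z} \<subseteq> L" using gen nat_pow_mem[OF Ls z(1)] by auto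
      then have "generate G {z} <#> K \<subseteq> L" using set_mult_subset[OF Ls] L by blast
      then have eq: "generate G {z} <#> K = L" using subgroup_eqI[OF e(1) Ls] e card by simp
      show ?thesis
      proof (rule cyclic_groupI_nat[OF V.is_group, of "K #> z"])
        show "K #> z \<in> carrier ?V" using z by (auto simp: cV)
        fix A assume "A \<in> carrier ?V"
        then obtain x where x: "x \<in> L" "A = K #> x" by (auto simp: cV)
        have "x \<in> generate G {z} <#> K" using x eq by simp
        then obtain i :: nat and k where ik: "k \<in> K" "x = z [^] i \<otimes> k" unfolding gen mem_set_mult by blast
        have "x \<otimes> inv (z [^] i) = cj (z [^] i) k" using ik zc by (simp add: conjugate_def)
        then have "x \<otimes> inv (z [^] i) \<in> K" using normalD_cj[OF L(2)] ik zc by simp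
        then have "K #> x = K #> z [^] i" using rcoset_eq_iff[OF Ks] Lc x zc by blast
        then show "\<exists>n::nat. A = (K #> z) [^]\<^bsub>?V\<^esub> n" using factor_pow[OF L(1-3) z(1)] x by auto
      qed
    qed
    show "cyclic_group (G Mod ?C)"
    proof -
      obtain h where h: "h \<in> carrier G" "\<forall>g\<in>carrier G. \<exists>q::nat. \<forall>x\<in>L. K #> cj g x = K #> cj (h [^] q) x"
        using factor_centralizer_cyclic[OF p cL ch card] by blast
      show ?thesis
      proof (rule cyclic_groupI_nat[OF Q.is_group, of "?C #> h"])
        show "?C #> h \<in> carrier (G Mod ?C)" using h by (auto simp: cQ)
        fix A assume "A \<in> carrier (G Mod ?C)"
        then obtain g where g: "g \<in> carrier G" "A = ?C #> g" by (auto simp: cQ)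
        obtain q :: nat where q: "\<forall>x\<in>L. K #> cj g x = K #> cj (h [^] q) x" using h g by blast
        have hq: "h [^] q \<in> carrier G" using h by simp
        have "cmt (g \<otimes> inv (h [^] q)) x \<in> K" if x: "x \<in> L" for x
        proof -
          define y where "y = cj (inv (h [^] q)) x"
          have y: "y \<in> L" "y \<in> carrier G" using normalD_cj[OF L(1) _ x, of "inv (h [^] q)"] hq Lc by (auto simp: y_def)
          have "K #> cj (g \<otimes> inv (h [^] q)) x = K #> cj g y" using g hq x Lc by (simp add: y_def cj_cj)
          also have "\<dots> = K #> cj (h [^] q) y" using q y by blast
          also have "cj (h [^] q) y = x" using hq x Lc by (simp add: y_def)
          finally show ?thesis using cmt_mem_iff_rcoset[OF L(2)] g hq x Lc by simp
        qed
        then have "g \<otimes> inv (h [^] q) \<in> ?C" using g hq unfolding Ceq by simp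
        then have "?C #> g = ?C #> h [^] q" using rcoset_eq_iff[OF Cs g(1) hq] by simp
        then show "\<exists>n::nat. A = (?C #> h) [^]\<^bsub>G Mod ?C\<^esub> n" using g rcoset_pow[OF C h(1)] by auto
      qed
    qed
    show "conj_action G A \<in> hom ?V ?V" if A: "A \<in> carrier (G Mod ?C)" for A
    proof -
      obtain g where g: "g \<in> carrier G" "A = ?C #> g" using A by (auto simp: cQ)
      show ?thesis
      proof (rule homI)
        fix U assume "U \<in> carrier ?V"
        then show "conj_action G A U \<in> carrier ?V" using act[OF g(1)] g normalD_cj[OF L(1) g(1)] by (auto simp: cV)
      next
        fix U Y assume "U \<in> carrier ?V" "Y \<in> carrier ?V"
        then obtain x y where xy: "x \<in> L" "y \<in> L" "U = K #> x" "Y = K #> y" by (auto simp: cV)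
        have "U <#> Y = K #> (x \<otimes> y)" using normal.rcos_sum[OF L(2)] xy Lc by simp
        then have "conj_action G A (U <#> Y) = K #> (cj g x \<otimes> cj g y)"
          using act[OF g(1) subgroup.m_closed[OF Ls xy(1,2)]] g xy Lc by (simp add: cj_mult)
        also have "\<dots> = conj_action G A U <#> conj_action G A Y"
          using normal.rcos_sum[OF L(2)] xy g Lc act[OF g(1)] by simp
        finally show "conj_action G A (U \<otimes>\<^bsub>?V\<^esub> Y) = conj_action G A U \<otimes>\<^bsub>?V\<^esub> conj_action G A Y" by simp
      qed
    qed
    show "conj_action G \<one>\<^bsub>G Mod ?C\<^esub> U = U" if U: "U \<in> carrier ?V" for U
    proof -
      obtain x where x: "x \<in> L" "U = K #> x" using U by (auto simp: cV)
      have "?C #> \<one> = ?C" using subgroup.subset[OF Cs] by simp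
      then show ?thesis using act[OF one_closed x(1)] x Lc by simp
    qed
    show "conj_action G (A \<otimes>\<^bsub>G Mod ?C\<^esub> B) U = conj_action G A (conj_action G B U)"
      if AB: "A \<in> carrier (G Mod ?C)" "B \<in> carrier (G Mod ?C)" and U: "U \<in> carrier ?V" for A B U
    proof -
      obtain g where g: "g \<in> carrier G" "A = ?C #> g" using AB(1) by (auto simp: cQ)
      obtain h where h: "h \<in> carrier G" "B = ?C #> h" using AB(2) by (auto simp: cQ)
      obtain x where x: "x \<in> L" "U = K #> x" using U by (auto simp: cV)
      have "A <#> B = ?C #> (g \<otimes> h)" using normal.rcos_sum[OF C] g h by simp
      then have "conj_action G (A <#> B) U = K #> cj (g \<otimes> h) x" using act[OF _ x(1), of "g \<otimes> h"] g h x by simp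
      also have "\<dots> = K #> cj g (cj h x)" using g h x Lc by (simp add: cj_cj)
      also have "\<dots> = conj_action G A (conj_action G B U)"
        using act[OF h(1) x(1)] act[OF g(1) normalD_cj[OF L(1) h(1) x(1)]] g h x by simp
      finally show ?thesis by simp
    qed
  qed
  then show ?thesis unfolding U_central_def .
qed

text \<open>The Jordan-Hoelder argument carries the order \<open>p\<close> from the factors of the
  series to every chief factor below \<open>P\<close>.\<close>

lemma p_series_subset_Z_U:
  fixes p :: nat
  assumes p: "Factorial_Ring.prime p" and P: "card P = p ^ m" and ser: "p_series G p {\<one>} P"
  shows "P \<subseteq> Z_U G"
proof -
  have Pn: "P \<lhd> G" using p_series_normal(2)[OF ser] .
  note Ps = normalD_subgroup[OF Pn]
  have "U_central G L K" if ch: "chief_factor G L K" and LP: "L \<subseteq> P" for L K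
  proof -
    have L: "L \<lhd> G" "K \<lhd> G" "K \<subset> L" using ch by (auto simp: chief_factor_def)
    have "card L dvd p ^ m" using card_subgroup_dvd[OF normalD_subgroup[OF L(1)] Ps LP] P by simp
    then obtain l where l: "card L = p ^ l" using divides_primepow_nat[OF p] by blast
    have "{\<one>} \<inter> L \<subseteq> K" using subgroup.one_closed[OF normalD_subgroup[OF L(2)]] by blast
    from p_series_chief_card[OF p ch ser this] have "card L = p * card K" using LP L(3) by blast
    then show ?thesis by (rule prime_order_U_central[OF p l ch])
  qed
  then have "U_hypercentral G P" using Pn unfolding U_hypercentral_def by blast
  then show ?thesis unfolding Z_U_def by (auto intro: generate.incl)
qed

end

theorem theoremB:
  fixes G :: "('a, 'b) monoid_scheme" and p :: nat and P D :: "'a set"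
  assumes "group G" and "finite (carrier G)"
    and "Factorial_Ring.prime p"
    and "P \<lhd> G" and "\<exists>m. card P = p ^ m"
    and "subgroup D G" and "D \<subseteq> P" and "1 \<le> card D" and "card D < card P"
    and "\<And>H n. subgroup H G \<Longrightarrow> H \<subset> P \<Longrightarrow> n \<in> {0, 1::nat} \<Longrightarrow> card H = p ^ n * card D \<Longrightarrow>
           Pi_supplemented G H \<or> has_p_supersoluble_supplement p G H"
    and "\<not> quaternion_free p (G\<lparr>carrier := P\<rparr>) \<Longrightarrow> card D = 1 \<Longrightarrow>
           (\<forall>H. subgroup H G \<and> H \<subseteq> P \<and> cyclic_group (G\<lparr>carrier := H\<rparr>) \<and> card H = 4 \<longrightarrow>
             Pi_supplemented G H \<or> has_p_supersoluble_supplement 2 G H)"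
  shows "P \<subseteq> Z_U G"
proof -
  interpret fin_group G using assms(1,2) by (intro fin_group.intro fin_group_axioms.intro)
  note p = assms(3) and Pn = assms(4)
  obtain m where cP: "card P = p ^ m" using assms(5) by blast
  note Ps = normalD_subgroup[OF Pn] and Pc = normal_carrierD[OF Pn]
  have "card D dvd p ^ m" using card_subgroup_dvd[OF assms(6) Ps assms(7)] cP by simp
  then obtain k where k: "card D = p ^ k" using divides_primepow_nat[OF p] by blast
  have km: "k < m" using assms(9) k cP prime_power_less_iff[OF p] by simp
  have sup: "controlled G p P H" if "subgroup H G" "H \<subseteq> P" "Pi_supplemented G H \<or> has_p_supersoluble_supplement p G H" for H
    using that Pi_supplemented_controlled[OF p Pn cP] p_supersoluble_supplement_controlled[OF p Pn cP] by blast
  have ctrl: "controlled G p P H" if H: "subgroup H G" "H \<subset> P" "card H = p ^ k \<or> card H = p ^ Suc k" for H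
  proof -
    have "Pi_supplemented G H \<or> has_p_supersoluble_supplement p G H"
      using assms(10)[OF H(1,2), of 0] assms(10)[OF H(1,2), of 1] H(3) k by auto
    then show ?thesis using sup H by blast
  qed
  have "p_series G p {\<one>\<^bsub>G\<^esub>} P"
  proof (cases "k = 0")
    case False
    \<comment> \<open>The quotient by the trivial subgroup is only a change of type: it replaces
      \<open>G\<close> by an isomorphic plain monoid, for which the induction was stated.\<close>
    obtain G' :: "'a monoid" and f where "fin_group_epi G G' f {\<one>\<^bsub>G\<^esub>}" using exists_quotient[OF one_is_normal] by blast
    then interpret E: fin_group_epi G G' f "{\<one>\<^bsub>G\<^esub>}" .
    have oneP: "{\<one>\<^bsub>G\<^esub>} \<subseteq> P" using subgroup.one_closed[OF Ps] by simp
    have prefP: "E.pre (f ` P) = P" by (rule E.pre_image[OF Ps oneP])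
    have fPc: "f ` P \<subseteq> carrier G'" using E.image_subgroup[OF Ps] by (rule subgroup.subset)
    have cfP: "card (f ` P) = p ^ m" using E.card_pre[OF fPc] prefP cP by simp
    have "p_series G' p {\<one>\<^bsub>G'\<^esub>} (f ` P)"
    proof (rule p_series_of_controlled_subgroups[OF p E.G'.fin_group_axioms E.image_normal[OF Pn] cfP _ km])
      show "1 \<le> k" using False by simp
      fix H assume H: "subgroup H G'" "H \<subset> f ` P" "card H = p ^ k \<or> card H = p ^ Suc k"
      have Hc: "H \<subseteq> carrier G'" using H(1) by (rule subgroup.subset)
      have "E.pre H \<subseteq> P" using E.pre_mono[of H "f ` P"] H(2) prefP by auto
      moreover have "E.pre H \<noteq> P" using E.image_pre[OF Hc] H(2) by auto
      moreover have "card (E.pre H) = card H" using E.card_pre[OF Hc] by simp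
      ultimately have "controlled G p P (E.pre H)" using ctrl[OF E.pre_subgroup[OF H(1)]] H(3) by auto
      then show "controlled G' p (f ` P) H"
        using E.controlled_quotient[OF p Pn oneP H(1)] H(2) by blast
    qed
    then show ?thesis using E.p_series_pre prefP by fastforce
  next
    case k0: True
    show ?thesis
    proof (cases "m = 1")
      \<comment> \<open>Here the subgroup of order \<open>p\<close> is \<open>P\<close> itself,
        about which the hypothesis on proper subgroups is silent; but then the step from 1 to
        \<open>P\<close> is already a series.\<close>
      case True
      then have "card P = p * card {\<one>\<^bsub>G\<^esub>}" using cP by simp
      then show ?thesis
        using p_series.step[OF p_series.refl[OF one_is_normal] Pn] subgroup.one_closed[OF Ps] by blast
    next
      case False
      then have m1: "1 < m" using km by simp
      show ?thesis
      proof (rule p_series_of_controlled_elements[OF p Pn cP])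
        fix x assume x: "x \<in> P" "x \<noteq> \<one>\<^bsub>G\<^esub>" "x [^]\<^bsub>G\<^esub> p = \<one>\<^bsub>G\<^esub>"
        have xc: "x \<in> carrier G" using x Pc by blast
        have gs: "subgroup (generate G {x}) G" "generate G {x} \<subseteq> P"
          using generate_is_subgroup[of "{x}"] generate_subgroup_incl[OF _ Ps, of "{x}"] xc x(1) by auto
        have "ord x dvd p" using pow_eq_id[OF xc] x(3) by simp
        moreover have "ord x \<noteq> 1" using ord_eq_1[OF xc] x(2) by simp
        ultimately have "ord x = p" using p by (metis prime_nat_iff)
        then have cg: "card (generate G {x}) = p ^ Suc k" using generate_pow_card[OF xc] k0 by simp
        then have "generate G {x} \<noteq> P" using cP m1 k0 prime_power_less_iff[OF p, of "Suc k" m] by auto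
        then show "controlled G p P (generate G {x})" using ctrl[OF gs(1)] gs(2) cg by blast
      next
        fix x assume x: "p = 2" "\<not> quaternion_free 2 (G\<lparr>carrier := P\<rparr>)" "x \<in> P" "x \<otimes>\<^bsub>G\<^esub> x \<noteq> \<one>\<^bsub>G\<^esub>" "x [^]\<^bsub>G\<^esub> (4::nat) = \<one>\<^bsub>G\<^esub>"
        have xc: "x \<in> carrier G" using x Pc by blast
        have gs: "subgroup (generate G {x}) G" "generate G {x} \<subseteq> P"
          using generate_is_subgroup[of "{x}"] generate_subgroup_incl[OF _ Ps, of "{x}"] xc x(3) by auto
        have "ord x dvd 2 ^ 2" using pow_eq_id[OF xc, of 4] x(5) by simp
        then obtain i where i: "ord x = 2 ^ i" "i \<le> 2" using divides_primepow_nat[of 2 "ord x" 2] two_is_prime_nat by blast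
        have "\<not> ord x dvd 2" using pow_eq_id[OF xc, of 2] x(4) pow_two[OF xc] by simp
        then have "i \<noteq> 0" "i \<noteq> 1" using i(1) by (metis one_dvd power_0, metis dvd_refl power_one_right)
        then have "i = 2" using i(2) by linarith
        then have cg: "card (generate G {x}) = 4" using generate_pow_card[OF xc] i by simp
        have "cyclic_group (G\<lparr>carrier := generate G {x}\<rparr>)"
        proof (rule cyclic_groupI_nat[OF subgroup_imp_group[OF gs(1)], of x])
          show "x \<in> carrier (G\<lparr>carrier := generate G {x}\<rparr>)" using generate.incl[of x "{x}" G] by simp
          show "\<exists>n::nat. y = x [^]\<^bsub>G\<lparr>carrier := generate G {x}\<rparr>\<^esub> n"
            if "y \<in> carrier (G\<lparr>carrier := generate G {x}\<rparr>)" for y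
            using that generate_singleton_finite[OF fin xc] by (auto simp: nat_pow_consistent[symmetric])
        qed
        then have "Pi_supplemented G (generate G {x}) \<or> has_p_supersoluble_supplement p G (generate G {x})"
          using assms(11) x(1,2) k k0 gs cg by simp
        then show "controlled G p P (generate G {x})" using sup gs by blast
      qed
    qed
  qed
  then show ?thesis by (rule p_series_subset_Z_U[OF p cP])
qed

end
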